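(* Let $\mathbf{k}$ be a field of characteristic zero, and let $\mathcal{P}$ be a quadratic symmetric operad over $\mathbf{k}$ minimally generated by a finite-dimensional $\mathbb{S}$-module $X=X(2)$ with a minimal $\mathbb{S}$-module of relations $R=R(3)\subset\mathcal{F}(X)$. Let $c=\dim X$ and $d=\dim R$. If $d\le 3c^2/8$, then there is a coefficient-wise inequality of formal power series $$\mathcal{P}(z)\ \ge\ \Bigl(z-\frac{c}{2}z^2+\frac{d}{6}z^3\Bigr)^{[-1]},$$ where $g^{[-1]}$ denotes the composition inverse of a power series $g$. In particular, $$\frac{(2n)!}{(n-1)!}\,z_1^{-n}\ \le\ \dim\mathcal{P}(n+1)\ \le\ \frac{(2n)!}{n!}\left(\frac{c}{2}\right)^n,\qquad\text{where } z_1=3\,\frac{c/2-\sqrt{c^2/4-2d/3}}{d}.$$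
   Context: An $\mathbb{S}$-module is a sequence $Q=\{Q(n)\}$ of $\mathbf{k}$-linear representations $Q(n)$ of the symmetric groups $S_n$. The generating series of a symmetric operad $\mathcal{P}$ is the exponential one, $\mathcal{P}(z)=\sum_{n\ge 1}\frac{\dim\mathcal{P}(n)}{n!}z^n$, where $\mathcal{P}(n)$ is the $n$-th component of $\mathcal{P}$. All operads are symmetric $\mathbf{k}$-linear connected operads with identity: there are no operations of arity $0$ and $\mathcal{P}(1)=\mathbf{k}\cdot\mathrm{id}$. Put $\mathcal{P}_+=\mathcal{P}(2)\oplus\mathcal{P}(3)\oplus\cdots$. The minimal $\mathbb{S}$-module of generators $X\subset\mathcal{P}_+$ is an $\mathbb{S}$-submodule generating $\mathcal{P}$ and mapping isomorphically onto $\mathcal{P}_+/(\mathcal{P}_+\circ\mathcal{P}_+)$, where $\mathcal{P}_+\circ\mathcal{P}_+$ denotes the span of all compositions of elements of $\mathcal{P}_+$. $\mathcal{F}(X)$ denotes the free symmetric operad generated by $X$. A minimal $\mathbb{S}$-module of relations is a minimal $\mathbb{S}$-submodule $R\subset\mathcal{F}(X)$ generating, as an operadic ideal, the kernel of the natural surjection $\mathcal{F}(X)\to\mathcal{P}$. The operad is quadratic if it has generators of arity $2$ and relations of arity $3$ only, i.e. $X=X(2)$ and $R=R(3)$.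
   Formalization: The lower bound is stated with (2n)!/n! instead of the printed (2n)!/(n-1)!, which is false (for c=2, d=1, n=2 it exceeds dim P(3)=11 and even the upper bound 12); for d=0, where z_1 reads 0/0, z_1 is taken as its limit 2/c. *)

theory Defs
  imports
    Complex_Main
    "HOL-Library.Poly_Mapping"
    "HOL-Combinatorics.Permutations"
    "HOL-Computational_Algebra.Formal_Power_Series"
begin

section \<open>Symmetric operads\<close>

text \<open>
  All components of an operad are subspaces of one ambient vector space; nothing is assumed about
  the position of different components relative to each other, so the operations carry the
  arities of their arguments.  Inputs are numbered from 0 and \<open>S\<^sub>n\<close> is the group of permutations of
  \<open>{..<n}\<close>.

  The intended reading of the operations is
  \<^item> \<open>(\<sigma> p)(x\<^sub>0, \<dots>, x\<^bsub>n-1\<^esub>) = p(x\<^bsub>\<sigma> 0\<^esub>, \<dots>, x\<^bsub>\<sigma> (n-1)\<^esub>)\<close> for \<open>act n \<sigma> p\<close>, which is a left action;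
  \<^item> \<open>p(x\<^sub>0, \<dots>, x\<^bsub>i-1\<^esub>, q(x\<^sub>i, \<dots>, x\<^bsub>i+n-1\<^esub>), x\<^bsub>i+n\<^esub>, \<dots>, x\<^bsub>m+n-2\<^esub>)\<close> for the partial composition
    \<open>cmp m n i p q\<close> of \<open>p\<close> of arity \<open>m\<close> and \<open>q\<close> of arity \<open>n\<close>.
\<close>

record ('k, 'a) operad =
  scl :: "'k \<Rightarrow> 'a \<Rightarrow> 'a"
  ops :: "nat \<Rightarrow> 'a set"
  act :: "nat \<Rightarrow> (nat \<Rightarrow> nat) \<Rightarrow> 'a \<Rightarrow> 'a"
  cmp :: "nat \<Rightarrow> nat \<Rightarrow> nat \<Rightarrow> 'a \<Rightarrow> 'a \<Rightarrow> 'a"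
  unt :: 'a

text \<open>
  \<open>outer n i a\<close> is the position in \<open>p \<circ>\<^sub>i q\<close> of the input \<open>a \<noteq> i\<close> of \<open>p\<close>, where \<open>q\<close> has arity \<open>n\<close>.
\<close>

definition outer :: "nat \<Rightarrow> nat \<Rightarrow> nat \<Rightarrow> nat" where
  "outer n i a = (if a < i then a else a + n - 1)"

text \<open>
  The permutation \<open>\<rho>\<close> with \<open>(\<sigma> p) \<circ>\<^bsub>\<sigma> i\<^esub> (\<tau> q) = \<rho> (p \<circ>\<^sub>i q)\<close>: it sends the \<open>n\<close> inputs of \<open>q\<close>, which
  occupy the positions \<open>i, \<dots>, i+n-1\<close>, to the block that starts at \<open>\<sigma> i\<close>.
\<close>

definition block_perm :: "nat \<Rightarrow> nat \<Rightarrow> (nat \<Rightarrow> nat) \<Rightarrow> (nat \<Rightarrow> nat) \<Rightarrow> nat \<Rightarrow> nat" where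
  "block_perm n i \<sigma> \<tau> k =
     (if k < i then outer n (\<sigma> i) (\<sigma> k)
      else if k < i + n then \<sigma> i + \<tau> (k - i)
      else outer n (\<sigma> i) (\<sigma> (k + 1 - n)))"

locale symmetric_operad = vector_space "scl P"
  for P :: "('k::field, 'a::ab_group_add) operad" +
  assumes subspace_ops: "subspace (ops P n)"
    and act_closed: "\<sigma> permutes {..<n} \<Longrightarrow> p \<in> ops P n \<Longrightarrow> act P n \<sigma> p \<in> ops P n"
    and act_add: "\<sigma> permutes {..<n} \<Longrightarrow> p \<in> ops P n \<Longrightarrow> q \<in> ops P n \<Longrightarrow>
      act P n \<sigma> (p + q) = act P n \<sigma> p + act P n \<sigma> q"
    and act_scale: "\<sigma> permutes {..<n} \<Longrightarrow> p \<in> ops P n \<Longrightarrow>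
      act P n \<sigma> (scl P a p) = scl P a (act P n \<sigma> p)"
    and act_id: "p \<in> ops P n \<Longrightarrow> act P n id p = p"
    and act_compose: "\<sigma> permutes {..<n} \<Longrightarrow> \<tau> permutes {..<n} \<Longrightarrow> p \<in> ops P n \<Longrightarrow>
      act P n (\<sigma> \<circ> \<tau>) p = act P n \<sigma> (act P n \<tau> p)"
    and cmp_closed: "p \<in> ops P m \<Longrightarrow> q \<in> ops P n \<Longrightarrow> i < m \<Longrightarrow>
      cmp P m n i p q \<in> ops P (m + n - 1)"
    and cmp_add_left: "p \<in> ops P m \<Longrightarrow> p' \<in> ops P m \<Longrightarrow> q \<in> ops P n \<Longrightarrow> i < m \<Longrightarrow>
      cmp P m n i (p + p') q = cmp P m n i p q + cmp P m n i p' q"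
    and cmp_add_right: "p \<in> ops P m \<Longrightarrow> q \<in> ops P n \<Longrightarrow> q' \<in> ops P n \<Longrightarrow> i < m \<Longrightarrow>
      cmp P m n i p (q + q') = cmp P m n i p q + cmp P m n i p q'"
    and cmp_scale_left: "p \<in> ops P m \<Longrightarrow> q \<in> ops P n \<Longrightarrow> i < m \<Longrightarrow>
      cmp P m n i (scl P a p) q = scl P a (cmp P m n i p q)"
    and cmp_scale_right: "p \<in> ops P m \<Longrightarrow> q \<in> ops P n \<Longrightarrow> i < m \<Longrightarrow>
      cmp P m n i p (scl P a q) = scl P a (cmp P m n i p q)"
    and cmp_equivariant: "\<sigma> permutes {..<m} \<Longrightarrow> \<tau> permutes {..<n} \<Longrightarrow>
      p \<in> ops P m \<Longrightarrow> q \<in> ops P n \<Longrightarrow> i < m \<Longrightarrow>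
      cmp P m n (\<sigma> i) (act P m \<sigma> p) (act P n \<tau> q)
        = act P (m + n - 1) (block_perm n i \<sigma> \<tau>) (cmp P m n i p q)"
    and cmp_sequential: "p \<in> ops P l \<Longrightarrow> q \<in> ops P m \<Longrightarrow> r \<in> ops P n \<Longrightarrow> i < l \<Longrightarrow> j < m \<Longrightarrow>
      cmp P (l + m - 1) n (i + j) (cmp P l m i p q) r
        = cmp P l (m + n - 1) i p (cmp P m n j q r)"
    and cmp_parallel: "p \<in> ops P l \<Longrightarrow> q \<in> ops P m \<Longrightarrow> r \<in> ops P n \<Longrightarrow> i < k \<Longrightarrow> k < l \<Longrightarrow>
      cmp P (l + m - 1) n (k + m - 1) (cmp P l m i p q) r
        = cmp P (l + n - 1) m i (cmp P l n k p r) q"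
    and unt_closed: "unt P \<in> ops P 1"
    and cmp_unt_left: "q \<in> ops P n \<Longrightarrow> cmp P 1 n 0 (unt P) q = q"
    and cmp_unt_right: "p \<in> ops P m \<Longrightarrow> i < m \<Longrightarrow> cmp P m 1 i p (unt P) = p"

locale connected_operad = symmetric_operad +
  assumes ops_0: "ops P 0 = {0}"
    and ops_1: "ops P 1 = span {unt P}"
    and unt_nonzero: "unt P \<noteq> 0"

definition gen_series :: "('k::field, 'a::ab_group_add) operad \<Rightarrow> real fps" where
  "gen_series P =
     Abs_fps (\<lambda>n. if n = 0 then 0 else of_nat (vector_space.dim (scl P) (ops P n)) / fact n)"

section \<open>Submodules, generators, ideals and morphisms\<close>

definition S_submodule :: "('k::field, 'a::ab_group_add) operad \<Rightarrow> (nat \<Rightarrow> 'a set) \<Rightarrow> bool" where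
  "S_submodule P Q \<longleftrightarrow>
     (\<forall>n. module.subspace (scl P) (Q n) \<and> Q n \<subseteq> ops P n \<and>
          (\<forall>\<sigma> x. \<sigma> permutes {..<n} \<longrightarrow> x \<in> Q n \<longrightarrow> act P n \<sigma> x \<in> Q n))"

definition suboperad :: "('k::field, 'a::ab_group_add) operad \<Rightarrow> (nat \<Rightarrow> 'a set) \<Rightarrow> bool" where
  "suboperad P Q \<longleftrightarrow> S_submodule P Q \<and> unt P \<in> Q 1 \<and>
     (\<forall>m n i p q. i < m \<longrightarrow> p \<in> Q m \<longrightarrow> q \<in> Q n \<longrightarrow> cmp P m n i p q \<in> Q (m + n - 1))"

definition generates :: "('k::field, 'a::ab_group_add) operad \<Rightarrow> (nat \<Rightarrow> 'a set) \<Rightarrow> bool" where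
  "generates P X \<longleftrightarrow> (\<forall>Q. suboperad P Q \<longrightarrow> (\<forall>n. X n \<subseteq> Q n) \<longrightarrow> (\<forall>n. Q n = ops P n))"

definition operadic_ideal :: "('k::field, 'a::ab_group_add) operad \<Rightarrow> (nat \<Rightarrow> 'a set) \<Rightarrow> bool" where
  "operadic_ideal P J \<longleftrightarrow> S_submodule P J \<and>
     (\<forall>m n i p q. i < m \<longrightarrow> p \<in> ops P m \<longrightarrow> q \<in> ops P n \<longrightarrow> p \<in> J m \<or> q \<in> J n \<longrightarrow>
        cmp P m n i p q \<in> J (m + n - 1))"

definition ideal_generated ::
  "('k::field, 'a::ab_group_add) operad \<Rightarrow> (nat \<Rightarrow> 'a set) \<Rightarrow> nat \<Rightarrow> 'a set" where
  "ideal_generated P R n = \<Inter> {J n | J. operadic_ideal P J \<and> (\<forall>m. R m \<subseteq> J m)}"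

text \<open>
  The arity \<open>n\<close> component of \<open>P\<^sub>+ \<circ> P\<^sub>+\<close>.  Compositions in a symmetric operad include arbitrary
  renumberings of the inputs, whence the permutation \<open>\<sigma>\<close>.
\<close>

definition decomposables :: "('k::field, 'a::ab_group_add) operad \<Rightarrow> nat \<Rightarrow> 'a set" where
  "decomposables P n = module.span (scl P)
     {act P n \<sigma> (cmp P m l i p q) | \<sigma> m l i p q.
        2 \<le> m \<and> 2 \<le> l \<and> n = m + l - 1 \<and> i < m \<and> p \<in> ops P m \<and> q \<in> ops P l \<and>
        \<sigma> permutes {..<n}}"

text \<open>
  The last condition says that the projection from \<open>X\<close> to \<open>P\<^sub>+ / (P\<^sub>+ \<circ> P\<^sub>+)\<close> is bijective.
\<close>

definition minimal_generators ::
  "('k::field, 'a::ab_group_add) operad \<Rightarrow> (nat \<Rightarrow> 'a set) \<Rightarrow> bool" where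
  "minimal_generators P X \<longleftrightarrow>
     S_submodule P X \<and> X 0 = {0} \<and> X 1 = {0} \<and> generates P X \<and>
     (\<forall>n\<ge>2. \<forall>p\<in>ops P n. \<exists>!x. x \<in> X n \<and> p - x \<in> decomposables P n)"

definition operad_morphism ::
  "('k::field, 'a::ab_group_add) operad \<Rightarrow> ('k, 'b::ab_group_add) operad \<Rightarrow>
   (nat \<Rightarrow> 'a \<Rightarrow> 'b) \<Rightarrow> bool" where
  "operad_morphism P Q \<phi> \<longleftrightarrow>
     (\<forall>n. \<forall>p\<in>ops P n. \<phi> n p \<in> ops Q n) \<and>
     (\<forall>n. \<forall>p\<in>ops P n. \<forall>q\<in>ops P n. \<phi> n (p + q) = \<phi> n p + \<phi> n q) \<and>
     (\<forall>n a. \<forall>p\<in>ops P n. \<phi> n (scl P a p) = scl Q a (\<phi> n p)) \<and>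
     (\<forall>n \<sigma>. \<forall>p\<in>ops P n. \<sigma> permutes {..<n} \<longrightarrow> \<phi> n (act P n \<sigma> p) = act Q n \<sigma> (\<phi> n p)) \<and>
     (\<forall>m n i. \<forall>p\<in>ops P m. \<forall>q\<in>ops P n. i < m \<longrightarrow>
        \<phi> (m + n - 1) (cmp P m n i p q) = cmp Q m n i (\<phi> m p) (\<phi> n q)) \<and>
     \<phi> 1 (unt P) = unt Q"

section \<open>The free symmetric operad generated by an S-submodule\<close>

text \<open>
  The free operad is the span of trees with vertices decorated by \<open>X\<close> and leaves bijectively
  labelled by the inputs, modulo linearity and equivariance of the decoration at every vertex.
\<close>

datatype 'x tree = Leaf nat | Node 'x "'x tree list"

primrec leaves :: "'x tree \<Rightarrow> nat list" where
  "leaves (Leaf a) = [a]"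
| "leaves (Node x ts) = concat (map leaves ts)"

primrec decorated :: "(nat \<Rightarrow> 'x set) \<Rightarrow> 'x tree \<Rightarrow> bool" where
  "decorated X (Leaf a) \<longleftrightarrow> True"
| "decorated X (Node x ts) \<longleftrightarrow> x \<in> X (length ts) \<and> list_all id (map (decorated X) ts)"

primrec tree_subst :: "(nat \<Rightarrow> 'x tree) \<Rightarrow> 'x tree \<Rightarrow> 'x tree" where
  "tree_subst f (Leaf a) = f a"
| "tree_subst f (Node x ts) = Node x (map (tree_subst f) ts)"

definition tree_monomials :: "(nat \<Rightarrow> 'x set) \<Rightarrow> nat \<Rightarrow> 'x tree set" where
  "tree_monomials X n = {t. decorated X t \<and> distinct (leaves t) \<and> set (leaves t) = {..<n}}"

definition relabel :: "(nat \<Rightarrow> nat) \<Rightarrow> 'x tree \<Rightarrow> 'x tree" where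
  "relabel \<sigma> = tree_subst (\<lambda>a. Leaf (\<sigma> a))"

definition graft :: "nat \<Rightarrow> nat \<Rightarrow> 'x tree \<Rightarrow> 'x tree \<Rightarrow> 'x tree" where
  "graft n i s t = tree_subst (\<lambda>a. if a = i then relabel (\<lambda>b. i + b) t else Leaf (outer n i a)) s"

definition pm_scale :: "'k::field \<Rightarrow> ('t \<Rightarrow>\<^sub>0 'k) \<Rightarrow> ('t \<Rightarrow>\<^sub>0 'k)" where
  "pm_scale c v = Poly_Mapping.map ((*) c) v"

lemma lookup_pm_scale: "Poly_Mapping.lookup (pm_scale c v) t = c * Poly_Mapping.lookup v t"
  by (simp add: pm_scale_def Poly_Mapping.map.rep_eq when_def)

interpretation pm: vector_space "pm_scale :: 'k::field \<Rightarrow> ('t \<Rightarrow>\<^sub>0 'k) \<Rightarrow> _"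
  by unfold_locales
    (auto intro!: poly_mapping_eqI simp: lookup_pm_scale lookup_add algebra_simps)

definition mon :: "'t \<Rightarrow> ('t \<Rightarrow>\<^sub>0 'k::field)" where
  "mon t = Poly_Mapping.single t 1"

definition lin_ext :: "('t \<Rightarrow> ('u \<Rightarrow>\<^sub>0 'k)) \<Rightarrow> ('t \<Rightarrow>\<^sub>0 'k::field) \<Rightarrow> ('u \<Rightarrow>\<^sub>0 'k)" where
  "lin_ext f v = (\<Sum>t\<in>Poly_Mapping.keys v. pm_scale (Poly_Mapping.lookup v t) (f t))"

text \<open>
  The relations also relate trees whose leaves are labelled by arbitrary, possibly repeated,
  numbers; they preserve the multiset of labels, so this has no effect on the trees used below.
\<close>

inductive_set tree_relations ::
  "('k::field, 'a::ab_group_add) operad \<Rightarrow> (nat \<Rightarrow> 'a set) \<Rightarrow> ('a tree \<Rightarrow>\<^sub>0 'k) set"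
  for P :: "('k, 'a) operad" and X :: "nat \<Rightarrow> 'a set" where
  add: "x \<in> X (length ts) \<Longrightarrow> y \<in> X (length ts) \<Longrightarrow>
    mon (Node (x + y) ts) - mon (Node x ts) - mon (Node y ts) \<in> tree_relations P X"
| scale: "x \<in> X (length ts) \<Longrightarrow>
    mon (Node (scl P a x) ts) - pm_scale a (mon (Node x ts)) \<in> tree_relations P X"
| equivariance: "x \<in> X (length ts) \<Longrightarrow> \<sigma> permutes {..<length ts} \<Longrightarrow>
    mon (Node (act P (length ts) \<sigma> x) ts) - mon (Node x (permute_list \<sigma> ts))
      \<in> tree_relations P X"
| vertex: "r \<in> tree_relations P X \<Longrightarrow> x \<in> X (length us + 1 + length vs) \<Longrightarrow>
    lin_ext (\<lambda>t. mon (Node x (us @ t # vs))) r \<in> tree_relations P X"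

text \<open>
  The quotient by the span of the relations is realised inside the space of formal linear
  combinations of trees, as the image of a linear projection that has this span as its kernel.
\<close>

definition quotient_projection ::
  "('k::field, 'a::ab_group_add) operad \<Rightarrow> (nat \<Rightarrow> 'a set) \<Rightarrow>
   ('a tree \<Rightarrow>\<^sub>0 'k) \<Rightarrow> ('a tree \<Rightarrow>\<^sub>0 'k)" where
  "quotient_projection P X =
     (SOME \<pi>. Vector_Spaces.linear pm_scale pm_scale \<pi> \<and> (\<forall>v. \<pi> (\<pi> v) = \<pi> v) \<and>
        {v. \<pi> v = 0} = module.span pm_scale (tree_relations P X))"

lemma quotient_projection:
  "Vector_Spaces.linear pm_scale pm_scale (quotient_projection P X)"
  "quotient_projection P X (quotient_projection P X v) = quotient_projection P X v"
  "{v. quotient_projection P X v = 0} = module.span pm_scale (tree_relations P X)"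
proof -
  define W where "W = pm.span (tree_relations P X)"
  have subW: "pm.subspace W" by (simp add: W_def)
  obtain B where B: "B \<subseteq> W" "pm.independent B" "W = pm.span B"
    using pm.basis_exists[of W] subW by (metis pm.span_eq_iff pm.span_minimal subset_antisym)
  define E where "E = pm.extend_basis B"
  have E: "B \<subseteq> E" "pm.independent E" "pm.span E = UNIV"
    using B(2) by (simp_all add: E_def pm.extend_basis_superset pm.independent_extend_basis)
  interpret pp: vector_space_pair pm_scale pm_scale by unfold_locales
  define f where "f = pp.construct E (\<lambda>b. if b \<in> B then 0 else b)"
  have lin: "Vector_Spaces.linear pm_scale pm_scale f"
    unfolding f_def by (rule pp.linear_construct[OF E(2)])
  interpret f: Vector_Spaces.linear pm_scale pm_scale f by (rule lin)
  have fb: "f b = (if b \<in> B then 0 else b)" if "b \<in> E" for b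
    unfolding f_def by (rule pp.construct_basis[OF E(2) that])
  have diff: "v - f v \<in> W" for v
  proof -
    have "v \<in> pm.span E" using E(3) by simp
    then show ?thesis
    proof (induction rule: pm.span_induct_alt)
      case base
      show ?case using subW by (simp add: f.zero pm.subspace_0)
    next
      case (step c x y)
      have x: "x - f x \<in> W"
        using step.hyps fb[of x] B(1) subW by (auto simp: pm.subspace_0)
      have eq: "pm_scale c x + y - f (pm_scale c x + y) = pm_scale c (x - f x) + (y - f y)"
        by (simp add: f.add f.scale pm.scale_right_diff_distrib)
      show ?case
        unfolding eq using x step.IH subW by (blast intro: pm.subspace_add pm.subspace_scale)
    qed
  qed
  have zero: "f w = 0" if "w \<in> W" for w
  proof -
    have "w \<in> pm.span B" using that B(3) by simp
    then show ?thesis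
    proof (induction rule: pm.span_induct_alt)
      case base
      show ?case by (simp add: f.zero)
    next
      case (step c x y)
      then show ?case using fb[of x] E(1) by (auto simp: f.add f.scale)
    qed
  qed
  have "f (f v) = f v" for v
    using zero[OF diff[of v]] by (simp add: f.diff)
  moreover have "{v. f v = 0} = W"
    using zero diff by (metis (mono_tags, lifting) Collect_cong diff_zero mem_Collect_eq
        subsetI subset_antisym)
  ultimately have "\<exists>\<pi>. Vector_Spaces.linear pm_scale pm_scale \<pi> \<and> (\<forall>v. \<pi> (\<pi> v) = \<pi> v) \<and>
      {v. \<pi> v = 0} = pm.span (tree_relations P X)"
    using lin unfolding W_def by blast
  from someI_ex[OF this]
  show "Vector_Spaces.linear pm_scale pm_scale (quotient_projection P X)"
    "quotient_projection P X (quotient_projection P X v) = quotient_projection P X v"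
    "{v. quotient_projection P X v = 0} = pm.span (tree_relations P X)"
    unfolding quotient_projection_def by blast+
qed

definition free_operad ::
  "('k::field, 'a::ab_group_add) operad \<Rightarrow> (nat \<Rightarrow> 'a set) \<Rightarrow> ('k, 'a tree \<Rightarrow>\<^sub>0 'k) operad" where
  "free_operad P X =
     (let \<pi> = quotient_projection P X in
      \<lparr> scl = pm_scale,
        ops = (\<lambda>n. \<pi> ` module.span pm_scale (mon ` tree_monomials X n)),
        act = (\<lambda>n \<sigma> u. \<pi> (lin_ext (\<lambda>t. mon (relabel \<sigma> t)) u)),
        cmp = (\<lambda>m n i u v. \<pi> (lin_ext (\<lambda>s. lin_ext (\<lambda>t. mon (graft n i s t)) v) u)),
        unt = \<pi> (mon (Leaf 0)) \<rparr>)"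

definition corolla :: "nat \<Rightarrow> 'x \<Rightarrow> 'x tree" where
  "corolla n x = Node x (map Leaf [0..<n])"

text \<open>
  The morphism from the free operad to \<open>P\<close> that extends the inclusion of \<open>X\<close>.  It is surjective if
  \<open>X\<close> generates \<open>P\<close>.
\<close>

definition natural_surjection ::
  "('k::field, 'a::ab_group_add) operad \<Rightarrow> (nat \<Rightarrow> 'a set) \<Rightarrow>
   (nat \<Rightarrow> ('a tree \<Rightarrow>\<^sub>0 'k) \<Rightarrow> 'a) \<Rightarrow> bool" where
  "natural_surjection P X \<pi> \<longleftrightarrow> operad_morphism (free_operad P X) P \<pi> \<and>
     (\<forall>n. \<forall>x\<in>X n. \<pi> n (quotient_projection P X (mon (corolla n x))) = x)"

definition generates_kernel ::
  "('k::field, 'a::ab_group_add) operad \<Rightarrow> (nat \<Rightarrow> 'a \<Rightarrow> 'b::zero) \<Rightarrow> (nat \<Rightarrow> 'a set) \<Rightarrow> bool" where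
  "generates_kernel F \<pi> R \<longleftrightarrow> (\<forall>n. ideal_generated F R n = {f \<in> ops F n. \<pi> n f = 0})"

definition minimal_relations ::
  "('k::field, 'a::ab_group_add) operad \<Rightarrow> (nat \<Rightarrow> 'a set) \<Rightarrow>
   (nat \<Rightarrow> ('a tree \<Rightarrow>\<^sub>0 'k) \<Rightarrow> 'a) \<Rightarrow> (nat \<Rightarrow> ('a tree \<Rightarrow>\<^sub>0 'k) set) \<Rightarrow> bool" where
  "minimal_relations P X \<pi> R \<longleftrightarrow>
     S_submodule (free_operad P X) R \<and> generates_kernel (free_operad P X) \<pi> R \<and>
     (\<forall>R'. S_submodule (free_operad P X) R' \<longrightarrow> (\<forall>n. R' n \<subseteq> R n) \<longrightarrow>
        generates_kernel (free_operad P X) \<pi> R' \<longrightarrow> R' = R)"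

section \<open>The smaller root\<close>

text \<open>
  The smaller root of \<open>1 - (c/2) z + (d/6) z\<^sup>2\<close>.  For \<open>d = 0\<close> the usual expression reads \<open>0/0\<close>; the
  root of the linear polynomial \<open>1 - (c/2) z\<close>, which is also the limit as \<open>d \<rightarrow> 0\<close>, is used instead.
\<close>

definition root\<^sub>1 :: "real \<Rightarrow> real \<Rightarrow> real" where
  "root\<^sub>1 c d = (if d = 0 then 2 / c else 3 * ((c / 2 - sqrt (c\<^sup>2 / 4 - 2 * d / 3)) / d))"

end

theory Submission
  imports Defs
begin

text \<open>
  Let \<open>J\<close> be the kernel of the natural surjection from the free operad \<open>F\<close> on \<open>X\<close> onto \<open>P\<close>, that is,
  the ideal generated by \<open>R\<close>.  A tree of arity \<open>n \<ge> 2\<close> is a generator applied to two smaller trees, and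
  an element of \<open>J\<close> is a sum of trees with a relation at some vertex: either the relation sits at
  the root, or it lies inside one of the two subtrees of the root.  Hence \<open>P(n)\<close> is the quotient of
  \<open>(X \<circ> P)(n)\<close> by the image of \<open>(R \<circ> P)(n)\<close>.  Counting dimensions gives, coefficient by coefficient
  and with \<open>a = c/2\<close> and \<open>b = d/6\<close>,

  \<^item> \<open>P - a P\<^sup>2 \<le> z\<close> (\<open>gen_series_le\<close>) and

  \<^item> \<open>P - a P\<^sup>2 + b P\<^sup>3 \<ge> z\<close> (\<open>gen_series_ge\<close>), an analogue of the Golod-Shafarevich inequality.

  The condition \<open>d \<le> 3 c\<^sup>2 / 8\<close> makes the polynomial \<open>1 - a z + b z\<^sup>2\<close> split as \<open>(1 - u z) (1 - v z)\<close> with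
  \<open>u, v \<ge> 0\<close>.  The second inequality then reads \<open>P \<ge> z / ((1 - u P) (1 - v P))\<close>, where the right-hand side
  is monotone in \<open>P\<close>, and induction on the degree gives \<open>P \<ge> g\<close> for the inverse series \<open>g\<close>
  (\<open>fps_cubic_comparison\<close>).  By the same lemma \<open>g\<close> dominates the solution \<open>h\<close> of \<open>h = z + u h\<^sup>2\<close>, where
  \<open>1/u\<close> is the smaller root if \<open>c > 0\<close>; the coefficients of \<open>h\<close> are Catalan numbers times powers of \<open>u\<close>.  The
  upper bound is the comparison of \<open>P\<close> with the solution of \<open>h = z + a h\<^sup>2\<close>.

  For the lower bound on dimensions, trees are evaluated in \<open>P\<close> through the given surjection.  The
  coordinate map \<open>Psi n\<close> sends a tree with root \<open>x\<close> and subtrees \<open>s\<close>, \<open>t\<close> to \<open>x \<otimes> s \<otimes> t\<close>, with \<open>s\<close> and \<open>t\<close>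
  evaluated in \<open>P\<close>, written in terms of a basis of \<open>(X \<circ> P)(n)\<close>.  It respects the relations of the free
  operad.  The linear combinations of trees that contain a relation represent an operadic ideal that
  contains \<open>R\<close> and therefore \<open>J\<close> (\<open>kernel_subset_ideal\<close>); \<open>Psi n\<close> kills those whose relation is not at
  the root (\<open>Psi_vertex_null\<close>), and its values on the others span a space of dimension at most
  \<open>dim (R \<circ> P)(n)\<close> (\<open>relation_image_span\<close>).  A basis of \<open>(X \<circ> P)(n)\<close> can be lifted to trees, so the
  kernel of \<open>(X \<circ> P)(n) \<rightarrow> P(n)\<close> lies in that space (\<open>card_indices_le\<close>).
\<close>

unbundle fps_syntax

section \<open>Comparison of power series\<close>

lemma fps_mult_nth_mono:
  fixes f g F G :: "real fps"
  assumes "\<And>i. i \<le> N \<Longrightarrow> 0 \<le> f $ i \<and> f $ i \<le> F $ i"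
    and "\<And>i. i \<le> N \<Longrightarrow> 0 \<le> g $ i \<and> g $ i \<le> G $ i"
  shows "0 \<le> (f * g) $ N \<and> (f * g) $ N \<le> (F * G) $ N"
proof
  show "0 \<le> (f * g) $ N"
    using assms by (auto simp: fps_mult_nth intro!: sum_nonneg mult_nonneg_nonneg)
  show "(f * g) $ N \<le> (F * G) $ N"
    unfolding fps_mult_nth
  proof (rule sum_mono, rule mult_mono)
    fix i assume "i \<in> {0..N}"
    then have i: "i \<le> N" "N - i \<le> N" by auto
    show "f $ i \<le> F $ i" "g $ (N - i) \<le> G $ (N - i)" "0 \<le> g $ (N - i)"
      using assms i by auto
    show "0 \<le> F $ i" using assms(1)[OF i(1)] by linarith
  qed
qed

lemma fps_inverse_one_minus_rec:
  fixes f :: "real fps"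
  assumes "f $ 0 = 0"
  shows "inverse (1 - fps_const u * f) = 1 + fps_const u * (f * inverse (1 - fps_const u * f))"
proof -
  have "(1 - fps_const u * f) * inverse (1 - fps_const u * f) = 1"
    by (rule inverse_mult_eq_1') (simp add: assms)
  then show ?thesis by (simp add: algebra_simps)
qed

lemma fps_inverse_one_minus_mono:
  fixes f F :: "real fps"
  assumes "0 \<le> u" "f $ 0 = 0" "F $ 0 = 0"
    and le: "\<And>i. i \<le> N \<Longrightarrow> 0 \<le> f $ i \<and> f $ i \<le> F $ i"
  shows "0 \<le> inverse (1 - fps_const u * f) $ N \<and>
    inverse (1 - fps_const u * f) $ N \<le> inverse (1 - fps_const u * F) $ N"
  using le
proof (induction N rule: less_induct)
  case (less N)
  let ?a = "inverse (1 - fps_const u * f)" and ?A = "inverse (1 - fps_const u * F)"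
  have split: "(k * h) $ N = (\<Sum>i=1..N. k $ i * h $ (N - i))" if "k $ 0 = 0" for k h :: "real fps"
    using that by (simp add: fps_mult_nth sum.atLeast_Suc_atMost)
  have a: "?a $ N = (if N = 0 then 1 else 0) + u * (\<Sum>i=1..N. f $ i * ?a $ (N - i))"
    by (subst fps_inverse_one_minus_rec[OF assms(2)]) (simp add: split[OF assms(2)])
  have A: "?A $ N = (if N = 0 then 1 else 0) + u * (\<Sum>i=1..N. F $ i * ?A $ (N - i))"
    by (subst fps_inverse_one_minus_rec[OF assms(3)]) (simp add: split[OF assms(3)])
  have IH: "0 \<le> ?a $ (N - i) \<and> ?a $ (N - i) \<le> ?A $ (N - i)" if "i \<in> {1..N}" for i
    using that less by simp
  have f: "0 \<le> f $ i \<and> f $ i \<le> F $ i" if "i \<in> {1..N}" for i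
    using that less.prems[of i] by simp
  have "0 \<le> (\<Sum>i=1..N. f $ i * ?a $ (N - i))"
    using f IH by (intro sum_nonneg mult_nonneg_nonneg) auto
  moreover have "(\<Sum>i=1..N. f $ i * ?a $ (N - i)) \<le> (\<Sum>i=1..N. F $ i * ?A $ (N - i))"
  proof (intro sum_mono mult_mono)
    fix i assume i: "i \<in> {1..N}"
    show "f $ i \<le> F $ i" "?a $ (N - i) \<le> ?A $ (N - i)" "0 \<le> ?a $ (N - i)" "0 \<le> F $ i"
      using f[OF i] IH[OF i] by auto
  qed
  ultimately show ?case
    unfolding a A using assms(1) by (auto intro!: mult_left_mono add_nonneg_nonneg)
qed

lemma fps_cubic_factor:
  fixes f :: "real fps"
  shows "f - fps_const (u + v) * f ^ 2 + fps_const (u * v) * f ^ 3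
    = f * (1 - fps_const u * f) * (1 - fps_const v * f)"
  by (simp add: algebra_simps power2_eq_square power3_eq_cube flip: fps_const_add fps_const_mult)

lemma fps_cubic_solve:
  fixes f Z :: "real fps"
  assumes "f $ 0 = 0"
    and "f - fps_const (u + v) * f ^ 2 + fps_const (u * v) * f ^ 3 = Z"
  shows "f = Z * (inverse (1 - fps_const u * f) * inverse (1 - fps_const v * f))"
proof -
  have 1: "(1 - fps_const w * f) * inverse (1 - fps_const w * f) = 1" for w
    by (rule inverse_mult_eq_1') (simp add: assms)
  have "Z * (inverse (1 - fps_const u * f) * inverse (1 - fps_const v * f))
    = f * ((1 - fps_const u * f) * inverse (1 - fps_const u * f)) *
      ((1 - fps_const v * f) * inverse (1 - fps_const v * f))"
    unfolding assms(2)[symmetric] fps_cubic_factor by (simp only: mult_ac)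
  then show ?thesis by (simp add: 1)
qed

text \<open>
  Since \<open>1 - (u + v) z + u v z\<^sup>2 = (1 - u z) (1 - v z)\<close>, a solution of the cubic inequality satisfies
  \<open>F \<ge> z / ((1 - u F) (1 - v F))\<close>, and the right-hand side is monotone in \<open>F\<close>.  Its coefficient of
  degree \<open>n\<close> only involves coefficients of \<open>F\<close> of smaller degree, so that the comparison with the
  solution of the equation is an induction on the degree.
\<close>

lemma fps_cubic_comparison:
  fixes F g :: "real fps"
  assumes "0 \<le> u" "0 \<le> v" "F $ 0 = 0" "g $ 0 = 0"
    and nonneg: "\<And>n. 0 \<le> F $ n"
    and ge: "\<And>n. fps_X $ n \<le> (F - fps_const (u + v) * F ^ 2 + fps_const (u * v) * F ^ 3) $ n"
    and eq: "g - fps_const (u + v) * g ^ 2 + fps_const (u * v) * g ^ 3 = fps_X"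
  shows "0 \<le> g $ n \<and> g $ n \<le> F $ n"
proof (induction n rule: less_induct)
  case (less n)
  show ?case
  proof (cases n)
    case 0
    then show ?thesis by (simp add: assms)
  next
    case (Suc m)
    define H where "H f = inverse (1 - fps_const u * f) * inverse (1 - fps_const v * f)"
      for f :: "real fps"
    define Z where "Z = F - fps_const (u + v) * F ^ 2 + fps_const (u * v) * F ^ 3"
    have F: "F = Z * H F"
      unfolding H_def by (rule fps_cubic_solve[OF assms(3)]) (simp add: Z_def)
    have g: "g = fps_X * H g"
      unfolding H_def by (rule fps_cubic_solve[OF assms(4) eq])
    have IH: "0 \<le> g $ i \<and> g $ i \<le> F $ i" if "i \<le> m" for i
      using less that Suc by simp
    have H_mono: "0 \<le> H g $ i \<and> H g $ i \<le> H F $ i" if "i \<le> m" for i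
      unfolding H_def using that IH assms
      by (intro fps_mult_nth_mono fps_inverse_one_minus_mono) auto
    have H_nonneg: "0 \<le> H F $ i" for i
      using fps_mult_nth_mono[of i "inverse (1 - fps_const u * F)" "inverse (1 - fps_const u * F)"
          "inverse (1 - fps_const v * F)" "inverse (1 - fps_const v * F)"]
        fps_inverse_one_minus_mono[OF assms(1) assms(3) assms(3)]
        fps_inverse_one_minus_mono[OF assms(2) assms(3) assms(3)] nonneg
      by (simp add: H_def)
    have X_nonneg: "0 \<le> (fps_X :: real fps) $ i" for i by (simp add: fps_X_def)
    have "g $ n = H g $ m" by (subst g) (simp add: Suc)
    moreover have "H g $ m \<le> H F $ m" "0 \<le> H g $ m" using H_mono[of m] by auto
    moreover have "H F $ m = (fps_X * H F) $ n" by (simp add: Suc)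
    moreover have "(fps_X * H F) $ n \<le> (Z * H F) $ n"
      using fps_mult_nth_mono[of n fps_X Z "H F" "H F"] ge X_nonneg H_nonneg by (auto simp: Z_def)
    moreover have "F $ n = (Z * H F) $ n" by (rule arg_cong[OF F])
    ultimately show ?thesis by linarith
  qed
qed

text \<open>
  The coefficients of the solution of \<open>h = z + u h\<^sup>2\<close> are Catalan numbers times powers of \<open>u\<close>.  The
  recurrence comes from the differential equation \<open>(1 - 4 u z) h' = 1 - 2 u h\<close>.
\<close>

lemma fps_quadratic_coeff:
  fixes h :: "real fps"
  assumes "h $ 0 = 0" and h: "h - fps_const u * h ^ 2 = fps_X"
  shows "h $ (n + 1) = fact (2 * n) / (fact n * fact (n + 1)) * u ^ n"
proof -
  let ?d = "1 - fps_const (2 * u) * h"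
  have "fps_deriv (h - fps_const u * h ^ 2) = 1" by (simp add: h)
  then have d1: "fps_deriv h * ?d = 1"
    by (simp add: fps_deriv_power algebra_simps flip: fps_const_mult)
  have "?d * ?d = 1 - fps_const (4 * u) * (h - fps_const u * h ^ 2)"
    by (simp add: algebra_simps power2_eq_square flip: fps_const_mult)
      (simp add: numeral_fps_const)
  then have d2: "?d * ?d = 1 - fps_const (4 * u) * fps_X" by (simp add: h)
  have "fps_deriv h * (1 - fps_const (4 * u) * fps_X) = ?d"
    unfolding d2[symmetric] using d1 by (simp add: mult.assoc[symmetric])
  then have "fps_deriv h - fps_const (4 * u) * (fps_X * fps_deriv h) = ?d"
    by (simp add: algebra_simps)
  then have coeff: "(fps_deriv h - fps_const (4 * u) * (fps_X * fps_deriv h)) $ k = ?d $ k" for k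
    by (rule arg_cong)
  have rec: "real (k + 1) * h $ (k + 1) - 4 * u * (real k * h $ k)
      = (if k = 0 then 1 else 0) - 2 * u * h $ k" for k
    using coeff[of k] by (cases k) (simp_all add: algebra_simps)
  show ?thesis
  proof (induction n)
    case 0
    show ?case using rec[of 0] by (simp add: assms)
  next
    case (Suc n)
    have "real (n + 2) * h $ (n + 2) = 2 * (2 * real n + 1) * u * h $ (n + 1)"
      using rec[of "n + 1"] by (simp add: algebra_simps)
    then have "h $ (n + 2) = 2 * (2 * real n + 1) * u * h $ (n + 1) / real (n + 2)"
      by (simp add: field_simps)
    also have "\<dots> = fact (2 * (n + 1)) / (fact (n + 1) * fact (n + 2)) * u ^ (n + 1)"
      unfolding Suc.IH by (simp add: divide_simps) (simp add: algebra_simps)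
    finally show ?case by (simp add: numeral_2_eq_2)
  qed
qed

lemma fps_quadratic_upper:
  fixes F h :: "real fps"
  assumes "0 \<le> a" "F $ 0 = 0" "h $ 0 = 0" and nonneg: "\<And>n. 0 \<le> F $ n"
    and le: "\<And>n. (F - fps_const a * F ^ 2) $ n \<le> fps_X $ n"
    and h: "h - fps_const a * h ^ 2 = fps_X"
  shows "F $ n \<le> h $ n"
proof (induction n rule: less_induct)
  case (less n)
  have h': "h = fps_X + fps_const a * h ^ 2" using h by (simp add: algebra_simps)
  have sq: "(k ^ 2) $ n = (\<Sum>i\<in>{1..<n}. k $ i * k $ (n - i))" if "k $ 0 = 0" for k :: "real fps"
    unfolding power2_eq_square fps_mult_nth using that
    by (intro sum.mono_neutral_right) (auto simp: Suc_le_eq)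
  have "(F ^ 2) $ n \<le> (h ^ 2) $ n"
    unfolding sq[OF assms(2)] sq[OF assms(3)]
    using less nonneg by (intro sum_mono mult_mono) (auto intro: order_trans)
  then have "a * (F ^ 2) $ n \<le> a * (h ^ 2) $ n" using assms(1) by (rule mult_left_mono)
  moreover have "F $ n \<le> fps_X $ n + a * (F ^ 2) $ n" using le[of n] by (simp add: algebra_simps)
  moreover have "h $ n = fps_X $ n + a * (h ^ 2) $ n" by (subst h') simp
  ultimately show ?case by linarith
qed

lemma fps_inv_cubic:
  fixes a b :: real
  defines "f \<equiv> fps_X - fps_const a * fps_X ^ 2 + fps_const b * fps_X ^ 3"
  shows "fps_inv f - fps_const a * fps_inv f ^ 2 + fps_const b * fps_inv f ^ 3 = fps_X"
    and "fps_inv f $ 0 = 0"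
proof -
  have 0: "f $ 0 = 0" by (simp add: f_def)
  have 1: "f $ 1 \<noteq> 0" by (simp add: f_def power2_eq_square power3_eq_cube mult.assoc)
  show z: "fps_inv f $ 0 = 0" by (simp add: fps_inv_def)
  have "f oo fps_inv f = fps_X" by (rule fps_inv_right[OF 0 1])
  then show "fps_inv f - fps_const a * fps_inv f ^ 2 + fps_const b * fps_inv f ^ 3 = fps_X"
    by (simp add: f_def fps_compose_add_distrib fps_compose_sub_distrib fps_compose_mult_distrib
        z[unfolded f_def] flip: fps_compose_power)
qed

text \<open>
  The factors of \<open>1 - (c/2) z + (d/6) z\<^sup>2\<close>.  With the convention for \<open>d = 0\<close> the reciprocal of the smaller
  root is the larger factor \<open>u\<close> in all cases, including \<open>c = 0\<close>, where both are 0.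
\<close>

lemma inverse_root:
  assumes "real d \<le> 3 * (real c)\<^sup>2 / 8"
  defines "u \<equiv> (real c / 2 + sqrt ((real c)\<^sup>2 / 4 - 2 * real d / 3)) / 2"
    and "v \<equiv> (real c / 2 - sqrt ((real c)\<^sup>2 / 4 - 2 * real d / 3)) / 2"
  shows "0 \<le> u" "0 \<le> v" "u + v = real c / 2" "u * v = real d / 6"
    "inverse (root\<^sub>1 (real c) (real d)) = u"
proof -
  define s where "s = sqrt ((real c)\<^sup>2 / 4 - 2 * real d / 3)"
  have s2: "s * s = (real c)\<^sup>2 / 4 - 2 * real d / 3"
    unfolding s_def by (rule real_sqrt_mult_self[THEN trans]) (use assms(1) in simp)
  have s0: "0 \<le> s" using assms(1) by (simp add: s_def)
  have "s \<le> sqrt ((real c)\<^sup>2 / 4)" unfolding s_def by (intro real_sqrt_le_mono) simp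
  then have sc: "s \<le> real c / 2" by (simp add: real_sqrt_divide)
  show u: "0 \<le> u" and v: "0 \<le> v" using s0 sc by (simp_all add: u_def v_def flip: s_def)
  show "u + v = real c / 2" by (simp add: u_def v_def field_simps)
  show uv: "u * v = real d / 6"
  proof -
    have "u * v = ((real c)\<^sup>2 / 4 - s * s) / 4"
      unfolding u_def v_def s_def[symmetric] by (simp add: power2_eq_square field_simps)
    then show ?thesis by (simp add: s2)
  qed
  show "inverse (root\<^sub>1 (real c) (real d)) = u"
  proof (cases "d = 0")
    case True
    then show ?thesis by (simp add: root\<^sub>1_def u_def real_sqrt_divide)
  next
    case False
    then have "v \<noteq> 0" using uv by auto
    have "root\<^sub>1 (real c) (real d) = 6 * v / real d"
      using False by (simp add: root\<^sub>1_def v_def field_simps)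
    also have "\<dots> = v / (u * v)" unfolding uv by simp
    finally show ?thesis using \<open>v \<noteq> 0\<close> by simp
  qed
qed

section \<open>Linear maps on formal linear combinations\<close>

text \<open>The linear extension of \<open>f\<close> to formal linear combinations, with values in any vector space.\<close>

definition extend ::
  "('k::zero \<Rightarrow> 'v \<Rightarrow> 'v::comm_monoid_add) \<Rightarrow> ('t \<Rightarrow> 'v) \<Rightarrow> ('t \<Rightarrow>\<^sub>0 'k) \<Rightarrow> 'v" where
  "extend s f v = (\<Sum>t\<in>Poly_Mapping.keys v. s (Poly_Mapping.lookup v t) (f t))"

lemma lin_ext_eq_extend: "lin_ext f = extend pm_scale f"
  by (simp add: fun_eq_iff lin_ext_def extend_def)

lemma extend_superset:
  assumes "vector_space s" "finite A" "Poly_Mapping.keys v \<subseteq> A"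
  shows "extend s f v = (\<Sum>t\<in>A. s (Poly_Mapping.lookup v t) (f t))"
proof -
  interpret vector_space s by fact
  show ?thesis
    unfolding extend_def using assms(2,3)
    by (intro sum.mono_neutral_left) (auto simp: in_keys_iff)
qed

lemma linear_extend:
  assumes "vector_space s"
  shows "Vector_Spaces.linear pm_scale s (extend s f)"
proof -
  interpret vector_space s by fact
  have "extend s f (u + v) = extend s f u + extend s f v" for u v
  proof -
    let ?A = "Poly_Mapping.keys u \<union> Poly_Mapping.keys v"
    have "Poly_Mapping.keys (u + v) \<subseteq> ?A" by (rule Poly_Mapping.keys_add)
    then show ?thesis
      using extend_superset[OF assms, of ?A]
      by (simp add: lookup_add scale_left_distrib sum.distrib)
  qed
  moreover have "extend s f (pm_scale a v) = s a (extend s f v)" for a v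
  proof -
    have "Poly_Mapping.keys (pm_scale a v) \<subseteq> Poly_Mapping.keys v"
      by (auto simp: in_keys_iff lookup_pm_scale)
    then show ?thesis
      using extend_superset[OF assms, of "Poly_Mapping.keys v"]
      by (simp add: lookup_pm_scale scale_sum_right)
  qed
  ultimately show ?thesis
    unfolding Vector_Spaces.linear_iff using assms pm.vector_space_axioms by blast
qed

lemmas linear_lin_ext = linear_extend[OF pm.vector_space_axioms, folded lin_ext_eq_extend]

lemma keys_mon [simp]: "Poly_Mapping.keys (mon t :: _ \<Rightarrow>\<^sub>0 'k::field) = {t}"
  by (simp add: mon_def)

lemma lookup_mon: "Poly_Mapping.lookup (mon t :: _ \<Rightarrow>\<^sub>0 'k::field) s = (if s = t then 1 else 0)"
  by (simp add: mon_def lookup_single when_def)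

lemma extend_mon [simp]: "vector_space s \<Longrightarrow> extend s f (mon t) = f t"
  by (simp add: extend_def lookup_mon vector_space_def)

lemma lin_ext_mon [simp]: "lin_ext f (mon t) = f t"
  by (simp add: lin_ext_eq_extend pm.vector_space_axioms)

interpretation lin_ext: Vector_Spaces.linear pm_scale pm_scale "lin_ext f"
  by (rule linear_lin_ext)

lemma pm_expand: "v = (\<Sum>t\<in>Poly_Mapping.keys v. pm_scale (Poly_Mapping.lookup v t) (mon t))"
proof (rule poly_mapping_eqI)
  fix t
  show "Poly_Mapping.lookup v t = Poly_Mapping.lookup
      (\<Sum>t\<in>Poly_Mapping.keys v. pm_scale (Poly_Mapping.lookup v t) (mon t)) t"
    by (simp add: lookup_sum lookup_pm_scale lookup_mon if_distrib in_keys_iff cong: if_cong)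
qed

lemma span_mon_iff: "v \<in> pm.span (mon ` A) \<longleftrightarrow> Poly_Mapping.keys (v :: _ \<Rightarrow>\<^sub>0 'k::field) \<subseteq> A"
proof
  assume "v \<in> pm.span (mon ` A)"
  then show "Poly_Mapping.keys v \<subseteq> A"
  proof (induction rule: pm.span_induct_alt)
    case (step c x y)
    then obtain t where "t \<in> A" "x = mon t" by auto
    moreover have "Poly_Mapping.keys (pm_scale c x + y) \<subseteq>
        Poly_Mapping.keys x \<union> Poly_Mapping.keys y"
      by (auto simp: in_keys_iff lookup_add lookup_pm_scale)
    ultimately show ?case using step.IH by auto
  qed auto
next
  assume "Poly_Mapping.keys v \<subseteq> A"
  then show "v \<in> pm.span (mon ` A)"
    by (subst pm_expand[of v]) (intro pm.span_sum pm.span_scale pm.span_base, auto)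
qed

lemma linear_lin_ext_eq:
  assumes "Vector_Spaces.linear pm_scale s h"
  shows "h (lin_ext f v) = extend s (\<lambda>t. h (f t)) v"
proof -
  interpret h: Vector_Spaces.linear pm_scale s h by fact
  show ?thesis
    by (simp add: lin_ext_def extend_def h.sum h.scale)
qed

lemma lin_ext_lin_ext: "lin_ext f (lin_ext g v) = lin_ext (\<lambda>t. lin_ext f (g t)) v"
  using linear_lin_ext_eq[OF linear_lin_ext] by (simp add: lin_ext_eq_extend)

lemma lin_ext_mon_id [simp]: "lin_ext mon v = v"
  by (simp add: lin_ext_def flip: pm_expand)

lemma lin_ext_cong: "(\<And>t. t \<in> Poly_Mapping.keys v \<Longrightarrow> f t = g t) \<Longrightarrow> lin_ext f v = lin_ext g v"
  by (simp add: lin_ext_def)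

lemma lin_ext_swap:
  "lin_ext (\<lambda>s. lin_ext (\<lambda>t. h s t) v) u = lin_ext (\<lambda>t. lin_ext (\<lambda>s. h s t) u) v"
proof -
  have "lin_ext (\<lambda>s. lin_ext (\<lambda>t. h s t) v) u =
      (\<Sum>s\<in>Poly_Mapping.keys u. \<Sum>t\<in>Poly_Mapping.keys v.
        pm_scale (Poly_Mapping.lookup u s * Poly_Mapping.lookup v t) (h s t))"
    by (simp add: lin_ext_def pm.scale_sum_right)
  also have "\<dots> = lin_ext (\<lambda>t. lin_ext (\<lambda>s. h s t) u) v"
    by (subst sum.swap) (simp add: lin_ext_def pm.scale_sum_right mult.commute)
  finally show ?thesis .
qed

lemma keys_lin_ext:
  "Poly_Mapping.keys (lin_ext f v :: _ \<Rightarrow>\<^sub>0 'k::field) \<subseteq>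
    (\<Union>t\<in>Poly_Mapping.keys v. Poly_Mapping.keys (f t))"
proof
  fix s assume "s \<in> Poly_Mapping.keys (lin_ext f v)"
  then have "(\<Sum>t\<in>Poly_Mapping.keys v. Poly_Mapping.lookup v t * Poly_Mapping.lookup (f t) s) \<noteq> 0"
    by (simp add: lin_ext_def in_keys_iff lookup_sum lookup_pm_scale)
  then obtain t where "t \<in> Poly_Mapping.keys v"
      "Poly_Mapping.lookup v t * Poly_Mapping.lookup (f t) s \<noteq> 0"
    by (rule sum.not_neutral_contains_not_neutral)
  then show "s \<in> (\<Union>t\<in>Poly_Mapping.keys v. Poly_Mapping.keys (f t))"
    by (auto simp: in_keys_iff intro!: bexI[of _ t])
qed

lemma lin_ext_closed:
  assumes "pm.subspace U" "\<And>t. t \<in> Poly_Mapping.keys v \<Longrightarrow> f t \<in> U"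
  shows "lin_ext f v \<in> U"
  unfolding lin_ext_def using assms by (intro pm.subspace_sum pm.subspace_scale) auto

lemma linear_image_span_closed:
  assumes "Vector_Spaces.linear pm_scale pm_scale h" "pm.subspace U"
    and "\<And>x. x \<in> S \<Longrightarrow> h x \<in> U" "v \<in> pm.span S"
  shows "h v \<in> U"
proof -
  interpret h: Vector_Spaces.linear pm_scale pm_scale h by fact
  have "h ` pm.span S \<subseteq> U"
    unfolding h.span_image[symmetric] using assms by (intro pm.span_minimal) auto
  then show ?thesis using assms(4) by auto
qed

section \<open>Substitution in trees\<close>

lemma leaves_tree_subst: "leaves (tree_subst f t) = concat (map (\<lambda>a. leaves (f a)) (leaves t))"
proof (induction t)
  case (Node x ts)
  then show ?case by (induction ts) auto
qed simp

lemma decorated_tree_subst: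
  "decorated X (tree_subst f t) \<longleftrightarrow> decorated X t \<and> (\<forall>a\<in>set (leaves t). decorated X (f a))"
  by (induction t) (auto simp: list_all_iff)

lemma tree_subst_tree_subst: "tree_subst f (tree_subst g t) = tree_subst (\<lambda>a. tree_subst f (g a)) t"
  by (induction t) auto

lemma tree_subst_cong:
  "(\<And>a. a \<in> set (leaves t) \<Longrightarrow> f a = g a) \<Longrightarrow> tree_subst f t = tree_subst g t"
  by (induction t) auto

lemma tree_subst_ident: "(\<And>a. a \<in> set (leaves t) \<Longrightarrow> f a = Leaf a) \<Longrightarrow> tree_subst f t = t"
  by (induction t) (auto intro: map_idI)

lemma leaves_relabel: "leaves (relabel f t) = map f (leaves t)"
  by (simp add: relabel_def leaves_tree_subst concat_map_singleton)

lemma decorated_relabel [simp]: "decorated X (relabel f t) = decorated X t"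
  by (simp add: relabel_def decorated_tree_subst)

lemma relabel_relabel: "relabel f (relabel g t) = relabel (f \<circ> g) t"
  by (simp add: relabel_def tree_subst_tree_subst)

lemma relabel_cong: "(\<And>a. a \<in> set (leaves t) \<Longrightarrow> f a = g a) \<Longrightarrow> relabel f t = relabel g t"
  unfolding relabel_def by (rule tree_subst_cong) auto

lemma relabel_ident: "(\<And>a. a \<in> set (leaves t) \<Longrightarrow> f a = a) \<Longrightarrow> relabel f t = t"
  unfolding relabel_def by (rule tree_subst_ident) auto

lemma relabel_Node [simp]: "relabel f (Node x ts) = Node x (map (relabel f) ts)"
  by (simp add: relabel_def)

lemma relabel_Leaf [simp]: "relabel f (Leaf a) = Leaf (f a)"
  by (simp add: relabel_def)

text \<open>Substitution and the formation of a root vertex, extended linearly.\<close>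

definition subst_comb :: "(nat \<Rightarrow> 'x tree) \<Rightarrow> ('x tree \<Rightarrow>\<^sub>0 'k::field) \<Rightarrow> ('x tree \<Rightarrow>\<^sub>0 'k)" where
  "subst_comb f = lin_ext (\<lambda>t. mon (tree_subst f t))"

definition vertex_comb ::
  "'x \<Rightarrow> 'x tree list \<Rightarrow> ('x tree \<Rightarrow>\<^sub>0 'k::field) \<Rightarrow> 'x tree list \<Rightarrow> ('x tree \<Rightarrow>\<^sub>0 'k)" where
  "vertex_comb x us v vs = lin_ext (\<lambda>t. mon (Node x (us @ t # vs))) v"

lemma subst_comb_mon [simp]: "subst_comb f (mon t) = mon (tree_subst f t)"
  by (simp add: subst_comb_def)

interpretation subst_comb: Vector_Spaces.linear pm_scale pm_scale "subst_comb f"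
  unfolding subst_comb_def by (rule linear_lin_ext)

interpretation vertex_comb: Vector_Spaces.linear pm_scale pm_scale "\<lambda>v. vertex_comb x us v vs"
  unfolding vertex_comb_def by (rule linear_lin_ext)

lemma vertex_comb_mon [simp]: "vertex_comb x us (mon t) vs = mon (Node x (us @ t # vs))"
  by (simp add: vertex_comb_def)

lemma subst_comb_subst_comb:
  "subst_comb f (subst_comb g v) = subst_comb (\<lambda>a. tree_subst f (g a)) v"
  by (simp add: subst_comb_def lin_ext_lin_ext tree_subst_tree_subst)

lemma subst_comb_vertex_comb:
  "subst_comb f (vertex_comb x us v vs) =
    vertex_comb x (map (tree_subst f) us) (subst_comb f v) (map (tree_subst f) vs)"
  by (simp add: subst_comb_def vertex_comb_def lin_ext_lin_ext)

lemma subst_comb_ident: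
  "(\<And>t a. t \<in> Poly_Mapping.keys v \<Longrightarrow> a \<in> set (leaves t) \<Longrightarrow> f a = Leaf a) \<Longrightarrow> subst_comb f v = v"
proof -
  assume "\<And>t a. t \<in> Poly_Mapping.keys v \<Longrightarrow> a \<in> set (leaves t) \<Longrightarrow> f a = Leaf a"
  then have "subst_comb f v = lin_ext mon v"
    unfolding subst_comb_def by (intro lin_ext_cong) (simp add: tree_subst_ident)
  then show ?thesis by simp
qed

lemma one_hole_Node:
  assumes "distinct (leaves (Node x ss))" "i \<in> set (leaves (Node x ss))"
  obtains us s vs where "ss = us @ s # vs" "i \<in> set (leaves s)"
    "\<And>h v. lin_ext (\<lambda>t. mon (tree_subst (h(i := t)) (Node x ss))) v =
      vertex_comb x (map (tree_subst h) us)
        (lin_ext (\<lambda>t. mon (tree_subst (h(i := t)) s)) v :: _ \<Rightarrow>\<^sub>0 'k::field) (map (tree_subst h) vs)"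
proof -
  from assms(2) obtain s where s: "s \<in> set ss" "i \<in> set (leaves s)" by auto
  then obtain us vs where ss: "ss = us @ s # vs" by (meson split_list)
  have other: "i \<notin> set (leaves s')" if "s' \<in> set us \<union> set vs" for s'
    using assms(1) s(2) that by (auto simp: ss)
  have keep: "map (tree_subst (h(i := t))) ws = map (tree_subst h) ws"
    if "set ws \<subseteq> set us \<union> set vs" for ws t h
    using other that by (intro map_cong tree_subst_cong) auto
  show ?thesis
    by (rule that[OF ss s(2)])
      (simp add: vertex_comb_def lin_ext_lin_ext ss keep del: fun_upd_apply)
qed

text \<open>
  A set that is closed under the formation of root vertices is closed under all one-hole contexts.
\<close>

lemma context_closed:
  fixes U :: "('x tree \<Rightarrow>\<^sub>0 'k::field) set"
  assumes vertex: "\<And>x us v vs. x \<in> X (length us + 1 + length vs) \<Longrightarrow> v \<in> U \<Longrightarrow>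
      vertex_comb x us v vs \<in> U"
    and v: "v \<in> U"
  shows "decorated X s \<Longrightarrow> distinct (leaves s) \<Longrightarrow> i \<in> set (leaves s) \<Longrightarrow>
    lin_ext (\<lambda>t. mon (tree_subst (h(i := t)) s)) v \<in> U"
proof (induction s)
  case (Leaf a)
  then show ?case using v by simp
next
  case (Node x ss)
  obtain us s vs where ss: "ss = us @ s # vs" "i \<in> set (leaves s)" and
    eq: "\<And>h v. lin_ext (\<lambda>t. mon (tree_subst (h(i := t)) (Node x ss))) v =
      vertex_comb x (map (tree_subst h) us)
        (lin_ext (\<lambda>t. mon (tree_subst (h(i := t)) s)) v :: _ \<Rightarrow>\<^sub>0 'k) (map (tree_subst h) vs)"
    by (rule one_hole_Node[OF Node.prems(2,3)]) (rule that)
  have "distinct (leaves s)" "decorated X s" "s \<in> set ss"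
    using Node.prems(1,2) by (auto simp: ss(1) list_all_iff)
  then have "lin_ext (\<lambda>t. mon (tree_subst (h(i := t)) s)) v \<in> U"
    by (intro Node.IH ss(2))
  then show ?case
    unfolding eq using Node.prems(1) by (intro vertex) (auto simp: ss(1))
qed

section \<open>Relations between trees\<close>

text \<open>
  The relations of the free operad together with all substitution instances of the elements of \<open>Q\<close>,
  closed under the formation of root vertices.
\<close>

inductive_set ext_relations ::
  "('k::field, 'a::ab_group_add) operad \<Rightarrow> (nat \<Rightarrow> 'a set) \<Rightarrow> ('a tree \<Rightarrow>\<^sub>0 'k) set \<Rightarrow>
    ('a tree \<Rightarrow>\<^sub>0 'k) set"
  for P :: "('k, 'a) operad" and X :: "nat \<Rightarrow> 'a set" and Q :: "('a tree \<Rightarrow>\<^sub>0 'k) set" where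
  add: "x \<in> X (length ts) \<Longrightarrow> y \<in> X (length ts) \<Longrightarrow>
    mon (Node (x + y) ts) - mon (Node x ts) - mon (Node y ts) \<in> ext_relations P X Q"
| scale: "x \<in> X (length ts) \<Longrightarrow>
    mon (Node (scl P a x) ts) - pm_scale a (mon (Node x ts)) \<in> ext_relations P X Q"
| equivariance: "x \<in> X (length ts) \<Longrightarrow> \<sigma> permutes {..<length ts} \<Longrightarrow>
    mon (Node (act P (length ts) \<sigma> x) ts) - mon (Node x (permute_list \<sigma> ts))
      \<in> ext_relations P X Q"
| vertex: "r \<in> ext_relations P X Q \<Longrightarrow> x \<in> X (length us + 1 + length vs) \<Longrightarrow>
    vertex_comb x us r vs \<in> ext_relations P X Q"
| base: "r \<in> Q \<Longrightarrow> subst_comb f r \<in> ext_relations P X Q"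

lemma tree_relations_eq: "tree_relations P X = ext_relations P X {}"
proof
  show "tree_relations P X \<subseteq> ext_relations P X {}"
  proof
    fix r assume "r \<in> tree_relations P X"
    then show "r \<in> ext_relations P X {}"
      by (induction rule: tree_relations.induct)
        (auto intro: ext_relations.intros simp flip: vertex_comb_def)
  qed
  show "ext_relations P X {} \<subseteq> tree_relations P X"
  proof
    fix r assume "r \<in> ext_relations P X {}"
    then show "r \<in> tree_relations P X"
      by (induction rule: ext_relations.induct)
        (auto intro: tree_relations.intros simp: vertex_comb_def)
  qed
qed

lemma ext_relations_mono: "Q \<subseteq> Q' \<Longrightarrow> ext_relations P X Q \<subseteq> ext_relations P X Q'"
proof
  fix r assume *: "Q \<subseteq> Q'" "r \<in> ext_relations P X Q"
  from *(2) show "r \<in> ext_relations P X Q'"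
    by (induction rule: ext_relations.induct) (use *(1) in \<open>auto intro: ext_relations.intros\<close>)
qed

lemma subst_comb_ext_relations:
  "r \<in> ext_relations P X Q \<Longrightarrow> subst_comb f r \<in> ext_relations P X Q"
proof (induction rule: ext_relations.induct)
  case (add x ts y)
  then show ?case
    using ext_relations.add[of x X "map (tree_subst f) ts" y P Q] by (simp add: subst_comb.diff)
next
  case (scale x ts a)
  then show ?case
    using ext_relations.scale[of x X "map (tree_subst f) ts" P a Q]
    by (simp add: subst_comb.diff subst_comb.scale)
next
  case (equivariance x ts \<sigma>)
  then show ?case
    using ext_relations.equivariance[of x X "map (tree_subst f) ts" \<sigma> P Q]
    by (simp add: subst_comb.diff permute_list_map)
next
  case (vertex r x us vs)
  then show ?case
    by (auto simp: subst_comb_vertex_comb intro!: ext_relations.vertex)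
next
  case (base r g)
  then show ?case
    by (simp add: subst_comb_subst_comb ext_relations.base)
qed

lemma subst_comb_span_ext_relations:
  "v \<in> pm.span (ext_relations P X Q) \<Longrightarrow> subst_comb f v \<in> pm.span (ext_relations P X Q)"
  by (rule linear_image_span_closed[OF subst_comb.linear_axioms])
    (auto intro: pm.span_base subst_comb_ext_relations)

lemma vertex_comb_span_ext_relations:
  "x \<in> X (length us + 1 + length vs) \<Longrightarrow> v \<in> pm.span (ext_relations P X Q) \<Longrightarrow>
    vertex_comb x us v vs \<in> pm.span (ext_relations P X Q)"
  by (rule linear_image_span_closed[OF vertex_comb.linear_axioms, where S = "ext_relations P X Q"])
    (rule pm.subspace_span, blast intro: pm.span_base ext_relations.vertex, assumption)

section \<open>Presentations of an operad with binary generators\<close>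

text \<open>
  Linearity of \<open>f\<close> on a subset of its domain.  The operations of an operad are only assumed to be
  linear on the components of the operad.
\<close>

definition linear_on ::
  "('k \<Rightarrow> 'v \<Rightarrow> 'v) \<Rightarrow> ('k \<Rightarrow> 'w \<Rightarrow> 'w) \<Rightarrow> 'v::plus set \<Rightarrow> ('v \<Rightarrow> 'w::plus) \<Rightarrow> bool" where
  "linear_on s1 s2 U f \<longleftrightarrow> (\<forall>x\<in>U. \<forall>y\<in>U. f (x + y) = f x + f y) \<and>
     (\<forall>a. \<forall>x\<in>U. f (s1 a x) = s2 a (f x))"

lemma linear_on_sum:
  assumes "vector_space s1" "vector_space s2" "linear_on s1 s2 U f" "module.subspace s1 U"
    and "\<And>i. i \<in> A \<Longrightarrow> g i \<in> U"
  shows "f (\<Sum>i\<in>A. s1 (a i) (g i)) = (\<Sum>i\<in>A. s2 (a i) (f (g i)))"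
proof -
  interpret v1: vector_space s1 by fact
  interpret v2: vector_space s2 by fact
  note U = v1.subspace_0[OF assms(4)] v1.subspace_add[OF assms(4)] v1.subspace_scale[OF assms(4)]
  have f: "f (x + y) = f x + f y" "f (s1 c x) = s2 c (f x)" if "x \<in> U" "y \<in> U" for x y c
    using assms(3) that by (auto simp: linear_on_def)
  have f0: "f 0 = 0" using f(2)[OF U(1) U(1), of 0] by simp
  show ?thesis
    using assms(5)
  proof (induction A rule: infinite_finite_induct)
    case (insert i A)
    then have "(\<Sum>i\<in>A. s1 (a i) (g i)) \<in> U"
      by (intro v1.subspace_sum[OF assms(4)] U(3)) auto
    then show ?case
      using insert by (simp add: f U)
  qed (simp_all add: f0)
qed

lemma linear_on_zero:
  assumes "vector_space s1" "vector_space s2" "linear_on s1 s2 U f" "module.subspace s1 U"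
  shows "f 0 = 0"
  using linear_on_sum[OF assms, of "{}" id "\<lambda>_. 0"] by simp

text \<open>
  A connected operad with a generating S-submodule \<open>X\<close> concentrated in arity 2 and the natural
  surjection from the free operad.
\<close>

locale binary_presentation = connected_operad P
  for P :: "('k::field, 'a::ab_group_add) operad" +
  fixes X :: "nat \<Rightarrow> 'a set" and \<pi> :: "nat \<Rightarrow> ('a tree \<Rightarrow>\<^sub>0 'k) \<Rightarrow> 'a"
  assumes S_submodule_X: "S_submodule P X"
    and X_trivial: "n \<noteq> 2 \<Longrightarrow> X n = {0}"
    and generates_X: "generates P X"
    and natural_surjection: "natural_surjection P X \<pi>"
begin

text \<open>
  The projection to the chosen representatives of the classes of trees, the free operad, and the
  span of the relations extended by \<open>Q\<close>.  For \<open>Q = {}\<close> this span is the kernel of the projection.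
\<close>

abbreviation "qp \<equiv> quotient_projection P X"
abbreviation "F \<equiv> free_operad P X"
abbreviation "ideal Q \<equiv> pm.span (ext_relations P X Q)"

text \<open>
  The linear combinations of tree monomials of arity \<open>n\<close>; the free operad consists of their classes.
\<close>

definition combs :: "nat \<Rightarrow> ('a tree \<Rightarrow>\<^sub>0 'k) set" where
  "combs n = pm.span (mon ` tree_monomials X n)"

lemma X_subspace: "subspace (X n)"
  and X_ops: "x \<in> X n \<Longrightarrow> x \<in> ops P n"
  and X_act: "\<sigma> permutes {..<n} \<Longrightarrow> x \<in> X n \<Longrightarrow> act P n \<sigma> x \<in> X n"
  using S_submodule_X by (auto simp: S_submodule_def)

lemma X_closed:
  "0 \<in> X n" "x \<in> X n \<Longrightarrow> y \<in> X n \<Longrightarrow> x + y \<in> X n" "x \<in> X n \<Longrightarrow> scl P a x \<in> X n"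
  using X_subspace[of n] by (auto simp: subspace_0 subspace_add subspace_scale)

lemma combs_iff: "v \<in> combs n \<longleftrightarrow> Poly_Mapping.keys v \<subseteq> tree_monomials X n"
  by (simp add: combs_def span_mon_iff)

lemma subspace_combs: "pm.subspace (combs n)"
  by (simp add: combs_def)

lemma mon_combs [simp]: "mon t \<in> combs n \<longleftrightarrow> t \<in> tree_monomials X n"
  by (simp add: combs_iff)

lemma scl_F [simp]: "scl F = pm_scale"
  and ops_F: "ops F n = qp ` combs n"
  by (simp_all add: free_operad_def Let_def combs_def)

sublocale qp: Vector_Spaces.linear pm_scale pm_scale qp
  by (rule quotient_projection)

lemma qp_qp [simp]: "qp (qp v) = qp v"
  by (rule quotient_projection)

lemma qp_eq_0_iff: "qp v = 0 \<longleftrightarrow> v \<in> ideal {}"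
  using quotient_projection(3)[of P X] by (auto simp: tree_relations_eq)

lemma qp_eq_iff: "qp u = qp v \<longleftrightarrow> u - v \<in> ideal {}"
  by (simp add: qp.diff flip: qp_eq_0_iff)

lemma ideal_mono: "Q \<subseteq> Q' \<Longrightarrow> ideal Q \<subseteq> ideal Q'"
  by (intro pm.span_mono ext_relations_mono)

lemma qp_diff: "v - qp v \<in> ideal Q"
  using ideal_mono[of "{}" Q] qp_eq_iff[of v "qp v"] by auto

lemma qp_ideal_iff: "qp v \<in> ideal Q \<longleftrightarrow> v \<in> ideal Q"
  using qp_diff[of v Q] pm.span_add[of "v - qp v" "ext_relations P X Q" "qp v"]
    pm.span_diff[of v "ext_relations P X Q" "v - qp v"] by auto

lemma act_F: "act F n \<sigma> v = qp (subst_comb (\<lambda>a. Leaf (\<sigma> a)) v)"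
  by (simp add: free_operad_def Let_def subst_comb_def relabel_def)

text \<open>The grafting of trees, extended bilinearly; it represents the composition of the free operad.\<close>

definition graft_comb ::
  "nat \<Rightarrow> nat \<Rightarrow> ('a tree \<Rightarrow>\<^sub>0 'k) \<Rightarrow> ('a tree \<Rightarrow>\<^sub>0 'k) \<Rightarrow> ('a tree \<Rightarrow>\<^sub>0 'k)" where
  "graft_comb k i u v = lin_ext (\<lambda>s. lin_ext (\<lambda>t. mon (graft k i s t)) v) u"

lemma cmp_F: "cmp F m k i u v = qp (graft_comb k i u v)"
  by (simp add: free_operad_def Let_def graft_comb_def)

lemma graft_comb_mon [simp]: "graft_comb k i (mon s) (mon t) = mon (graft k i s t)"
  by (simp add: graft_comb_def)

lemma graft_comb_diff_left: "graft_comb k i (u - u') v = graft_comb k i u v - graft_comb k i u' v"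
  by (simp add: graft_comb_def lin_ext.diff)

lemma graft_comb_diff_right: "graft_comb k i u (v - v') = graft_comb k i u v - graft_comb k i u v'"
  unfolding graft_comb_def by (subst (1 2 3) lin_ext_swap) (simp add: lin_ext.diff)

text \<open>
  Grafting is compatible with the relations in either argument.  In the second argument this needs
  that the leaf \<open>i\<close> occurs exactly once in the trees of the first one: if it did not occur, the sum of
  the coefficients of the second argument would appear.
\<close>

lemma graft_comb_ideal_left: "u \<in> ideal Q \<Longrightarrow> graft_comb k i u v \<in> ideal Q"
  unfolding graft_comb_def
  by (subst lin_ext_swap)
    (auto simp: graft_def intro!: lin_ext_closed
      subst_comb_span_ext_relations[unfolded subst_comb_def])

lemma graft_comb_ideal_right:
  assumes "u \<in> combs m" "i < m" "v \<in> ideal Q"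
  shows "graft_comb k i u v \<in> ideal Q"
  unfolding graft_comb_def
proof (rule lin_ext_closed)
  fix s assume "s \<in> Poly_Mapping.keys u"
  then have s: "decorated X s" "distinct (leaves s)" "i \<in> set (leaves s)"
    using assms(1,2) by (auto simp: combs_iff tree_monomials_def)
  have "lin_ext (\<lambda>t. mon (tree_subst ((\<lambda>a. Leaf (outer k i a))(i := t)) s))
      (subst_comb (\<lambda>b. Leaf (i + b)) v) \<in> ideal Q"
    by (rule context_closed[OF _ _ s])
      (use assms(3) in \<open>auto intro!: vertex_comb_span_ext_relations subst_comb_span_ext_relations\<close>)
  then show "lin_ext (\<lambda>t. mon (graft k i s t)) v \<in> ideal Q"
    by (simp add: subst_comb_def lin_ext_lin_ext graft_def relabel_def fun_upd_def cong: if_cong)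
qed simp

lemma graft_comb_qp:
  assumes "u \<in> combs m" "i < m"
  shows "qp (graft_comb k i (qp u) (qp v)) = qp (graft_comb k i u v)"
proof -
  have "graft_comb k i u v - graft_comb k i u (qp v) \<in> ideal {}"
    unfolding graft_comb_diff_right[symmetric]
    by (rule graft_comb_ideal_right[OF assms qp_diff])
  moreover have "graft_comb k i u (qp v) - graft_comb k i (qp u) (qp v) \<in> ideal {}"
    unfolding graft_comb_diff_left[symmetric] by (rule graft_comb_ideal_left[OF qp_diff])
  ultimately show ?thesis by (simp flip: qp_eq_iff)
qed

lemma subst_comb_qp: "qp (subst_comb f (qp v)) = qp (subst_comb f v)"
proof -
  have "subst_comb f (v - qp v) \<in> ideal {}" by (intro subst_comb_span_ext_relations qp_diff)
  then show ?thesis by (simp add: subst_comb.diff flip: qp_eq_iff)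
qed

subsection \<open>Trees with a given set of leaves\<close>

text \<open>The decorated trees whose leaves are labelled bijectively by the elements of \<open>L\<close>.\<close>

definition good :: "nat set \<Rightarrow> 'a tree \<Rightarrow> bool" where
  "good L t \<longleftrightarrow> decorated X t \<and> distinct (leaves t) \<and> set (leaves t) = L"

lemma tree_monomials_iff: "t \<in> tree_monomials X n \<longleftrightarrow> good {..<n} t"
  by (simp add: tree_monomials_def good_def)

lemma good_finite: "good L t \<Longrightarrow> finite L"
  by (auto simp: good_def)

lemma good_relabel: "good L t \<Longrightarrow> inj_on f L \<Longrightarrow> good (f ` L) (relabel f t)"
  by (auto simp: good_def leaves_relabel distinct_map)

lemma good_tree_subst:
  assumes "good L s" "\<And>a. a \<in> L \<Longrightarrow> good (M a) (f a)"
    and "\<And>a b. a \<in> L \<Longrightarrow> b \<in> L \<Longrightarrow> a \<noteq> b \<Longrightarrow> M a \<inter> M b = {}"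
  shows "good (\<Union>a\<in>L. M a) (tree_subst f s)"
proof -
  have "distinct (concat (map g xs))"
    if "distinct xs" "\<And>a. a \<in> set xs \<Longrightarrow> distinct (g a)"
      "\<And>a b. a \<in> set xs \<Longrightarrow> b \<in> set xs \<Longrightarrow> a \<noteq> b \<Longrightarrow> set (g a) \<inter> set (g b) = {}"
    for xs :: "nat list" and g :: "nat \<Rightarrow> nat list"
    using that
  proof (induction xs)
    case (Cons x xs)
    then have "distinct (concat (map g xs))" by auto
    moreover have "set (g x) \<inter> set (g b) = {}" if "b \<in> set xs" for b
      using Cons.prems that by auto
    ultimately show ?case using Cons.prems by auto
  qed simp
  then show ?thesis
    using assms by (auto simp: good_def leaves_tree_subst decorated_tree_subst)
qed

lemma good_Node2: "good S (Node x [t, s]) \<longleftrightarrow>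
    x \<in> X 2 \<and> (\<exists>L M. good L t \<and> good M s \<and> L \<inter> M = {} \<and> S = L \<union> M)"
  by (auto simp: good_def numeral_2_eq_2)

lemma graft_tree_monomials:
  assumes "s \<in> tree_monomials X m" "t \<in> tree_monomials X k" "i < m"
  shows "graft k i s t \<in> tree_monomials X (m + k - 1)"
proof -
  define M where "M a = (if a = i then (+) i ` {..<k} else {outer k i a})" for a
  have "good (\<Union>a\<in>{..<m}. M a) (graft k i s t)"
    unfolding graft_def
  proof (rule good_tree_subst)
    show "good {..<m} s" using assms by (simp add: tree_monomials_iff)
    have t: "good ((+) i ` {..<k}) (relabel ((+) i) t)"
      using assms(2) by (intro good_relabel) (auto simp: tree_monomials_iff)
    show "good (M a) (if a = i then relabel ((+) i) t else Leaf (outer k i a))" for a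
      using t by (auto simp: M_def good_def)
    show "M a \<inter> M b = {}" if "a \<noteq> b" for a b
      using that by (auto simp: M_def outer_def split: if_splits)
  qed
  moreover have "(\<Union>a\<in>{..<m}. M a) = {..<m + k - 1}"
  proof (intro equalityI subsetI)
    fix b assume "b \<in> (\<Union>a\<in>{..<m}. M a)"
    then show "b \<in> {..<m + k - 1}" using assms(3) by (auto simp: M_def outer_def split: if_splits)
  next
    fix b assume b: "b \<in> {..<m + k - 1}"
    consider "b < i" | "i \<le> b" "b < i + k" | "i + k \<le> b" by linarith
    then show "b \<in> (\<Union>a\<in>{..<m}. M a)"
    proof cases
      case 1
      then have "b \<in> M b" by (simp add: M_def outer_def)
      then show ?thesis using 1 assms(3) by auto
    next
      case 2
      then have "b \<in> M i" by (auto simp: M_def intro!: image_eqI[of _ _ "b - i"])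
      then show ?thesis using assms(3) by auto
    next
      case 3
      then have "b \<in> M (b + 1 - k)" by (auto simp: M_def outer_def)
      moreover have "b + 1 - k < m" using 3 b by auto
      ultimately show ?thesis by auto
    qed
  qed
  ultimately show ?thesis by (simp add: tree_monomials_iff)
qed

lemma relabel_tree_monomials:
  assumes "t \<in> tree_monomials X n" "\<sigma> permutes {..<n}"
  shows "relabel \<sigma> t \<in> tree_monomials X n"
  using good_relabel[of "{..<n}" t \<sigma>] assms permutes_inj_on[OF assms(2)] permutes_image[OF assms(2)]
  by (simp add: tree_monomials_iff)

lemma combs_act:
  assumes "v \<in> combs n" "\<sigma> permutes {..<n}"
  shows "subst_comb (\<lambda>a. Leaf (\<sigma> a)) v \<in> combs n"
  unfolding subst_comb_def using assms
  by (intro lin_ext_closed subspace_combs)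
    (auto simp: combs_iff relabel_tree_monomials simp flip: relabel_def)

lemma combs_graft:
  assumes "u \<in> combs m" "v \<in> combs k" "i < m"
  shows "graft_comb k i u v \<in> combs (m + k - 1)"
  unfolding graft_comb_def using assms
  by (intro lin_ext_closed subspace_combs)
    (auto simp: combs_iff[of _ m] combs_iff[of _ k] intro!: graft_tree_monomials[unfolded One_nat_def])

subsection \<open>The natural surjection on trees\<close>

lemma morphism: "operad_morphism F P \<pi>"
  and pi_corolla: "x \<in> X n \<Longrightarrow> \<pi> n (qp (mon (corolla n x))) = x"
  using natural_surjection by (auto simp: natural_surjection_def)

lemma pi_closed: "v \<in> combs n \<Longrightarrow> \<pi> n (qp v) \<in> ops P n"
  using morphism by (auto simp: operad_morphism_def ops_F)

lemma linear_on_pi: "linear_on pm_scale (scl P) (combs n) (\<lambda>v. \<pi> n (qp v))"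
  using morphism by (auto simp: operad_morphism_def ops_F linear_on_def qp.add qp.scale)

lemmas pi_sum = linear_on_sum[OF pm.vector_space_axioms vector_space_axioms linear_on_pi subspace_combs]

lemma pi_act:
  "v \<in> combs n \<Longrightarrow> \<sigma> permutes {..<n} \<Longrightarrow>
    \<pi> n (qp (subst_comb (\<lambda>a. Leaf (\<sigma> a)) v)) = act P n \<sigma> (\<pi> n (qp v))"
  using morphism by (auto simp: operad_morphism_def ops_F act_F subst_comb_qp)

lemma pi_graft:
  "u \<in> combs m \<Longrightarrow> v \<in> combs k \<Longrightarrow> i < m \<Longrightarrow>
    \<pi> (m + k - 1) (qp (graft_comb k i u v)) = cmp P m k i (\<pi> m (qp u)) (\<pi> k (qp v))"
  using morphism by (auto simp: operad_morphism_def ops_F cmp_F graft_comb_qp)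

text \<open>
  The natural surjection is surjective: its image is a suboperad that contains the generators.
\<close>

lemma pi_surj:
  assumes "y \<in> ops P n"
  obtains v where "v \<in> combs n" "\<pi> n (qp v) = y"
proof -
  define I where "I n = (\<lambda>v. \<pi> n (qp v)) ` combs n" for n
  have sub: "subspace (I n)" for n
  proof (rule subspaceI)
    show "0 \<in> I n"
      using linear_on_zero[OF pm.vector_space_axioms vector_space_axioms linear_on_pi subspace_combs]
        pm.subspace_0[OF subspace_combs]
      by (auto simp: I_def image_iff intro!: bexI[of _ 0])
    show "x + y \<in> I n" if "x \<in> I n" "y \<in> I n" for x y
      using that linear_on_pi[of n] pm.subspace_add[OF subspace_combs[of n]]
      unfolding linear_on_def I_def by (auto simp: image_iff) (metis (no_types, lifting))
    show "scl P a x \<in> I n" if "x \<in> I n" for a x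
      using that linear_on_pi[of n] pm.subspace_scale[OF subspace_combs[of n]]
      unfolding linear_on_def I_def by (auto simp: image_iff) (metis (no_types, lifting))
  qed
  have "S_submodule P I"
    unfolding S_submodule_def
  proof (intro allI conjI impI sub)
    show "I n \<subseteq> ops P n" for n by (auto simp: I_def pi_closed)
    show "act P n \<sigma> x \<in> I n" if "\<sigma> permutes {..<n}" "x \<in> I n" for n \<sigma> x
      using that combs_act[OF _ that(1)] by (auto simp: I_def simp flip: pi_act)
  qed
  moreover have "unt P \<in> I 1"
  proof -
    have "\<pi> 1 (qp (mon (Leaf 0))) = unt P"
      using morphism by (simp add: operad_morphism_def free_operad_def Let_def)
    moreover have "mon (Leaf 0) \<in> combs 1" by (simp add: tree_monomials_def lessThan_Suc)
    ultimately show ?thesis unfolding I_def by (metis (no_types, lifting) image_eqI)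
  qed
  moreover have "cmp P m n i p q \<in> I (m + n - 1)" if "i < m" "p \<in> I m" "q \<in> I n" for m n i p q
    using that by (auto simp: I_def simp del: One_nat_def simp flip: pi_graft intro!: imageI combs_graft)
  ultimately have "suboperad P I" by (simp add: suboperad_def)
  moreover have "X n \<subseteq> I n" for n
  proof
    fix x assume x: "x \<in> X n"
    then have "mon (corolla n x) \<in> combs n"
      by (auto simp: tree_monomials_def corolla_def list_all_iff concat_map_singleton o_def)
    then show "x \<in> I n" using pi_corolla[OF x]
      unfolding I_def by (metis (no_types, lifting) image_eqI)
  qed
  ultimately have "I n = ops P n" using generates_X by (simp add: generates_def)
  then have "y \<in> (\<lambda>v. \<pi> n (qp v)) ` combs n" using assms by (simp add: I_def)
  then show ?thesis by (elim imageE) (rule that, simp_all)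
qed

subsection \<open>Evaluation of trees with arbitrary leaf labels\<close>

text \<open>The increasing bijection from a finite set \<open>L\<close> of labels to \<open>{..<card L}\<close>.\<close>

definition std :: "nat set \<Rightarrow> nat \<Rightarrow> nat" where
  "std L a = card {b \<in> L. b < a}"

lemma std_bij:
  assumes "finite L"
  shows "bij_betw (std L) L {..<card L}"
proof -
  have less: "std L a < std L b" if "a \<in> L" "a < b" for a b
    unfolding std_def using assms that by (intro psubset_card_mono) auto
  have inj: "inj_on (std L) L"
    by (rule inj_onI) (metis less less_irrefl linorder_neqE_nat)
  have "std L ` L \<subseteq> {..<card L}"
    using assms by (auto simp: std_def intro!: psubset_card_mono)
  moreover have "card (std L ` L) = card {..<card L}" using inj by (simp add: card_image)
  ultimately have "std L ` L = {..<card L}" by (intro card_subset_eq) auto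
  then show ?thesis using inj by (simp add: bij_betw_def)
qed

lemma std_lessThan: "a < n \<Longrightarrow> std {..<n} a = a"
proof -
  assume "a < n"
  then have "{b \<in> {..<n}. b < a} = {..<a}" by auto
  then show ?thesis by (simp add: std_def)
qed

text \<open>
  The value in \<open>P(|L|)\<close> of a tree whose leaves are labelled by the elements of \<open>L\<close>, numbered in
  increasing order; all other trees have the value 0.
\<close>

definition ev_tree :: "nat set \<Rightarrow> 'a tree \<Rightarrow> 'a" where
  "ev_tree L t = (if good L t then \<pi> (card L) (qp (mon (relabel (std L) t))) else 0)"

text \<open>The linear extension of the evaluation of trees.\<close>

definition ev :: "nat set \<Rightarrow> ('a tree \<Rightarrow>\<^sub>0 'k) \<Rightarrow> 'a" where
  "ev L = extend (scl P) (ev_tree L)"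

sublocale ev: Vector_Spaces.linear pm_scale "scl P" "ev L"
  unfolding ev_def by (rule linear_extend[OF vector_space_axioms])

lemma ev_mon [simp]: "ev L (mon t) = ev_tree L t"
  by (simp add: ev_def vector_space_axioms)

lemma good_std: "good L t \<Longrightarrow> good {..<card L} (relabel (std L) t)"
  using good_relabel[of L t "std L"] std_bij[OF good_finite] by (auto simp: bij_betw_def)

lemma ev_tree_closed: "ev_tree L t \<in> ops P (card L)"
  using subspace_0[OF subspace_ops]
  by (auto simp: ev_tree_def tree_monomials_iff good_std intro!: pi_closed)

lemma ev_closed: "ev L v \<in> ops P (card L)"
  unfolding ev_def extend_def
  by (rule subspace_sum[OF subspace_ops], rule subspace_scale[OF subspace_ops ev_tree_closed])

lemma ev_lessThan:
  assumes "v \<in> combs n"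
  shows "ev {..<n} v = \<pi> n (qp v)"
proof -
  have keys: "good {..<n} t" if "t \<in> Poly_Mapping.keys v" for t
    using assms that by (auto simp: combs_iff tree_monomials_iff)
  then have "relabel (std {..<n}) t = t" if "t \<in> Poly_Mapping.keys v" for t
    using that by (intro relabel_ident) (auto simp: good_def std_lessThan)
  then have "ev {..<n} v =
      (\<Sum>t\<in>Poly_Mapping.keys v. scl P (Poly_Mapping.lookup v t) (\<pi> n (qp (mon t))))"
    using keys by (simp add: ev_def extend_def ev_tree_def)
  also have "\<dots> = \<pi> n (qp (\<Sum>t\<in>Poly_Mapping.keys v. pm_scale (Poly_Mapping.lookup v t) (mon t)))"
    by (rule pi_sum[symmetric]) (simp add: keys tree_monomials_iff)
  finally show ?thesis unfolding pm_expand[of v, symmetric] .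
qed

text \<open>
  All trees that occur in a given relation have the same multiset of labels, and either all or none
  of them are decorated by \<open>X\<close>.
\<close>

definition homogeneous :: "('a tree \<Rightarrow>\<^sub>0 'k) \<Rightarrow> bool" where
  "homogeneous v \<longleftrightarrow> (\<exists>D M. \<forall>t\<in>Poly_Mapping.keys v. decorated X t = D \<and> mset (leaves t) = M)"

lemma mset_leaves_Node: "mset (leaves (Node x ts)) = (\<Sum>t\<in>#mset ts. mset (leaves t))"
  by (induction ts) simp_all

lemma homogeneous_subset:
  assumes "Poly_Mapping.keys v \<subseteq> A"
    and "\<And>t. t \<in> A \<Longrightarrow> decorated X t = D \<and> mset (leaves t) = M"
  shows "homogeneous v"
  unfolding homogeneous_def using assms by (intro exI[of _ D] exI[of _ M]) blast

lemma homogeneous_ext_relations: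
  assumes "\<And>q. q \<in> Q \<Longrightarrow> \<exists>n. q \<in> combs n"
  shows "r \<in> ext_relations P X Q \<Longrightarrow> homogeneous r"
proof (induction rule: ext_relations.induct)
  case (add x ts y)
  have "Poly_Mapping.keys (mon (Node (x + y) ts) - mon (Node x ts) - mon (Node y ts) :: _ \<Rightarrow>\<^sub>0 'k)
      \<subseteq> {Node (x + y) ts, Node x ts, Node y ts}"
    by (auto simp: in_keys_iff lookup_minus lookup_mon split: if_splits)
  then show ?case
    by (rule homogeneous_subset[where D = "list_all id (map (decorated X) ts)"
          and M = "mset (concat (map leaves ts))"]) (use add X_closed in auto)
next
  case (scale x ts a)
  have "Poly_Mapping.keys (mon (Node (scl P a x) ts) - pm_scale a (mon (Node x ts)) :: _ \<Rightarrow>\<^sub>0 'k)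
      \<subseteq> {Node (scl P a x) ts, Node x ts}"
    by (auto simp: in_keys_iff lookup_minus lookup_pm_scale lookup_mon split: if_splits)
  then show ?case
    by (rule homogeneous_subset[where D = "list_all id (map (decorated X) ts)"
          and M = "mset (concat (map leaves ts))"]) (use scale X_closed in auto)
next
  case (equivariance x ts \<sigma>)
  have "Poly_Mapping.keys (mon (Node (act P (length ts) \<sigma> x) ts) -
      mon (Node x (permute_list \<sigma> ts)) :: _ \<Rightarrow>\<^sub>0 'k)
      \<subseteq> {Node (act P (length ts) \<sigma> x) ts, Node x (permute_list \<sigma> ts)}"
    by (auto simp: in_keys_iff lookup_minus lookup_mon split: if_splits)
  then show ?case
    by (rule homogeneous_subset[where D = "list_all id (map (decorated X) ts)"
          and M = "mset (leaves (Node x ts))"])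
      (use equivariance X_act in \<open>auto simp: list_all_iff mset_leaves_Node simp del: leaves.simps\<close>)
next
  case (vertex r x us vs)
  then obtain D M where DM: "\<And>t. t \<in> Poly_Mapping.keys r \<Longrightarrow> decorated X t = D \<and> mset (leaves t) = M"
    by (auto simp: homogeneous_def)
  have "Poly_Mapping.keys (vertex_comb x us r vs) \<subseteq> (\<lambda>t. Node x (us @ t # vs)) ` Poly_Mapping.keys r"
    unfolding vertex_comb_def by (rule order_trans[OF keys_lin_ext]) auto
  then show ?case
    by (rule homogeneous_subset[where D = "D \<and> list_all id (map (decorated X) (us @ vs))"
          and M = "mset (concat (map leaves us)) + M + mset (concat (map leaves vs))"])
      (use vertex DM in auto)
next
  case (base r f)
  then obtain n where n: "Poly_Mapping.keys r \<subseteq> tree_monomials X n"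
    using assms by (auto simp: combs_iff)
  have "Poly_Mapping.keys (subst_comb f r) \<subseteq> tree_subst f ` Poly_Mapping.keys r"
    unfolding subst_comb_def by (rule order_trans[OF keys_lin_ext]) auto
  then show ?case
  proof (rule homogeneous_subset)
    fix t assume "t \<in> tree_subst f ` Poly_Mapping.keys r"
    then obtain s where s: "t = tree_subst f s" "good {..<n} s"
      using n by (auto simp: tree_monomials_iff)
    then have "mset (leaves s) = mset_set {..<n}" by (metis good_def mset_set_set)
    moreover have "mset (concat (map g xs)) = (\<Sum>a\<in>#mset xs. mset (g a))"
      for g :: "nat \<Rightarrow> nat list" and xs by (induction xs) auto
    ultimately show "decorated X t = (\<forall>a<n. decorated X (f a)) \<and>
        mset (leaves t) = (\<Sum>a\<in>#mset_set {..<n}. mset (leaves (f a)))"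
      using s by (auto simp: good_def decorated_tree_subst leaves_tree_subst)
  qed
qed

lemma homogeneous_good:
  assumes "homogeneous v"
  shows "(\<forall>t\<in>Poly_Mapping.keys v. good L t) \<or> (\<forall>t\<in>Poly_Mapping.keys v. \<not> good L t)"
proof -
  obtain D M where "\<And>t. t \<in> Poly_Mapping.keys v \<Longrightarrow> decorated X t = D \<and> mset (leaves t) = M"
    using assms by (auto simp: homogeneous_def)
  then have "good L s \<longleftrightarrow> good L t" if "s \<in> Poly_Mapping.keys v" "t \<in> Poly_Mapping.keys v" for s t
    using that by (metis good_def mset_eq_imp_distinct_iff mset_eq_setD)
  then show ?thesis by blast
qed

lemma ev_tree_relation:
  assumes "r \<in> ext_relations P X {}"
  shows "ev L r = 0"
proof (cases "\<forall>t\<in>Poly_Mapping.keys r. good L t")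
  case True
  let ?f = "\<lambda>a. Leaf (std L a)"
  have "ev L r = (\<Sum>t\<in>Poly_Mapping.keys r. scl P (Poly_Mapping.lookup r t)
      (\<pi> (card L) (qp (mon (relabel (std L) t)))))"
    using True by (simp add: ev_def extend_def ev_tree_def)
  also have "\<dots> = \<pi> (card L) (qp (\<Sum>t\<in>Poly_Mapping.keys r. pm_scale (Poly_Mapping.lookup r t)
      (mon (relabel (std L) t))))"
    using True by (intro pi_sum[symmetric]) (simp add: tree_monomials_iff good_std)
  also have "(\<Sum>t\<in>Poly_Mapping.keys r. pm_scale (Poly_Mapping.lookup r t)
      (mon (relabel (std L) t))) = subst_comb ?f r"
    by (simp add: subst_comb_def lin_ext_def relabel_def)
  also have "qp (subst_comb ?f r) = 0"
    unfolding qp_eq_0_iff using assms by (intro pm.span_base subst_comb_ext_relations)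
  also have "\<pi> (card L) 0 = 0"
    using linear_on_zero[OF pm.vector_space_axioms vector_space_axioms linear_on_pi subspace_combs]
    by simp
  finally show ?thesis .
next
  case False
  then have "\<forall>t\<in>Poly_Mapping.keys r. \<not> good L t"
    using homogeneous_good[OF homogeneous_ext_relations[OF _ assms], of L] by auto
  then show ?thesis by (simp add: ev_def extend_def ev_tree_def)
qed

subsection \<open>Evaluation and composition\<close>

text \<open>
  The permutation of \<open>{..<card T}\<close> that turns the numbering \<open>\<tau>\<close> of the finite set \<open>T\<close> into the
  increasing one.
\<close>

definition renumber :: "nat set \<Rightarrow> (nat \<Rightarrow> nat) \<Rightarrow> nat \<Rightarrow> nat" where
  "renumber T \<tau> i = (if i < card T then std T (inv_into T \<tau> i) else i)"

lemma renumber_permutes: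
  assumes "finite T" "bij_betw \<tau> T {..<card T}"
  shows "renumber T \<tau> permutes {..<card T}"
proof (rule bij_imp_permutes)
  have "bij_betw (std T \<circ> inv_into T \<tau>) {..<card T} {..<card T}"
    by (rule bij_betw_trans[OF bij_betw_inv_into[OF assms(2)] std_bij[OF assms(1)]])
  then show "bij_betw (renumber T \<tau>) {..<card T} {..<card T}"
    by (rule bij_betw_cong[THEN iffD1, rotated]) (simp add: renumber_def)
qed (simp add: renumber_def)

lemma ev_tree_renumber:
  assumes "good T t" "bij_betw \<tau> T {..<card T}"
  shows "ev_tree T t = act P (card T) (renumber T \<tau>) (\<pi> (card T) (qp (mon (relabel \<tau> t))))"
proof -
  have T: "finite T" by (rule good_finite[OF assms(1)])
  have "relabel \<tau> t \<in> tree_monomials X (card T)"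
    using good_relabel[OF assms(1), of \<tau>] assms(2) by (simp add: bij_betw_def tree_monomials_iff)
  then have "act P (card T) (renumber T \<tau>) (\<pi> (card T) (qp (mon (relabel \<tau> t)))) =
      \<pi> (card T) (qp (mon (relabel (renumber T \<tau> \<circ> \<tau>) t)))"
    using pi_act[OF _ renumber_permutes[OF T assms(2)], of "mon (relabel \<tau> t)"]
    by (simp add: relabel_relabel flip: relabel_def)
  also have "relabel (renumber T \<tau> \<circ> \<tau>) t = relabel (std T) t"
  proof (rule relabel_cong)
    fix a assume "a \<in> set (leaves t)"
    then have "a \<in> T" using assms(1) by (simp add: good_def)
    then show "(renumber T \<tau> \<circ> \<tau>) a = std T a"
      using assms(2) by (auto simp: renumber_def bij_betw_def)
  qed
  finally show ?thesis using assms(1) by (simp add: ev_tree_def)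
qed

text \<open>The numbering of \<open>L \<union> M\<close>, for disjoint \<open>L\<close> and \<open>M\<close>, that lists \<open>L\<close> before \<open>M\<close>.\<close>

definition join :: "nat set \<Rightarrow> nat set \<Rightarrow> nat \<Rightarrow> nat" where
  "join L M a = (if a \<in> L then std L a else card L + std M a)"

text \<open>
  The value of a tree with root \<open>x\<close> and two subtrees, with labels in \<open>L\<close> and \<open>M\<close>, as a function of the
  values of the subtrees.
\<close>

definition root_cmp :: "nat set \<Rightarrow> nat set \<Rightarrow> 'a \<Rightarrow> 'a \<Rightarrow> 'a \<Rightarrow> 'a" where
  "root_cmp L M x a b = act P (card L + card M) (renumber (L \<union> M) (join L M))
     (cmp P (Suc (card M)) (card L) 0 (cmp P 2 (card M) 1 x b) a)"

lemma bij_betw_join: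
  fixes f g :: "nat \<Rightarrow> nat"
  assumes f: "bij_betw f L {..<k}" and g: "bij_betw g M {..<l}" and disj: "L \<inter> M = {}"
  shows "bij_betw (\<lambda>a. if a \<in> L then f a else k + g a) (L \<union> M) {..<k + l}" (is "bij_betw ?h _ _")
proof -
  have "bij_betw ((+) k) {..<l} {k..<k + l}"
    by (rule bij_betwI[of _ _ _ "\<lambda>b. b - k"]) auto
  from bij_betw_trans[OF g this] have "bij_betw (\<lambda>a. k + g a) M {k..<k + l}" by (simp add: o_def)
  then have M: "bij_betw ?h M {k..<k + l}"
    by (rule bij_betw_cong[THEN iffD1, rotated]) (use disj in auto)
  have L: "bij_betw ?h L {..<k}"
    using f by (rule bij_betw_cong[THEN iffD1, rotated]) simp
  have "{..<k} \<union> {k..<k + l} = {..<k + l}" "{..<k} \<inter> {k..<k + l} = {}" by auto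
  then show ?thesis using bij_betw_combine[OF L M] by simp
qed

lemma join_bij:
  assumes "finite L" "finite M" "L \<inter> M = {}"
  shows "bij_betw (join L M) (L \<union> M) {..<card L + card M}"
  unfolding join_def[abs_def] using assms by (intro bij_betw_join std_bij)

lemma ev_tree_Node:
  assumes "x \<in> X 2" "good L s" "good M t" "L \<inter> M = {}"
  shows "ev_tree (L \<union> M) (Node x [s, t]) = root_cmp L M x (ev_tree L s) (ev_tree M t)"
proof -
  let ?k = "card L" and ?l = "card M"
  let ?s = "relabel (std L) s" and ?t = "relabel (std M) t"
  have fin: "finite L" "finite M" using assms good_finite by auto
  have card: "card (L \<union> M) = ?k + ?l" using fin assms(4) by (rule card_Un_disjoint)
  have g: "good (L \<union> M) (Node x [s, t])"
    using assms by (auto simp: good_Node2)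
  have s: "?s \<in> tree_monomials X ?k" and t: "?t \<in> tree_monomials X ?l"
    using assms by (auto simp: tree_monomials_iff good_std)
  have c: "corolla 2 x \<in> tree_monomials X 2"
    using assms(1) by (auto simp: tree_monomials_def corolla_def numeral_2_eq_2)
  have ct: "graft ?l 1 (corolla 2 x) ?t \<in> tree_monomials X (Suc ?l)"
    using graft_tree_monomials[OF c t, of 1] by simp
  have "relabel (join L M) (Node x [s, t]) = graft ?k 0 (graft ?l 1 (corolla 2 x) ?t) ?s"
  proof -
    have "relabel (join L M) s = ?s"
      using assms(2) by (intro relabel_cong) (auto simp: join_def good_def)
    moreover have "relabel (join L M) t = tree_subst (\<lambda>b. Leaf (?k + std M b)) t"
      using assms(3,4) by (fold relabel_def, intro relabel_cong) (auto simp: join_def good_def)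
    moreover have "relabel (\<lambda>b. b) ?s = ?s" by (rule relabel_ident) simp
    moreover have "tree_subst (\<lambda>b. if b = 0 then v else Leaf (outer ?k 0 b)) (relabel Suc u) =
        tree_subst (\<lambda>b. Leaf (?k + b)) u" for u v :: "'a tree"
      by (simp add: relabel_def tree_subst_tree_subst outer_def add.commute)
    ultimately show ?thesis
      by (simp add: graft_def corolla_def numeral_2_eq_2)
        (simp add: relabel_def tree_subst_tree_subst outer_def add.commute)
  qed
  moreover have "\<pi> (?k + ?l) (qp (mon (graft ?k 0 (graft ?l 1 (corolla 2 x) ?t) ?s))) =
      cmp P (Suc ?l) ?k 0 (cmp P 2 ?l 1 x (ev_tree M t)) (ev_tree L s)"
    using pi_graft[of "mon (graft ?l 1 (corolla 2 x) ?t)" "Suc ?l" "mon ?s" ?k 0]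
      pi_graft[of "mon (corolla 2 x)" 2 "mon ?t" ?l 1] assms c s t ct
    by (simp add: ev_tree_def pi_corolla add.commute)
  ultimately show ?thesis
    using ev_tree_renumber[OF g, of "join L M"] join_bij[OF fin assms(4)] card
    by (simp add: root_cmp_def)
qed

lemma root_cmp_linear:
  assumes "finite L" "finite M" "L \<inter> M = {}"
    and x: "x \<in> ops P 2" and a: "a \<in> ops P (card L)" and b: "b \<in> ops P (card M)"
  shows "linear_on (scl P) (scl P) (ops P 2) (\<lambda>x. root_cmp L M x a b)"
    and "linear_on (scl P) (scl P) (ops P (card L)) (\<lambda>a. root_cmp L M x a b)"
    and "linear_on (scl P) (scl P) (ops P (card M)) (\<lambda>b. root_cmp L M x a b)"
proof -
  let ?k = "card L" and ?l = "card M"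
  have c: "card (L \<union> M) = ?k + ?l" using assms by (simp add: card_Un_disjoint)
  have perm: "renumber (L \<union> M) (join L M) permutes {..<?k + ?l}"
    using renumber_permutes[OF _ join_bij[OF assms(1-3), folded c]] assms c by simp
  have 1: "cmp P 2 ?l 1 x b \<in> ops P (Suc ?l)" if "x \<in> ops P 2" "b \<in> ops P ?l" for x b
    using cmp_closed[of x 2 b ?l 1] that by simp
  have 2: "cmp P (Suc ?l) ?k 0 y a \<in> ops P (?k + ?l)"
    if "y \<in> ops P (Suc ?l)" "a \<in> ops P ?k" for y a
    using cmp_closed[of y "Suc ?l" a ?k 0] that by (simp add: add.commute)
  show "linear_on (scl P) (scl P) (ops P 2) (\<lambda>x. root_cmp L M x a b)"
    "linear_on (scl P) (scl P) (ops P ?k) (\<lambda>a. root_cmp L M x a b)"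
    "linear_on (scl P) (scl P) (ops P ?l) (\<lambda>b. root_cmp L M x a b)"
    unfolding linear_on_def root_cmp_def
    using x a b 1 2 act_add[OF perm] act_scale[OF perm]
    by (auto simp del: One_nat_def simp: cmp_add_left cmp_add_right cmp_scale_left cmp_scale_right)
qed

text \<open>Linear combinations of trees whose leaves are labelled by the elements of \<open>L\<close>.\<close>

definition labelled :: "nat set \<Rightarrow> ('a tree \<Rightarrow>\<^sub>0 'k) set" where
  "labelled L = pm.span (mon ` {t. good L t})"

lemma labelled_iff: "v \<in> labelled L \<longleftrightarrow> (\<forall>t\<in>Poly_Mapping.keys v. good L t)"
  by (auto simp: labelled_def span_mon_iff)

lemma labelled_lessThan: "labelled {..<n} = combs n"
  by (auto simp: labelled_iff combs_iff tree_monomials_iff subset_iff)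

lemma subspace_labelled: "pm.subspace (labelled L)"
  by (simp add: labelled_def)

text \<open>The formation of a root vertex with two subtrees, extended bilinearly.\<close>

definition node_comb ::
  "'a \<Rightarrow> ('a tree \<Rightarrow>\<^sub>0 'k) \<Rightarrow> ('a tree \<Rightarrow>\<^sub>0 'k) \<Rightarrow> ('a tree \<Rightarrow>\<^sub>0 'k)" where
  "node_comb x u v = lin_ext (\<lambda>s. lin_ext (\<lambda>t. mon (Node x [s, t])) v) u"

lemma labelled_node_comb:
  assumes "x \<in> X 2" "L \<inter> M = {}" "u \<in> labelled L" "v \<in> labelled M"
  shows "node_comb x u v \<in> labelled (L \<union> M)"
  unfolding node_comb_def using assms
  by (intro lin_ext_closed subspace_labelled) (simp add: labelled_iff good_Node2, blast)

lemma ev_node_comb: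
  assumes x: "x \<in> X 2" and LM: "finite L" "finite M" "L \<inter> M = {}"
    and u: "u \<in> labelled L" and v: "v \<in> labelled M"
  shows "ev (L \<union> M) (node_comb x u v) = root_cmp L M x (ev L u) (ev M v)"
proof -
  note lin = root_cmp_linear[OF LM X_ops[OF x]]
  have "ev (L \<union> M) (node_comb x u v) =
      (\<Sum>s\<in>Poly_Mapping.keys u. scl P (Poly_Mapping.lookup u s)
        (\<Sum>t\<in>Poly_Mapping.keys v. scl P (Poly_Mapping.lookup v t)
          (root_cmp L M x (ev_tree L s) (ev_tree M t))))"
    using u v x LM(3)
    by (simp add: node_comb_def linear_lin_ext_eq[OF ev.linear_axioms] extend_def labelled_iff
        ev_tree_Node)
  also have "\<dots> = (\<Sum>s\<in>Poly_Mapping.keys u. scl P (Poly_Mapping.lookup u s)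
      (root_cmp L M x (ev_tree L s) (ev M v)))"
    unfolding ev_def extend_def
    by (subst linear_on_sum[OF vector_space_axioms vector_space_axioms
        lin(3)[OF ev_tree_closed ev_closed] subspace_ops])
      (simp_all add: ev_tree_closed)
  also have "\<dots> = root_cmp L M x (ev L u) (ev M v)"
    unfolding ev_def[of L] extend_def
    by (subst linear_on_sum[OF vector_space_axioms vector_space_axioms
        lin(2)[OF ev_closed ev_closed] subspace_ops])
      (simp_all add: ev_tree_closed ev_closed)
  finally show ?thesis .
qed

lemma ev_tree_zero: "ev_tree S (Node 0 ts) = 0"
  using ev_tree_relation[OF ext_relations.scale[of 0 X ts P 0 "{}", OF X_closed(1)]]
  by (simp add: ev.diff ev.scale ev.zero)

abbreviation swap :: "'a \<Rightarrow> 'a" where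
  "swap \<equiv> act P 2 (Transposition.transpose 0 1)"

lemma transpose_permutes: "Transposition.transpose 0 1 permutes {..<2::nat}"
  by (rule permutes_swap_id) auto

lemma permute_list_transpose: "permute_list (Transposition.transpose 0 1) [s, t] = [t, s]"
  by (simp add: permute_list_def numeral_2_eq_2)

lemma swap_relation:
  assumes "x \<in> X 2"
  shows "mon (Node (swap x) [t, s]) - mon (Node x [s, t]) \<in> ext_relations P X Q"
proof -
  have "length [t, s] = 2" by simp
  then show ?thesis
    using ext_relations.equivariance[of x X "[t, s]" "Transposition.transpose 0 1" P Q]
      assms transpose_permutes
    by (simp only: permute_list_transpose)
qed

lemma ev_tree_swap:
  assumes "x \<in> X 2"
  shows "ev_tree S (Node x [s, t]) = ev_tree S (Node (swap x) [t, s])"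
  using ev_tree_relation[OF swap_relation[OF assms, of t s], of S] by (simp add: ev.diff)

text \<open>The linear combinations of trees that every evaluation sends to 0.\<close>

definition null_combs :: "('a tree \<Rightarrow>\<^sub>0 'k) set" where
  "null_combs = {v. \<forall>S. ev S v = 0}"

lemma ev_left_zero:
  assumes "v \<in> null_combs" "x \<in> X 2"
  shows "ev S (vertex_comb x [] v [s]) = 0"
proof -
  have eq: "ev S (vertex_comb x [] v [s]) = (\<Sum>t\<in>Poly_Mapping.keys v.
      scl P (Poly_Mapping.lookup v t) (ev_tree S (Node x [t, s])))"
    by (simp add: vertex_comb_def linear_lin_ext_eq[OF ev.linear_axioms] extend_def)
  show ?thesis
  proof (cases "\<exists>M. good M s \<and> M \<subseteq> S \<and> finite S")
    case True
    then obtain M where M: "good M s" "M \<subseteq> S" "finite S" by blast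
    let ?L = "S - M"
    have fin: "finite ?L" "finite M" "?L \<inter> M = {}" "?L \<union> M = S"
      using M finite_subset by auto
    note lin = root_cmp_linear(2)[OF fin(1-3) X_ops[OF assms(2)] ev_tree_closed ev_tree_closed[of M s]]
    have "ev_tree S (Node x [t, s]) = root_cmp ?L M x (ev_tree ?L t) (ev_tree M s)" for t
    proof (cases "good ?L t")
      case True
      then show ?thesis using ev_tree_Node[OF assms(2) True M(1) fin(3)] fin(4) by simp
    next
      case False
      then have "\<not> good S (Node x [t, s])"
        using M fin by (auto simp: good_Node2 good_def)
      then show ?thesis
        using False linear_on_zero[OF vector_space_axioms vector_space_axioms lin subspace_ops]
        by (simp add: ev_tree_def)
    qed
    then have "ev S (vertex_comb x [] v [s]) = (\<Sum>t\<in>Poly_Mapping.keys v.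
      scl P (Poly_Mapping.lookup v t) (root_cmp ?L M x (ev_tree ?L t) (ev_tree M s)))"
      by (simp add: eq)
    also have "\<dots> = root_cmp ?L M x (ev ?L v) (ev_tree M s)"
      unfolding ev_def extend_def
      by (subst linear_on_sum[OF vector_space_axioms vector_space_axioms lin subspace_ops])
        (simp_all add: ev_tree_closed)
    also have "\<dots> = 0"
      using assms(1) linear_on_zero[OF vector_space_axioms vector_space_axioms lin subspace_ops]
      by (simp add: null_combs_def)
    finally show ?thesis .
  next
    case False
    then have "\<not> good S (Node x [t, s])" for t
      using good_finite by (auto simp: good_Node2)
    then show ?thesis by (simp add: eq ev_tree_def)
  qed
qed

text \<open>Combinations of value 0 are stable under the formation of root vertices.\<close>

lemma null_combs_vertex:
  assumes x: "x \<in> X (length us + 1 + length vs)" and v: "v \<in> null_combs"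
  shows "vertex_comb x us v vs \<in> null_combs"
proof (cases "length us + 1 + length vs = 2")
  case False
  then have "x = 0" using x X_trivial by auto
  have "ev S (vertex_comb x us v vs) = 0" for S
    unfolding \<open>x = 0\<close>
    by (simp add: vertex_comb_def linear_lin_ext_eq[OF ev.linear_axioms] extend_def ev_tree_zero)
  then show ?thesis by (simp add: null_combs_def)
next
  case True
  then consider s where "us = []" "vs = [s]" | s where "us = [s]" "vs = []"
    by (cases us; cases vs) (auto simp: length_Suc_conv)
  then show ?thesis
  proof cases
    case 1
    then show ?thesis using ev_left_zero[OF v] x by (simp add: null_combs_def numeral_2_eq_2)
  next
    case 2
    have x2: "x \<in> X 2" using x unfolding True .
    have "ev S (vertex_comb x us v vs) = ev S (vertex_comb (swap x) [] v [s])" for S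
      using 2 ev_tree_swap[OF x2]
      by (simp add: vertex_comb_def linear_lin_ext_eq[OF ev.linear_axioms])
    then show ?thesis
      using ev_left_zero[OF v X_act[OF transpose_permutes x2]] by (simp add: null_combs_def)
  qed
qed

text \<open>
  The value of a tree \<open>s\<close> of arity 3 with three trees grafted to its leaves, as a function of the values
  of the four trees.
\<close>

lemma ev_tree_subst:
  assumes "good {..<3} s" and f: "good K (f 0)" "good L (f 1)" "good M (f 2)"
    and disj: "K \<inter> L = {}" "K \<inter> M = {}" "L \<inter> M = {}"
  shows "ev_tree (K \<union> (L \<union> M)) (tree_subst f s) = act P (card K + (card L + card M))
      (renumber (K \<union> (L \<union> M)) (\<lambda>a. if a \<in> K then std K a else card K + join L M a))
      (cmp P (Suc (card L + card M)) (card K) 0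
        (cmp P (Suc (Suc (card M))) (card L) 1
          (cmp P 3 (card M) 2 (\<pi> 3 (qp (mon s))) (ev_tree M (f 2)))
          (ev_tree L (f 1)))
        (ev_tree K (f 0)))"
proof -
  let ?k = "card K" and ?l = "card L" and ?m = "card M"
  let ?K = "relabel (std K) (f 0)" and ?L = "relabel (std L) (f 1)" and ?M = "relabel (std M) (f 2)"
  let ?j = "\<lambda>a. if a \<in> K then std K a else ?k + join L M a"
  have fin: "finite K" "finite L" "finite M" using f good_finite by auto
  have card: "card (K \<union> (L \<union> M)) = ?k + (?l + ?m)"
    using fin disj by (simp add: card_Un_disjoint Int_Un_distrib)
  have s: "s \<in> tree_monomials X 3" using assms(1) by (simp add: tree_monomials_iff)
  have K: "?K \<in> tree_monomials X ?k" and L: "?L \<in> tree_monomials X ?l"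
    and M: "?M \<in> tree_monomials X ?m"
    using f by (auto simp: tree_monomials_iff good_std)
  let ?g = "\<lambda>a. if a = (0::nat) then f 0 else if a = 1 then f 1 else f 2"
  have "good (\<Union>a\<in>{..<3::nat}. if a = 0 then K else if a = 1 then L else M) (tree_subst f s)"
  proof (rule good_tree_subst[OF assms(1)])
    fix a :: nat assume "a \<in> {..<3}"
    then have "a = 0 \<or> a = 1 \<or> a = 2" by auto
    then show "good (if a = 0 then K else if a = 1 then L else M) (f a)" using f by auto
  qed (use disj in auto)
  moreover have "(\<Union>a\<in>{..<3::nat}. if a = 0 then K else if a = 1 then L else M) = K \<union> (L \<union> M)"
    by (auto simp: numeral_3_eq_3 lessThan_Suc)
  ultimately have g: "good (K \<union> (L \<union> M)) (tree_subst f s)" by simp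
  have j: "bij_betw ?j (K \<union> (L \<union> M)) {..<?k + (?l + ?m)}"
    using disj fin by (intro bij_betw_join std_bij join_bij) auto
  let ?s2 = "graft ?m 2 s ?M"
  let ?s1 = "graft ?l 1 ?s2 ?L"
  have s2: "?s2 \<in> tree_monomials X (Suc (Suc ?m))"
    using graft_tree_monomials[OF s M, of 2] by (simp add: numeral_3_eq_3)
  have s1: "?s1 \<in> tree_monomials X (Suc (?l + ?m))"
    using graft_tree_monomials[OF s2 L, of 1] by (simp add: add.commute)
  define A where "A a = (if a = 0 then relabel ((+) 0) ?K else Leaf (outer ?k 0 a))" for a
  define B where "B a = (if a = 1 then relabel ((+) 1) ?L else Leaf (outer ?l 1 a))" for a
  define C where "C a = (if a = 2 then relabel ((+) 2) ?M else Leaf (outer ?m 2 a))" for a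
  have graft: "graft ?k 0 ?s1 ?K = tree_subst (\<lambda>a. tree_subst A (tree_subst B (C a))) s"
    unfolding graft_def A_def[abs_def, symmetric] B_def[abs_def, symmetric]
      C_def[abs_def, symmetric] by (simp only: tree_subst_tree_subst)
  have shift: "tree_subst D (relabel h t) = relabel h' t"
    if "\<And>a. D (h a) = Leaf (h' a)" for D h h' and t :: "'a tree"
    using that by (simp add: relabel_def tree_subst_tree_subst)
  have C: "C 0 = Leaf 0" "C 1 = Leaf 1" "C 2 = relabel ((+) 2) ?M"
    by (simp_all add: C_def outer_def)
  have B: "B 0 = Leaf 0" "B 1 = relabel ((+) 1) ?L" "B (2 + a) = Leaf (1 + (?l + a))" for a
    by (simp_all add: B_def outer_def)
  have A: "A 0 = relabel ((+) 0) ?K" "A (1 + a) = Leaf (?k + a)" for a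
    by (simp_all add: A_def outer_def)
  have "relabel ?j (tree_subst f s) = tree_subst (\<lambda>a. relabel ?j (f a)) s"
    by (simp only: relabel_def tree_subst_tree_subst)
  also have "\<dots> = graft ?k 0 ?s1 ?K"
    unfolding graft
  proof (rule tree_subst_cong)
    fix a assume "a \<in> set (leaves s)"
    then have "a < 3" using assms(1) by (simp add: good_def)
    then consider "a = 0" | "a = 1" | "a = 2" by linarith
    then show "relabel ?j (f a) = tree_subst A (tree_subst B (C a))"
    proof cases
      case 1
      have "relabel ?j (f 0) = relabel ((+) 0 \<circ> std K) (f 0)"
        using f by (intro relabel_cong) (simp add: good_def)
      then show ?thesis by (simp only: 1 C B A tree_subst.simps relabel_relabel)
    next
      case 2
      have "relabel ?j (f 1) = relabel ((+) ?k) ?L"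
        unfolding relabel_relabel using f disj
        by (intro relabel_cong) (auto simp: good_def join_def)
      then show ?thesis by (simp only: 2 C B tree_subst.simps shift[of A, OF A(2)])
    next
      case 3
      have "relabel ?j (f 2) = relabel (\<lambda>a. ?k + (?l + a)) ?M"
        unfolding relabel_relabel using f disj
        by (intro relabel_cong) (auto simp: good_def join_def)
      then show ?thesis
        by (simp only: 3 C shift[of B, OF B(3)] shift[of A, OF A(2)])
    qed
  qed
  finally have "relabel ?j (tree_subst f s) = graft ?k 0 ?s1 ?K" .
  moreover have "\<pi> (?k + (?l + ?m)) (qp (mon (graft ?k 0 ?s1 ?K))) =
      cmp P (Suc (?l + ?m)) ?k 0 (cmp P (Suc (Suc ?m)) ?l 1
          (cmp P 3 ?m 2 (\<pi> 3 (qp (mon s))) (ev_tree M (f 2))) (ev_tree L (f 1))) (ev_tree K (f 0))"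
    using pi_graft[of "mon ?s1" "Suc (?l + ?m)" "mon ?K" ?k 0]
      pi_graft[of "mon ?s2" "Suc (Suc ?m)" "mon ?L" ?l 1]
      pi_graft[of "mon s" 3 "mon ?M" ?m 2] f s s1 s2 K L M
    by (simp add: ev_tree_def add_ac numeral_3_eq_3)
  ultimately show ?thesis
    using ev_tree_renumber[OF g, of ?j] j card by simp
qed

lemma good_tree_substD:
  assumes "good S (tree_subst f s)" "good L s"
  shows "a \<in> L \<Longrightarrow> good (set (leaves (f a))) (f a)"
    and "a \<in> L \<Longrightarrow> b \<in> L \<Longrightarrow> a \<noteq> b \<Longrightarrow> set (leaves (f a)) \<inter> set (leaves (f b)) = {}"
    and "S = (\<Union>a\<in>L. set (leaves (f a)))"
proof -
  have *: "(\<forall>a\<in>set xs. distinct (g a)) \<and>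
      (\<forall>a\<in>set xs. \<forall>b\<in>set xs. a \<noteq> b \<longrightarrow> set (g a) \<inter> set (g b) = {})"
    if "distinct (concat (map g xs))" for xs :: "nat list" and g :: "nat \<Rightarrow> nat list"
    using that
  proof (induction xs)
    case (Cons x xs)
    then have "set (g x) \<inter> set (g b) = {}" if "b \<in> set xs" for b using that by auto
    with Cons show ?case by (simp add: Int_commute)
  qed simp
  from *[of "\<lambda>a. leaves (f a)" "leaves s"]
  show "a \<in> L \<Longrightarrow> good (set (leaves (f a))) (f a)"
    "a \<in> L \<Longrightarrow> b \<in> L \<Longrightarrow> a \<noteq> b \<Longrightarrow> set (leaves (f a)) \<inter> set (leaves (f b)) = {}"
    using assms by (auto simp: good_def leaves_tree_subst decorated_tree_subst)
  show "S = (\<Union>a\<in>L. set (leaves (f a)))"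
    using assms by (auto simp: good_def leaves_tree_subst)
qed

text \<open>An element of arity 3 in the kernel stays in the kernel when trees are grafted to its leaves.\<close>

lemma null_combs_subst:
  assumes r: "r \<in> combs 3" and null: "\<pi> 3 (qp r) = 0"
  shows "subst_comb f r \<in> null_combs"
  unfolding null_combs_def
proof (intro CollectI allI)
  fix S
  have keys: "good {..<3} s" if "s \<in> Poly_Mapping.keys r" for s
    using r that by (auto simp: combs_iff tree_monomials_iff)
  have eq: "ev S (subst_comb f r) = (\<Sum>s\<in>Poly_Mapping.keys r.
      scl P (Poly_Mapping.lookup r s) (ev_tree S (tree_subst f s)))"
    by (simp add: subst_comb_def linear_lin_ext_eq[OF ev.linear_axioms] extend_def)
  show "ev S (subst_comb f r) = 0"
  proof (cases "\<exists>s\<in>Poly_Mapping.keys r. good S (tree_subst f s)")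
    case False
    then show ?thesis by (simp add: eq ev_tree_def)
  next
    case True
    then obtain s0 where s0: "s0 \<in> Poly_Mapping.keys r" "good S (tree_subst f s0)" by blast
    note D = good_tree_substD[OF s0(2) keys[OF s0(1)]]
    define K L M where "K = set (leaves (f 0))" and "L = set (leaves (f 1))"
      and "M = set (leaves (f 2))"
    have f: "good K (f 0)" "good L (f 1)" "good M (f 2)"
      unfolding K_def L_def M_def by (intro D; simp)+
    have disj: "K \<inter> L = {}" "K \<inter> M = {}" "L \<inter> M = {}"
      unfolding K_def L_def M_def by (intro D; simp)+
    have S: "S = K \<union> (L \<union> M)"
      unfolding D(3) K_def L_def M_def by (auto simp: numeral_3_eq_3 lessThan_Suc numeral_2_eq_2)
    let ?k = "card K" and ?l = "card L" and ?m = "card M"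
    define \<rho> where
      "\<rho> = renumber (K \<union> (L \<union> M)) (\<lambda>a. if a \<in> K then std K a else card K + join L M a)"
    define \<Theta> where "\<Theta> y = act P (?k + (?l + ?m)) \<rho> (cmp P (Suc (?l + ?m)) ?k 0
        (cmp P (Suc (Suc ?m)) ?l 1 (cmp P 3 ?m 2 y (ev_tree M (f 2))) (ev_tree L (f 1)))
        (ev_tree K (f 0)))" for y
    have fin: "finite K" "finite L" "finite M" using f good_finite by auto
    have card: "card (K \<union> (L \<union> M)) = ?k + (?l + ?m)"
      using fin disj by (simp add: card_Un_disjoint Int_Un_distrib)
    have "bij_betw (\<lambda>a. if a \<in> K then std K a else card K + join L M a) (K \<union> (L \<union> M))
        {..<?k + (?l + ?m)}"
      using disj fin by (intro bij_betw_join std_bij join_bij) auto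
    then have \<rho>: "\<rho> permutes {..<?k + (?l + ?m)}"
      unfolding \<rho>_def using fin renumber_permutes[of "K \<union> (L \<union> M)"] by (simp add: card)
    have 1: "cmp P 3 ?m 2 y (ev_tree M (f 2)) \<in> ops P (Suc (Suc ?m))" if "y \<in> ops P 3" for y
      using cmp_closed[OF that ev_tree_closed[of M "f 2"], of 2] by (simp add: numeral_3_eq_3)
    have 2: "cmp P (Suc (Suc ?m)) ?l 1 y (ev_tree L (f 1)) \<in> ops P (Suc (?l + ?m))"
      if "y \<in> ops P (Suc (Suc ?m))" for y
      using cmp_closed[OF that ev_tree_closed[of L "f 1"], of 1] by (simp add: add.commute)
    have 3: "cmp P (Suc (?l + ?m)) ?k 0 y (ev_tree K (f 0)) \<in> ops P (?k + (?l + ?m))"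
      if "y \<in> ops P (Suc (?l + ?m))" for y
      using cmp_closed[OF that ev_tree_closed[of K "f 0"], of 0] by (simp add: add.commute)
    have lin: "linear_on (scl P) (scl P) (ops P 3) \<Theta>"
      unfolding linear_on_def \<Theta>_def
      by (auto simp del: One_nat_def simp: 1 2 3 ev_tree_closed cmp_add_left cmp_scale_left
          act_add[OF \<rho>] act_scale[OF \<rho>])
    have "ev_tree S (tree_subst f s) = \<Theta> (\<pi> 3 (qp (mon s)))" if "s \<in> Poly_Mapping.keys r" for s
      unfolding S \<Theta>_def \<rho>_def by (rule ev_tree_subst[OF keys[OF that] f disj])
    then have "ev S (subst_comb f r) = (\<Sum>s\<in>Poly_Mapping.keys r.
        scl P (Poly_Mapping.lookup r s) (\<Theta> (\<pi> 3 (qp (mon s)))))"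
      by (simp add: eq)
    also have "\<dots> = \<Theta> (\<Sum>s\<in>Poly_Mapping.keys r.
        scl P (Poly_Mapping.lookup r s) (\<pi> 3 (qp (mon s))))"
      by (rule linear_on_sum[OF vector_space_axioms vector_space_axioms lin subspace_ops, symmetric])
        (simp add: pi_closed keys tree_monomials_iff)
    also have "(\<Sum>s\<in>Poly_Mapping.keys r. scl P (Poly_Mapping.lookup r s) (\<pi> 3 (qp (mon s)))) =
        \<pi> 3 (qp (\<Sum>s\<in>Poly_Mapping.keys r. pm_scale (Poly_Mapping.lookup r s) (mon s)))"
      by (rule pi_sum[symmetric]) (simp add: keys tree_monomials_iff)
    also have "\<dots> = 0" using null unfolding pm_expand[of r, symmetric] .
    also have "\<Theta> 0 = 0"
      by (rule linear_on_zero[OF vector_space_axioms vector_space_axioms lin subspace_ops])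
    finally show ?thesis .
  qed
qed

text \<open>
  Trees that contain a relation have the value 0, if the relations do.
\<close>

lemma ext_relations_null:
  assumes Q: "\<And>q. q \<in> Q \<Longrightarrow> q \<in> combs 3 \<and> \<pi> 3 (qp q) = 0"
  shows "r \<in> ext_relations P X Q \<Longrightarrow> r \<in> null_combs"
proof (induction rule: ext_relations.induct)
  case (add x ts y)
  then show ?case
    using ev_tree_relation[OF ext_relations.add[of x X ts y P "{}", OF add]] by (simp add: null_combs_def)
next
  case (scale x ts a)
  then show ?case
    using ev_tree_relation[OF ext_relations.scale[of x X ts P a "{}", OF scale]] by (simp add: null_combs_def)
next
  case (equivariance x ts \<sigma>)
  then show ?case
    using ev_tree_relation[OF ext_relations.equivariance[of x X ts \<sigma> P "{}", OF equivariance]]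
    by (simp add: null_combs_def)
next
  case (vertex r x us vs)
  then show ?case by (intro null_combs_vertex) auto
next
  case (base r f)
  then show ?case using Q by (intro null_combs_subst) auto
qed

subsection \<open>The kernel of the natural surjection\<close>

text \<open>The tree representatives of a set \<open>R\<close> of elements of arity 3 of the free operad.\<close>

definition lifts :: "('a tree \<Rightarrow>\<^sub>0 'k) set \<Rightarrow> ('a tree \<Rightarrow>\<^sub>0 'k) set" where
  "lifts R = {r \<in> combs 3. qp r \<in> R}"

text \<open>
  The classes of the linear combinations of trees that contain an element of \<open>Q\<close> form an operadic
  ideal.  If \<open>Q\<close> represents \<open>R\<close>, this ideal contains \<open>R\<close> and hence the ideal generated by \<open>R\<close>.
\<close>

lemma operadic_ideal_ext_relations: "operadic_ideal F (\<lambda>n. ops F n \<inter> ideal Q)"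
proof -
  have sub: "pm.subspace (ops F n \<inter> ideal Q)" for n
    unfolding ops_F
    by (intro pm.subspace_inter pm.subspace_span qp.subspace_image subspace_combs)
  have act: "act F n \<sigma> x \<in> ops F n \<inter> ideal Q"
    if \<sigma>: "\<sigma> permutes {..<n}" and x: "x \<in> ops F n \<inter> ideal Q" for n \<sigma> x
  proof -
    obtain v where v: "v \<in> combs n" "x = qp v" using x by (auto simp: ops_F)
    have "act F n \<sigma> x = qp (subst_comb (\<lambda>a. Leaf (\<sigma> a)) v)"
      by (simp add: act_F v subst_comb_qp)
    then have "act F n \<sigma> x \<in> ops F n" using combs_act[OF v(1) \<sigma>] by (auto simp: ops_F)
    moreover have "act F n \<sigma> x \<in> ideal Q"
      using x by (simp add: act_F qp_ideal_iff subst_comb_span_ext_relations)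
    ultimately show ?thesis by simp
  qed
  have cmp: "cmp F m n i p q \<in> ops F (m + n - 1) \<inter> ideal Q"
    if i: "i < m" and p: "p \<in> ops F m" and q: "q \<in> ops F n"
      and J: "p \<in> ops F m \<inter> ideal Q \<or> q \<in> ops F n \<inter> ideal Q" for m n i p q
  proof -
    obtain u v where u: "u \<in> combs m" "p = qp u" and v: "v \<in> combs n" "q = qp v"
      using p q by (auto simp: ops_F)
    have eq: "cmp F m n i p q = qp (graft_comb n i u v)"
      by (simp add: cmp_F u v graft_comb_qp[OF u(1) i])
    moreover have "graft_comb n i u v \<in> ideal Q"
      using J u(1) i
      by (auto simp: u(2) v(2) qp_ideal_iff intro: graft_comb_ideal_left graft_comb_ideal_right)
    ultimately show ?thesis
      using combs_graft[OF u(1) v(1) i] by (auto simp: ops_F qp_ideal_iff)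
  qed
  show ?thesis
    unfolding operadic_ideal_def S_submodule_def scl_F using sub act cmp by blast
qed

lemma kernel_subset_ideal:
  assumes R: "\<And>n. n \<noteq> 3 \<Longrightarrow> R n = {0}" "R 3 \<subseteq> ops F 3" and gen: "generates_kernel F \<pi> R"
    and v: "v \<in> combs n" "\<pi> n (qp v) = 0"
  shows "v \<in> ideal (lifts (R 3))"
proof -
  let ?J = "\<lambda>n. ops F n \<inter> ideal (lifts (R 3))"
  have "R 3 \<subseteq> ?J 3"
  proof
    fix r assume r: "r \<in> R 3"
    then obtain w where w: "w \<in> combs 3" "r = qp w" using R(2) by (auto simp: ops_F)
    then have "subst_comb Leaf w \<in> ideal (lifts (R 3))"
      using r by (intro pm.span_base ext_relations.base) (auto simp: lifts_def)
    then have "w \<in> ideal (lifts (R 3))" by (simp add: subst_comb_ident)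
    then show "r \<in> ?J 3" using w by (auto simp: ops_F qp_ideal_iff)
  qed
  moreover have "0 \<in> ?J n" for n
    unfolding ops_F by (auto intro!: pm.span_zero image_eqI[of _ _ 0] pm.subspace_0[OF subspace_combs])
  ultimately have "R m \<subseteq> ?J m" for m using R(1) by (cases "m = 3") auto
  then have "ideal_generated F R n \<subseteq> ?J n"
    unfolding ideal_generated_def
    by (intro Inter_lower CollectI exI[of _ ?J] conjI allI operadic_ideal_ext_relations refl)
  moreover have "qp v \<in> ideal_generated F R n"
    using gen v by (auto simp: generates_kernel_def ops_F)
  ultimately show ?thesis by (auto simp: qp_ideal_iff)
qed

lemma lifts_null:
  assumes "generates_kernel F \<pi> R" "q \<in> lifts (R 3)"
  shows "q \<in> combs 3 \<and> \<pi> 3 (qp q) = 0"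
proof -
  have "R 3 \<subseteq> ideal_generated F R 3" by (auto simp: ideal_generated_def)
  then show ?thesis using assms by (auto simp: generates_kernel_def lifts_def)
qed

subsection \<open>Finiteness\<close>

lemma finite_trees:
  assumes "finite B"
  shows "finite {t. decorated (\<lambda>n. if n = 2 then B else {}) t \<and> set (leaves t) \<subseteq> {..<n} \<and>
    length (leaves t) \<le> k}" (is "finite (?T k)")
proof (induction k)
  case 0
  have "length (leaves t) > 0" if "decorated (\<lambda>n. if n = 2 then B else {}) t" for t
    using that by (induction t) (auto simp: list_all_iff length_Suc_conv numeral_2_eq_2
        split: if_splits)
  then have "?T 0 = {}" by auto
  then show ?case by (simp only: finite.emptyI)
next
  case (Suc k)
  have pos: "length (leaves t) > 0" if "decorated (\<lambda>n. if n = 2 then B else {}) t" for t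
    using that by (induction t) (auto simp: list_all_iff length_Suc_conv numeral_2_eq_2
        split: if_splits)
  have "?T (Suc k) \<subseteq> Leaf ` {..<n} \<union> (\<lambda>(b, s, t). Node b [s, t]) ` (B \<times> ?T k \<times> ?T k)"
  proof
    fix t assume t: "t \<in> ?T (Suc k)"
    show "t \<in> Leaf ` {..<n} \<union> (\<lambda>(b, s, t). Node b [s, t]) ` (B \<times> ?T k \<times> ?T k)"
    proof (cases t)
      case (Leaf a)
      then show ?thesis using t by auto
    next
      case (Node b ts)
      then have "length ts = 2" "b \<in> B" using t by (auto split: if_splits)
      then obtain s u where ts: "ts = [s, u]" by (auto simp: length_Suc_conv numeral_2_eq_2)
      then have "s \<in> ?T k" "u \<in> ?T k"
        using t Node pos[of s] pos[of u] by (auto simp flip: length_greater_0_conv)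
      then show ?thesis
        using Node ts \<open>b \<in> B\<close> by (intro UnI2 image_eqI[of _ _ "(b, s, u)"]) auto
    qed
  qed
  then show ?case using Suc assms by (auto intro: finite_subset)
qed

text \<open>
  Every decorated tree is, modulo the relations of the free operad, a linear combination of binary
  trees that are decorated by a given basis of \<open>X(2)\<close>.
\<close>

lemma tree_in_span_basis_trees:
  assumes B: "X 2 \<subseteq> span B" "B \<subseteq> X 2"
  shows "decorated X t \<Longrightarrow> mon t \<in> pm.span (ext_relations P X {} \<union>
    mon ` {s. decorated (\<lambda>n. if n = 2 then B else {}) s \<and> mset (leaves s) = mset (leaves t)})"
proof (induction t)
  case (Leaf a)
  then show ?case by (intro pm.span_base) auto
next
  case (Node x ts)
  let ?U = "\<lambda>M. pm.span (ext_relations P X {} \<union>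
    mon ` {s. decorated (\<lambda>n. if n = 2 then B else {}) s \<and> mset (leaves s) = M})"
  have rel: "ideal {} \<subseteq> ?U M" for M by (intro pm.span_mono) auto
  let ?M = "mset (leaves (Node x ts))"
  show ?case
  proof (cases "length ts = 2")
    case False
    then have "x = 0" using Node.prems X_trivial by auto
    then have "mon (Node x ts) \<in> ideal {}"
      using pm.span_base[OF ext_relations.scale[of 0 X ts P 0 "{}", OF X_closed(1)]] by simp
    then show ?thesis using rel by blast
  next
    case True
    then obtain s t where ts: "ts = [s, t]" by (auto simp: length_Suc_conv numeral_2_eq_2)
    have x: "x \<in> X 2" and st: "decorated X s" "decorated X t"
      using Node.prems True by (auto simp: ts numeral_2_eq_2)
    have base: "mon (Node b [s', t']) \<in> ?U ?M"
      if "b \<in> B" "decorated (\<lambda>n. if n = 2 then B else {}) s'" "mset (leaves s') = mset (leaves s)"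
        "decorated (\<lambda>n. if n = 2 then B else {}) t'" "mset (leaves t') = mset (leaves t)"
      for b s' t'
      using that by (intro pm.span_base) (auto simp: ts numeral_2_eq_2)
    have right: "mon (Node b [s', t]) \<in> ?U ?M"
      if b: "b \<in> B" and s': "decorated (\<lambda>n. if n = 2 then B else {}) s'"
        "mset (leaves s') = mset (leaves s)" for b s'
    proof -
      have "vertex_comb b [s'] (mon t) [] \<in> ?U ?M"
      proof (rule linear_image_span_closed[OF vertex_comb.linear_axioms pm.subspace_span])
        show "mon t \<in> ?U (mset (leaves t))" by (rule Node.IH) (auto simp: ts st)
        fix v assume "v \<in> ext_relations P X {} \<union>
          mon ` {s. decorated (\<lambda>n. if n = 2 then B else {}) s \<and> mset (leaves s) = mset (leaves t)}"
        then show "vertex_comb b [s'] v [] \<in> ?U ?M"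
        proof
          assume "v \<in> ext_relations P X {}"
          then have "vertex_comb b [s'] v [] \<in> ideal {}"
            using b B(2) by (intro pm.span_base ext_relations.vertex) (auto simp: numeral_2_eq_2)
          then show ?thesis using rel by blast
        qed (use base[OF b s'] in auto)
      qed
      then show ?thesis by simp
    qed
    have left: "mon (Node b [s, t]) \<in> ?U ?M" if b: "b \<in> B" for b
    proof -
      have "vertex_comb b [] (mon s) [t] \<in> ?U ?M"
      proof (rule linear_image_span_closed[OF vertex_comb.linear_axioms pm.subspace_span])
        show "mon s \<in> ?U (mset (leaves s))" by (rule Node.IH) (auto simp: ts st)
        fix v assume "v \<in> ext_relations P X {} \<union>
          mon ` {u. decorated (\<lambda>n. if n = 2 then B else {}) u \<and> mset (leaves u) = mset (leaves s)}"
        then show "vertex_comb b [] v [t] \<in> ?U ?M"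
        proof
          assume "v \<in> ext_relations P X {}"
          then have "vertex_comb b [] v [t] \<in> ideal {}"
            using b B(2) by (intro pm.span_base ext_relations.vertex) (auto simp: numeral_2_eq_2)
          then show ?thesis using rel by blast
        qed (use right[OF b] in auto)
      qed
      then show ?thesis by simp
    qed
    have add: "mon (Node (y + z) [s, t]) - mon (Node y [s, t]) - mon (Node z [s, t]) \<in> ?U ?M"
      if "y \<in> X 2" "z \<in> X 2" for y z
      using that rel pm.span_base[OF ext_relations.add[of y X "[s, t]" z P "{}"]]
      by (auto simp: numeral_2_eq_2)
    have scale: "mon (Node (scl P a y) [s, t]) - pm_scale a (mon (Node y [s, t])) \<in> ?U ?M"
      if "y \<in> X 2" for y a
      using that rel pm.span_base[OF ext_relations.scale[of y X "[s, t]" P a "{}"]]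
      by (auto simp: numeral_2_eq_2)
    have "x \<in> span B" using x B by auto
    then have "x \<in> X 2 \<and> mon (Node x [s, t]) \<in> ?U ?M"
    proof (induction rule: span_induct_alt)
      case base
      have "mon (Node 0 [s, t]) \<in> ?U ?M"
        using scale[OF X_closed(1), of 0] by simp
      then show ?case using X_closed by simp
    next
      case (step a y z)
      have y: "y \<in> X 2" "scl P a y \<in> X 2" using step.hyps B X_closed by auto
      have "mon (Node (scl P a y) [s, t]) \<in> ?U ?M"
        using pm.span_add[OF scale[OF y(1), of a] pm.span_scale[OF left[OF step.hyps(1)], of a]]
        by simp
      moreover have z: "z \<in> X 2" "mon (Node z [s, t]) \<in> ?U ?M" using step.IH by auto
      ultimately have "mon (Node (scl P a y + z) [s, t]) \<in> ?U ?M"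
        using pm.span_add[OF add[OF y(2) z(1)] pm.span_add[OF _ z(2)]] by fastforce
      then show ?case using X_closed y z by simp
    qed
    then show ?thesis by (simp add: ts)
  qed
qed

end

lemma linear_on_span_closed:
  assumes "vector_space s1" "vector_space s2" "linear_on s1 s2 U f" "module.subspace s1 U"
    and "B \<subseteq> U" "x \<in> module.span s1 B" "module.subspace s2 V" "\<And>b. b \<in> B \<Longrightarrow> f b \<in> V"
  shows "f x \<in> V"
proof -
  interpret v1: vector_space s1 by fact
  interpret v2: vector_space s2 by fact
  note lin = assms(3)[unfolded linear_on_def]
  from assms(6) have "x \<in> U \<and> f x \<in> V"
  proof (induction rule: v1.span_induct_alt)
    case base
    then show ?case
      using v1.subspace_0[OF assms(4)] v2.subspace_0[OF assms(7)] linear_on_zero[OF assms(1-4)] by simp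
  next
    case (step c b y)
    then have b: "b \<in> U" "f b \<in> V" using assms by auto
    then have "s1 c b \<in> U" "f (s1 c b) = s2 c (f b)"
      using v1.subspace_scale[OF assms(4)] lin by auto
    then show ?case
      using step b lin v1.subspace_add[OF assms(4)] v2.subspace_add[OF assms(7)]
        v2.subspace_scale[OF assms(7)] by auto
  qed
  then show ?thesis by simp
qed

text \<open>A basis of a subspace, chosen once and for all.\<close>

definition basis_of :: "('k::field \<Rightarrow> 'v::ab_group_add \<Rightarrow> 'v) \<Rightarrow> 'v set \<Rightarrow> 'v set" where
  "basis_of s V = (SOME B. B \<subseteq> V \<and> \<not> module.dependent s B \<and> V \<subseteq> module.span s B \<and>
     card B = vector_space.dim s V)"

context vector_space begin

lemma basis_of:
  "basis_of scale V \<subseteq> V" "independent (basis_of scale V)" "V \<subseteq> span (basis_of scale V)" "card (basis_of scale V) = dim V"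
proof -
  have "\<exists>B. B \<subseteq> V \<and> independent B \<and> V \<subseteq> span B \<and> card B = dim V"
    by (meson basis_exists)
  from someI_ex[OF this]
  show "basis_of scale V \<subseteq> V" "independent (basis_of scale V)" "V \<subseteq> span (basis_of scale V)"
    "card (basis_of scale V) = dim V"
    by (auto simp: basis_of_def)
qed

lemma finite_basis_of: "finite A \<Longrightarrow> V \<subseteq> span A \<Longrightarrow> finite (basis_of scale V)"
  using independent_span_bound[of A "basis_of scale V"] basis_of(1,2)[of V] by auto

lemma span_basis_of: "subspace V \<Longrightarrow> span (basis_of scale V) = V"
  using basis_of[of V] by (simp add: span_minimal subset_antisym)

end

text \<open>A binary presentation with finitely many generators.\<close>

locale finite_binary_presentation = binary_presentation P X \<pi>
  for P :: "('k::field, 'a::ab_group_add) operad" and X \<pi> +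
  assumes finite_generators: "\<exists>B. finite B \<and> X 2 \<subseteq> span B"
begin

text \<open>Bases of the generators and of the components of \<open>P\<close>.\<close>

definition gens :: "'a set" where
  "gens = basis_of (scl P) (X 2)"

definition basis :: "nat \<Rightarrow> 'a set" where
  "basis n = basis_of (scl P) (ops P n)"

lemma gens: "gens \<subseteq> X 2" "independent gens" "span gens = X 2" "finite gens"
    "card gens = dim (X 2)"
  using basis_of[of "X 2"] finite_generators finite_basis_of X_subspace
  by (auto simp: gens_def span_basis_of)

text \<open>
  The binary trees of arity \<open>n\<close> decorated by the basis of \<open>X(2)\<close>.  The set is finite and spans the
  free operad in arity \<open>n\<close>, so all components considered below have finite dimension.
\<close>

definition basis_trees :: "nat \<Rightarrow> 'a tree set" where
  "basis_trees n = {s. decorated (\<lambda>n. if n = 2 then gens else {}) s \<and>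
     mset (leaves s) = mset_set {..<n}}"

lemma basis_trees_leaves:
  assumes "t \<in> basis_trees n"
  shows "set (leaves t) = {..<n}" "length (leaves t) = n" "distinct (leaves t)"
proof -
  have eq: "mset (leaves t) = mset_set {..<n}" using assms by (simp add: basis_trees_def)
  show set: "set (leaves t) = {..<n}" using arg_cong[OF eq, of set_mset] by simp
  show len: "length (leaves t) = n" using arg_cong[OF eq, of size] by simp
  show "distinct (leaves t)" by (rule card_distinct) (simp add: set len)
qed

lemma finite_basis_trees: "finite (basis_trees n)"
  by (rule finite_subset[OF _ finite_trees[OF gens(4), of n n]])
    (auto simp: basis_trees_leaves, simp add: basis_trees_def)

lemma basis_trees_good: "basis_trees n \<subseteq> tree_monomials X n"
proof
  fix t assume t: "t \<in> basis_trees n"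
  have "decorated X s" if "decorated (\<lambda>n. if n = 2 then gens else {}) s" for s
    using that
  proof (induction s)
    case (Node x ts)
    then have "length ts = 2" "x \<in> gens" by (auto split: if_splits)
    then show ?case using Node gens(1) by (auto simp: list_all_iff)
  qed simp
  then show "t \<in> tree_monomials X n"
    using basis_trees_leaves[OF t] t by (auto simp: tree_monomials_def basis_trees_def)
qed

lemma ops_F_span: "ops F n \<subseteq> pm.span ((\<lambda>t. qp (mon t)) ` basis_trees n)"
proof
  fix y assume "y \<in> ops F n"
  then obtain v where v: "v \<in> combs n" "y = qp v" by (auto simp: ops_F)
  have "v \<in> pm.span (ext_relations P X {} \<union> mon ` basis_trees n)"
  proof (subst pm_expand, intro pm.span_sum pm.span_scale)
    fix t assume "t \<in> Poly_Mapping.keys v"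
    then have "good {..<n} t" using v by (auto simp: combs_iff tree_monomials_iff)
    then have t: "decorated X t" "mset (leaves t) = mset_set {..<n}"
      using mset_set_set[of "leaves t"] by (simp_all add: good_def)
    show "mon t \<in> pm.span (ext_relations P X {} \<union> mon ` basis_trees n)"
      using tree_in_span_basis_trees[OF _ gens(1) t(1)] gens(3) t(2) by (simp add: basis_trees_def)
  qed
  then show "y \<in> pm.span ((\<lambda>t. qp (mon t)) ` basis_trees n)"
    unfolding v(2)
  proof (rule linear_image_span_closed[OF qp.linear_axioms pm.subspace_span, rotated])
    fix x assume "x \<in> ext_relations P X {} \<union> mon ` basis_trees n"
    then show "qp x \<in> pm.span ((\<lambda>t. qp (mon t)) ` basis_trees n)"
    proof
      assume "x \<in> ext_relations P X {}"
      then have "qp x = 0" unfolding qp_eq_0_iff by (rule pm.span_base)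
      then show ?thesis by (simp add: pm.span_zero)
    qed (auto intro: pm.span_base)
  qed
qed

lemma ops_P_span: "ops P n \<subseteq> span ((\<lambda>t. \<pi> n (qp (mon t))) ` basis_trees n)"
proof
  fix y assume "y \<in> ops P n"
  then obtain v where v: "v \<in> combs n" "y = \<pi> n (qp v)" by (metis pi_surj)
  have lin: "linear_on pm_scale (scl P) (ops F n) (\<pi> n)"
    using morphism by (auto simp: operad_morphism_def linear_on_def)
  show "y \<in> span ((\<lambda>t. \<pi> n (qp (mon t))) ` basis_trees n)"
    unfolding v(2)
  proof (rule linear_on_span_closed[OF pm.vector_space_axioms vector_space_axioms lin])
    show "pm.subspace (ops F n)"
      unfolding ops_F by (intro qp.subspace_image subspace_combs)
    show "qp v \<in> pm.span ((\<lambda>t. qp (mon t)) ` basis_trees n)"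
      using ops_F_span v by (auto simp: ops_F)
    show "(\<lambda>t. qp (mon t)) ` basis_trees n \<subseteq> ops F n"
      using basis_trees_good by (auto simp: ops_F subset_iff intro!: imageI)
  qed (auto intro: span_base)
qed

lemma basis: "basis n \<subseteq> ops P n" "independent (basis n)" "span (basis n) = ops P n"
    "finite (basis n)" "card (basis n) = dim (ops P n)"
  using basis_of[of "ops P n"] finite_basis_of[OF _ ops_P_span] finite_basis_trees subspace_ops
  by (auto simp: basis_def span_basis_of)

lemma basis_0: "basis 0 = {}"
  using basis(1,2)[of 0] dependent_zero[of "basis 0"] by (auto simp: ops_0)

lemma dim_ops_0: "dim (ops P 0) = 0"
  using basis(5)[of 0] by (simp add: basis_0)

lemma dim_ops_1: "dim (ops P 1) = 1"
  unfolding ops_1 dim_span using dim_eq_card_independent[of "{unt P}"] unt_nonzero by simp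

lemma finite_dim_F_subspace:
  assumes "V \<subseteq> ops F n"
  shows "finite (basis_of pm_scale V)"
  using pm.finite_basis_of[of "(\<lambda>t. qp (mon t)) ` basis_trees n" V] assms ops_F_span[of n]
    finite_basis_trees by auto

subsection \<open>Lifting elements to trees\<close>

lemma ev_surj:
  assumes S: "finite S" and y: "y \<in> ops P (card S)"
  shows "\<exists>v. v \<in> labelled S \<and> ev S v = y"
proof -
  obtain w where w: "w \<in> combs (card S)" "\<pi> (card S) (qp w) = y" using pi_surj[OF y] .
  let ?h = "inv_into S (std S)"
  have bij: "bij_betw ?h {..<card S} S" by (rule bij_betw_inv_into[OF std_bij[OF S]])
  have good: "good {..<card S} t" if "t \<in> Poly_Mapping.keys w" for t
    using w(1) that by (auto simp: combs_iff tree_monomials_iff)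
  have good': "good S (relabel ?h t)" if "t \<in> Poly_Mapping.keys w" for t
    using good_relabel[OF good[OF that], of ?h] bij by (simp add: bij_betw_def)
  let ?v = "lin_ext (\<lambda>t. mon (relabel ?h t)) w"
  have "?v \<in> labelled S"
    using good' by (intro lin_ext_closed subspace_labelled) (simp add: labelled_iff)
  moreover have "ev S ?v = ev {..<card S} w"
  proof -
    have "ev_tree S (relabel ?h t) = ev_tree {..<card S} t" if t: "t \<in> Poly_Mapping.keys w" for t
    proof -
      have "relabel (std S) (relabel ?h t) = relabel (std {..<card S}) t"
        unfolding relabel_relabel
      proof (rule relabel_cong)
        fix a assume "a \<in> set (leaves t)"
        then have a: "a < card S" using good[OF t] by (simp add: good_def)
        then have "a \<in> std S ` S" using std_bij[OF S] by (simp add: bij_betw_def)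
        then show "(std S \<circ> ?h) a = std {..<card S} a"
          using a by (simp add: f_inv_into_f std_lessThan)
      qed
      then show ?thesis using good[OF t] good'[OF t] by (simp add: ev_tree_def)
    qed
    then show ?thesis
      unfolding linear_lin_ext_eq[OF ev.linear_axioms] ev_mon by (simp add: ev_def extend_def)
  qed
  ultimately show ?thesis using ev_lessThan[OF w(1)] w(2) by auto
qed

text \<open>A chosen linear combination of trees with leaves in \<open>S\<close> and value \<open>y\<close>.\<close>

definition lift :: "nat set \<Rightarrow> 'a \<Rightarrow> ('a tree \<Rightarrow>\<^sub>0 'k)" where
  "lift S y = (SOME v. v \<in> labelled S \<and> ev S v = y)"

lemma lift:
  assumes "finite S" "y \<in> ops P (card S)"
  shows "lift S y \<in> labelled S" "ev S (lift S y) = y"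
  using someI_ex[OF ev_surj[OF assms]] by (auto simp: lift_def)

text \<open>
  An index \<open>(S, b, y, z)\<close> stands for the composition with the generator \<open>b\<close> at the root, applied to
  \<open>y\<close> on the inputs in \<open>S\<close> and to \<open>z\<close> on the other inputs.  The condition \<open>0 \<in> S\<close> selects one of the
  two orders of the factors.
\<close>

definition indices :: "nat \<Rightarrow> (nat set \<times> 'a \<times> 'a \<times> 'a) set" where
  "indices n = (SIGMA S:{S. S \<subseteq> {..<n} \<and> 0 \<in> S}. gens \<times> basis (card S) \<times> basis (n - card S))"

text \<open>The composition that an index stands for, lifted to trees.\<close>

definition index_tree :: "nat \<Rightarrow> nat set \<times> 'a \<times> 'a \<times> 'a \<Rightarrow> ('a tree \<Rightarrow>\<^sub>0 'k)" where
  "index_tree n = (\<lambda>(S, b, y, z). node_comb b (lift S y) (lift ({..<n} - S) z))"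

lemma card_compl: "S \<subseteq> {..<n} \<Longrightarrow> card ({..<n} - S) = n - card S"
  by (simp add: card_Diff_subset finite_subset)

lemma finite_indices: "finite (indices n)"
  unfolding indices_def by (intro finite_SigmaI) (auto simp: gens basis)

lemma card_indices: "card (indices n) =
    (\<Sum>S | S \<subseteq> {..<n} \<and> 0 \<in> S. dim (X 2) * (dim (ops P (card S)) * dim (ops P (n - card S))))"
  unfolding indices_def
  by (subst card_SigmaI) (auto simp: gens basis card_cartesian_product)

lemma index_tree_props:
  assumes "S \<subseteq> {..<n}" "b \<in> gens" "y \<in> basis (card S)" "z \<in> basis (n - card S)"
  shows "index_tree n (S, b, y, z) \<in> combs n"
    and "ev {..<n} (index_tree n (S, b, y, z)) = root_cmp S ({..<n} - S) b y z"
proof -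
  let ?T = "{..<n} - S"
  have fin: "finite S" "finite ?T" "S \<inter> ?T = {}" using assms(1) finite_subset by auto
  have un: "S \<union> ?T = {..<n}" using assms(1) by auto
  have b: "b \<in> X 2" using assms(2) gens by auto
  have yz: "y \<in> ops P (card S)" "z \<in> ops P (card ?T)"
    using assms basis(1) card_compl[OF assms(1)] by auto
  note l = lift[OF fin(1) yz(1)] lift[OF fin(2) yz(2)]
  show "index_tree n (S, b, y, z) \<in> combs n"
    using labelled_node_comb[OF b fin(3) l(1,3)] unfolding un
    by (simp add: index_tree_def labelled_lessThan)
  show "ev {..<n} (index_tree n (S, b, y, z)) = root_cmp S ?T b y z"
    using ev_node_comb[OF b fin l(1,3)] l unfolding un by (simp add: index_tree_def)
qed

lemma root_cmp_in_span:
  assumes S: "S \<subseteq> {..<n}" "0 \<in> S"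
    and x: "x \<in> X 2" and y: "y \<in> ops P (card S)" and z: "z \<in> ops P (n - card S)"
  shows "root_cmp S ({..<n} - S) x y z \<in> span ((\<lambda>i. ev {..<n} (index_tree n i)) ` indices n)"
    (is "_ \<in> ?U")
proof -
  let ?T = "{..<n} - S"
  have fin: "finite S" "finite ?T" "S \<inter> ?T = {}" using S finite_subset by auto
  note cl = linear_on_span_closed[OF vector_space_axioms vector_space_axioms]
  have basis_T: "basis (card ?T) = basis (n - card S)" by (simp add: card_compl S)
  have 1: "root_cmp S ?T b y' z' \<in> ?U"
    if "b \<in> gens" "y' \<in> basis (card S)" "z' \<in> basis (card ?T)" for b y' z'
  proof -
    have "(S, b, y', z') \<in> indices n" using that S by (simp add: indices_def basis_T)
    moreover have "root_cmp S ?T b y' z' = ev {..<n} (index_tree n (S, b, y', z'))"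
      using index_tree_props(2)[OF S(1)] that by (simp add: basis_T)
    ultimately show ?thesis by (metis (no_types, lifting) image_eqI span_base)
  qed
  have z': "z \<in> ops P (card ?T)" using z S by (simp add: card_compl)
  have gens_ops: "b \<in> ops P 2" if "b \<in> gens" for b
    using that gens(1) X_ops by auto
  have 2: "root_cmp S ?T b y' z \<in> ?U" if "b \<in> gens" "y' \<in> basis (card S)" for b y'
  proof -
    have y': "y' \<in> ops P (card S)" using that basis(1) by auto
    show ?thesis
      by (rule cl[OF root_cmp_linear(3)[OF fin gens_ops[OF that(1)] y' z'] subspace_ops basis(1)
            _ subspace_span]) (use that 1 basis(3) z' in auto)
  qed
  have 3: "root_cmp S ?T b y z \<in> ?U" if "b \<in> gens" for b
    by (rule cl[OF root_cmp_linear(2)[OF fin gens_ops[OF that] y z'] subspace_ops basis(1)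
          _ subspace_span]) (use that 2 basis(3) y in auto)
  show ?thesis
    by (rule cl[OF root_cmp_linear(1)[OF fin X_ops[OF x] y z'] subspace_ops _ _ subspace_span,
          where B = gens]) (use 3 gens x X_ops in auto)
qed

text \<open>
  Every operation of arity \<open>n \<ge> 2\<close> is a linear combination of compositions with a generator at the
  root.
\<close>

lemma ops_in_span:
  assumes n: "2 \<le> n"
  shows "ops P n \<subseteq> span ((\<lambda>i. ev {..<n} (index_tree n i)) ` indices n)" (is "_ \<subseteq> ?U")
proof
  fix y assume "y \<in> ops P n"
  then obtain v where v: "v \<in> combs n" "y = \<pi> n (qp v)" by (metis pi_surj)
  have tree: "ev_tree {..<n} t \<in> ?U" if good: "good {..<n} t" for t
  proof (cases t)
    case (Leaf a)
    then have "{a} = {..<n}" using good by (simp add: good_def)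
    then have "card {..<n} = 1" by (metis card_1_singleton_iff One_nat_def)
    then show ?thesis using n by simp
  next
    case (Node x ts)
    show ?thesis
    proof (cases "length ts = 2")
      case False
      then have "x = 0" using good X_trivial by (auto simp: good_def Node)
      then show ?thesis by (simp add: Node ev_tree_zero span_zero)
    next
      case True
      then obtain s u where ts: "ts = [s, u]" by (auto simp: length_Suc_conv numeral_2_eq_2)
      then obtain L M where LM: "good L s" "good M u" "L \<inter> M = {}" "{..<n} = L \<union> M" and x: "x \<in> X 2"
        using good by (auto simp: Node good_Node2)
      have M: "M = {..<n} - L" "L \<subseteq> {..<n}" and L: "L = {..<n} - M" "M \<subseteq> {..<n}"
        using LM(3,4) by blast+
      have c: "card M = n - card L" "card L = n - card M"
        using card_compl[OF M(2), folded M(1)] card_compl[OF L(2), folded L(1)] .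
      show ?thesis
      proof (cases "0 \<in> L")
        case True
        have "ev_tree {..<n} t = root_cmp L M x (ev_tree L s) (ev_tree M u)"
          unfolding LM(4) Node ts by (rule ev_tree_Node[OF x LM(1-3)])
        also have "\<dots> \<in> ?U"
          using root_cmp_in_span[OF M(2) True x ev_tree_closed ev_tree_closed[of M u, unfolded c(1)]]
          by (simp flip: M(1))
        finally show ?thesis .
      next
        case False
        have "0 \<in> {..<n}" using n by simp
        then have "0 \<in> M" using False LM(4) by blast
        have "ev_tree {..<n} t = ev_tree {..<n} (Node (swap x) [u, s])"
          unfolding Node ts by (rule ev_tree_swap[OF x])
        also have "\<dots> = root_cmp M L (swap x) (ev_tree M u) (ev_tree L s)"
          unfolding LM(4) Un_commute[of L] using LM(3)
          by (intro ev_tree_Node[OF X_act[OF transpose_permutes x] LM(2,1)]) blast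
        also have "\<dots> \<in> ?U"
          using root_cmp_in_span[OF L(2) \<open>0 \<in> M\<close> X_act[OF transpose_permutes x]
              ev_tree_closed ev_tree_closed[of L s, unfolded c(2)]]
          by (simp flip: L(1))
        finally show ?thesis .
      qed
    qed
  qed
  have "y = ev {..<n} v" by (simp add: ev_lessThan v)
  also have "\<dots> = (\<Sum>t\<in>Poly_Mapping.keys v. scl P (Poly_Mapping.lookup v t) (ev_tree {..<n} t))"
    by (simp add: ev_def extend_def)
  also have "\<dots> \<in> ?U"
    using v(1) tree
    by (intro span_sum span_scale) (auto simp: combs_iff tree_monomials_iff)
  finally show "y \<in> ?U" .
qed

lemma dim_ops_le: "2 \<le> n \<Longrightarrow> dim (ops P n) \<le> card (indices n)"
  using dim_le_card[OF ops_in_span] finite_indices card_image_le[OF finite_indices]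
  by (meson finite_imageI order_trans)

end

lemma lookup_lin_ext: "Poly_Mapping.lookup (lin_ext f v) i =
    (\<Sum>t\<in>Poly_Mapping.keys v. Poly_Mapping.lookup v t * Poly_Mapping.lookup (f t) i)"
  by (simp add: lin_ext_def lookup_sum lookup_pm_scale)

lemma independent_mon: "pm.independent (mon ` I :: (_ \<Rightarrow>\<^sub>0 'k::field) set)"
proof
  assume "pm.dependent (mon ` I :: (_ \<Rightarrow>\<^sub>0 'k) set)"
  then obtain i where "i \<in> I" "(mon i :: _ \<Rightarrow>\<^sub>0 'k) \<in> pm.span (mon ` I - {mon i})"
    unfolding pm.dependent_def by auto
  moreover have "mon ` I - {mon i :: _ \<Rightarrow>\<^sub>0 'k} \<subseteq> mon ` (I - {i})" by auto
  ultimately have "(mon i :: _ \<Rightarrow>\<^sub>0 'k) \<in> pm.span (mon ` (I - {i}))" using pm.span_mono by blast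
  then show False by (simp add: span_mon_iff)
qed

lemma card_mon_image: "card (mon ` I :: (_ \<Rightarrow>\<^sub>0 'k::field) set) = card I"
proof (rule card_image, rule inj_onI)
  fix i j assume "mon i = (mon j :: _ \<Rightarrow>\<^sub>0 'k)"
  then have "Poly_Mapping.keys (mon i :: _ \<Rightarrow>\<^sub>0 'k) = Poly_Mapping.keys (mon j :: _ \<Rightarrow>\<^sub>0 'k)" by simp
  then show "i = j" by simp
qed

lemma permutes_2_cases:
  assumes "\<sigma> permutes {..<2::nat}"
  shows "\<sigma> = id \<or> \<sigma> = Transposition.transpose 0 1"
proof -
  have "\<sigma> 0 < 2" "\<sigma> 1 < 2" "\<sigma> 0 \<noteq> \<sigma> 1"
    using permutes_in_image[OF assms] permutes_inj[OF assms] by (auto dest: injD)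
  then have "\<sigma> 0 = 0 \<and> \<sigma> 1 = 1 \<or> \<sigma> 0 = 1 \<and> \<sigma> 1 = 0" by linarith
  moreover have "\<sigma> a = a" if "a \<noteq> 0" "a \<noteq> 1" for a
    using permutes_not_in[OF assms, of a] that by simp
  ultimately show ?thesis
    by (metis (no_types, opaque_lifting) eq_id_iff ext transpose_apply_first transpose_apply_other
        transpose_apply_second)
qed

lemma bilinear_sum:
  fixes u w f g f' g' :: "_ \<Rightarrow> 'k::field"
  shows "(\<Sum>s\<in>I. u s * (\<Sum>t\<in>J. w t * (A * f s * g t + B * f' t * g' s))) =
    A * (\<Sum>s\<in>I. u s * f s) * (\<Sum>t\<in>J. w t * g t) + B * (\<Sum>t\<in>J. w t * f' t) * (\<Sum>s\<in>I. u s * g' s)"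
proof -
  define C D where "C = A * (\<Sum>t\<in>J. w t * g t)" and "D = B * (\<Sum>t\<in>J. w t * f' t)"
  have "(\<Sum>t\<in>J. w t * (A * f s * g t + B * f' t * g' s)) = C * f s + D * g' s" for s
    unfolding C_def D_def
    by (simp add: sum.distrib sum_distrib_left sum_distrib_right algebra_simps)
  then have "(\<Sum>s\<in>I. u s * (\<Sum>t\<in>J. w t * (A * f s * g t + B * f' t * g' s))) =
      C * (\<Sum>s\<in>I. u s * f s) + D * (\<Sum>s\<in>I. u s * g' s)"
    by (simp add: sum.distrib sum_distrib_left algebra_simps)
  then show ?thesis by (simp add: C_def D_def mult_ac)
qed

context finite_binary_presentation begin

section \<open>The coordinate map\<close>

text \<open>
  The coordinates of a tree with root \<open>x\<close> and subtrees \<open>s\<close>, \<open>u\<close>, evaluated in \<open>P\<close>.  Since a tree that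
  does not have the labels \<open>S\<close> evaluates to 0, the first summand counts if \<open>S\<close> is the set of labels of
  \<open>s\<close>, and the second one if it is that of \<open>u\<close>; in the second case the subtrees trade places and \<open>x\<close> is
  replaced by its transpose.  The coordinates of all other trees are 0.
  The symmetry of this formula makes it compatible with equivariance.
\<close>

definition coord :: "nat \<Rightarrow> nat set \<times> 'a \<times> 'a \<times> 'a \<Rightarrow> 'a tree \<Rightarrow> 'k" where
  "coord n i t = (case t of Node x [s, u] \<Rightarrow> (case i of (S, b, y, z) \<Rightarrow>
      if x \<in> X 2 then
        representation gens x b * representation (basis (card S)) (ev_tree S s) y *
          representation (basis (n - card S)) (ev_tree ({..<n} - S) u) z +
        representation gens (swap x) b * representation (basis (card S)) (ev_tree S u) y *
          representation (basis (n - card S)) (ev_tree ({..<n} - S) s) z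
      else 0) | _ \<Rightarrow> 0)"

text \<open>
  The coordinate map from combinations of trees to combinations of indices, that is, to \<open>(X \<circ> P)(n)\<close>.
\<close>

definition Psi :: "nat \<Rightarrow> ('a tree \<Rightarrow>\<^sub>0 'k) \<Rightarrow> (nat set \<times> 'a \<times> 'a \<times> 'a \<Rightarrow>\<^sub>0 'k)" where
  "Psi n = lin_ext (\<lambda>t. \<Sum>i\<in>indices n. pm_scale (coord n i t) (mon i))"

sublocale Psi: Vector_Spaces.linear pm_scale pm_scale "Psi n"
  unfolding Psi_def by (rule linear_lin_ext)

lemma coord_other: "length ts \<noteq> 2 \<Longrightarrow> coord n i (Node x ts) = 0"
  by (auto simp: coord_def split: list.splits)

lemma coord_Leaf [simp]: "coord n i (Leaf a) = 0"
  by (simp add: coord_def)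

lemma coord_Node: "coord n (S, b, y, z) (Node x [s, u]) = (if x \<in> X 2 then
        representation gens x b * representation (basis (card S)) (ev_tree S s) y *
          representation (basis (n - card S)) (ev_tree ({..<n} - S) u) z +
        representation gens (swap x) b * representation (basis (card S)) (ev_tree S u) y *
          representation (basis (n - card S)) (ev_tree ({..<n} - S) s) z
      else 0)"
  by (simp add: coord_def)

lemma lookup_Psi_mon:
  "Poly_Mapping.lookup (Psi n (mon t)) i = (if i \<in> indices n then coord n i t else 0)"
  using finite_indices[of n]
  by (simp add: Psi_def lookup_sum lookup_pm_scale lookup_mon if_distrib cong: if_cong)

lemma Psi_lin_ext: "Psi n (lin_ext f v) = lin_ext (\<lambda>t. Psi n (f t)) v"
  using linear_lin_ext_eq[OF Psi.linear_axioms] by (simp add: lin_ext_eq_extend)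

lemma Psi_mon_eqI:
  "(\<And>i. i \<in> indices n \<Longrightarrow> coord n i s = coord n i t) \<Longrightarrow> Psi n (mon s) = Psi n (mon t)"
  by (rule poly_mapping_eqI) (simp add: lookup_Psi_mon)

lemma representation_ev:
  "(\<Sum>t\<in>Poly_Mapping.keys v. Poly_Mapping.lookup v t * representation (basis (card S)) (ev_tree S t) y)
    = representation (basis (card S)) (ev S v) y"
proof -
  have "ev_tree S t \<in> span (basis (card S))" for t
    using ev_tree_closed basis(3) by simp
  then show ?thesis
    unfolding ev_def extend_def
    by (simp add: representation_sum[OF basis(2)] representation_scale[OF basis(2)] span_scale)
qed

lemma lookup_Psi_node_comb:
  assumes x: "x \<in> X 2" and i: "(S, b, y, z) \<in> indices n"
  shows "Poly_Mapping.lookup (Psi n (node_comb x u w)) (S, b, y, z) =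
    representation gens x b * representation (basis (card S)) (ev S u) y *
      representation (basis (n - card S)) (ev ({..<n} - S) w) z +
    representation gens (swap x) b * representation (basis (card S)) (ev S w) y *
      representation (basis (n - card S)) (ev ({..<n} - S) u) z"
proof -
  have c: "n - card S = card ({..<n} - S)" using i by (simp add: indices_def card_compl)
  show ?thesis
    unfolding node_comb_def Psi_lin_ext lookup_lin_ext using x i
    by (simp add: lookup_Psi_mon coord_Node bilinear_sum c representation_ev del: card_Diff_subset)
qed

lemma Psi_node_null:
  assumes x: "x \<in> X 2" and "u \<in> null_combs \<or> w \<in> null_combs"
  shows "Psi n (node_comb x u w) = 0"
proof (rule poly_mapping_eqI)
  fix i :: "nat set \<times> 'a \<times> 'a \<times> 'a"
  obtain S b y z where i: "i = (S, b, y, z)" by (metis prod_cases4)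
  show "Poly_Mapping.lookup (Psi n (node_comb x u w)) i = Poly_Mapping.lookup 0 i"
  proof (cases "i \<in> indices n")
    case True
    then show ?thesis
      using assms(2) unfolding i
      by (subst lookup_Psi_node_comb[OF x]) (auto simp: null_combs_def representation_zero)
  next
    case False
    then show ?thesis
      by (simp add: node_comb_def Psi_lin_ext lookup_lin_ext lookup_Psi_mon)
  qed
qed

text \<open>
  The coordinate map only sees the values of the subtrees of the root.  So it kills every tree that has
  a combination of value 0 below the root.
\<close>

lemma Psi_vertex_null:
  assumes x: "x \<in> X (length us + 1 + length vs)" and v: "v \<in> null_combs"
  shows "Psi n (vertex_comb x us v vs) = 0"
proof (cases "length us + 1 + length vs = 2")
  case False
  have "Psi n (mon (Node x (us @ t # vs))) = 0" for t
    using False by (intro poly_mapping_eqI) (simp add: lookup_Psi_mon coord_other)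
  then show ?thesis unfolding vertex_comb_def Psi_lin_ext by (simp add: lin_ext_def)
next
  case True
  have x2: "x \<in> X 2" using x unfolding True .
  from True consider s where "us = []" "vs = [s]" | s where "us = [s]" "vs = []"
    by (cases us; cases vs) (auto simp: length_Suc_conv)
  then show ?thesis
  proof cases
    case 1
    then have "vertex_comb x us v vs = node_comb x v (mon s)"
      by (simp add: vertex_comb_def node_comb_def)
    then show ?thesis using Psi_node_null[OF x2] v by simp
  next
    case 2
    then have "vertex_comb x us v vs = node_comb x (mon s) v"
      by (simp add: vertex_comb_def node_comb_def)
    then show ?thesis using Psi_node_null[OF x2] v by simp
  qed
qed

lemma swap_swap: "x \<in> X 2 \<Longrightarrow> swap (swap x) = x"
  using act_compose[OF transpose_permutes transpose_permutes X_ops, of x] act_id[OF X_ops, of x 2]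
  by simp

lemma swap_closed: "x \<in> X 2 \<Longrightarrow> swap x \<in> X 2"
  by (rule X_act[OF transpose_permutes])

lemma representation_gens:
  assumes "x \<in> X 2" "y \<in> X 2"
  shows "representation gens (x + y) b = representation gens x b + representation gens y b"
    and "representation gens (scl P a x) b = a * representation gens x b"
    and "representation gens (swap (x + y)) b =
      representation gens (swap x) b + representation gens (swap y) b"
    and "representation gens (swap (scl P a x)) b = a * representation gens (swap x) b"
  using assms swap_closed gens(2,3) act_add[OF transpose_permutes X_ops X_ops, of x y]
    act_scale[OF transpose_permutes X_ops, of x a]
  by (simp_all add: representation_add representation_scale)

text \<open>The image under the coordinate map of the trees with a relation from \<open>Q\<close> at the root.\<close>

definition relation_image :: "('a tree \<Rightarrow>\<^sub>0 'k) set \<Rightarrow> nat \<Rightarrow> (nat set \<times> 'a \<times> 'a \<times> 'a \<Rightarrow>\<^sub>0 'k) set" where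
  "relation_image Q n = {Psi n (subst_comb f q) | f q. q \<in> Q}"

text \<open>
  The coordinate map respects the relations of the free operad, and of the relations in \<open>Q\<close> it only sees
  the instances at the root.
\<close>

lemma Psi_ext_relations:
  assumes Q: "\<And>q. q \<in> Q \<Longrightarrow> q \<in> combs 3 \<and> \<pi> 3 (qp q) = 0"
  shows "r \<in> ext_relations P X Q \<Longrightarrow> Psi n r \<in> pm.span (relation_image Q n)"
proof (induction rule: ext_relations.induct)
  case (add x ts y)
  have "Psi n (mon (Node (x + y) ts) - mon (Node x ts) - mon (Node y ts)) = 0"
  proof (rule poly_mapping_eqI)
    fix i :: "nat set \<times> 'a \<times> 'a \<times> 'a"
    obtain S b w z where i: "i = (S, b, w, z)" by (metis prod_cases4)
    show "Poly_Mapping.lookup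
        (Psi n (mon (Node (x + y) ts) - mon (Node x ts) - mon (Node y ts))) i = Poly_Mapping.lookup 0 i"
    proof (cases "length ts = 2")
      case True
      then obtain s t where ts: "ts = [s, t]" by (auto simp: length_Suc_conv numeral_2_eq_2)
      have "x \<in> X 2" "y \<in> X 2" using add True by auto
      then show ?thesis
        by (simp add: Psi.diff lookup_minus lookup_Psi_mon i ts coord_Node X_closed representation_gens
            del: One_nat_def)
          (simp add: algebra_simps)
    qed (simp add: Psi.diff lookup_minus lookup_Psi_mon coord_other)
  qed
  then show ?case by (simp add: pm.span_zero)
next
  case (scale x ts a)
  have "Psi n (mon (Node (scl P a x) ts) - pm_scale a (mon (Node x ts))) = 0"
  proof (rule poly_mapping_eqI)
    fix i :: "nat set \<times> 'a \<times> 'a \<times> 'a"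
    obtain S b w z where i: "i = (S, b, w, z)" by (metis prod_cases4)
    show "Poly_Mapping.lookup
        (Psi n (mon (Node (scl P a x) ts) - pm_scale a (mon (Node x ts)))) i = Poly_Mapping.lookup 0 i"
    proof (cases "length ts = 2")
      case True
      then obtain s t where ts: "ts = [s, t]" by (auto simp: length_Suc_conv numeral_2_eq_2)
      have "x \<in> X 2" using scale True by auto
      then show ?thesis
        by (simp add: Psi.diff Psi.scale lookup_minus lookup_pm_scale lookup_Psi_mon i ts coord_Node
            X_closed representation_gens[of x x] del: One_nat_def)
          (simp add: algebra_simps)
    qed (simp add: Psi.diff Psi.scale lookup_minus lookup_pm_scale lookup_Psi_mon coord_other)
  qed
  then show ?case by (simp add: pm.span_zero)
next
  case (equivariance x ts \<sigma>)
  have "Psi n (mon (Node (act P (length ts) \<sigma> x) ts)) = Psi n (mon (Node x (permute_list \<sigma> ts)))"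
  proof (rule Psi_mon_eqI)
    fix i :: "nat set \<times> 'a \<times> 'a \<times> 'a"
    obtain S b w z where i: "i = (S, b, w, z)" by (metis prod_cases4)
    show "coord n i (Node (act P (length ts) \<sigma> x) ts) = coord n i (Node x (permute_list \<sigma> ts))"
    proof (cases "length ts = 2")
      case True
      then obtain s t where ts: "ts = [s, t]" by (auto simp: length_Suc_conv numeral_2_eq_2)
      have x: "x \<in> X 2" and \<sigma>: "\<sigma> permutes {..<2}" using equivariance True by auto
      from permutes_2_cases[OF \<sigma>] show ?thesis
      proof
        assume "\<sigma> = id"
        then show ?thesis using act_id[OF X_ops[OF x]] True by simp
      next
        assume \<sigma>: "\<sigma> = Transposition.transpose 0 1"
        have act: "act P (length ts) \<sigma> x = swap x" by (simp only: True \<sigma>)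
        show ?thesis
          unfolding act unfolding \<sigma> ts permute_list_transpose i coord_Node
          using x swap_closed[OF x] swap_swap[OF x] by simp
      qed
    qed (simp add: coord_other)
  qed
  then show ?case by (simp add: Psi.diff pm.span_zero)
next
  case (vertex r x us vs)
  then have "Psi n (vertex_comb x us r vs) = 0"
    by (intro Psi_vertex_null ext_relations_null[OF Q]) auto
  then show ?case by (simp add: pm.span_zero)
next
  case (base r f)
  then show ?case by (intro pm.span_base) (auto simp: relation_image_def)
qed

lemma Psi_ideal:
  assumes "\<And>q. q \<in> Q \<Longrightarrow> q \<in> combs 3 \<and> \<pi> 3 (qp q) = 0" "v \<in> ideal Q"
  shows "Psi n v \<in> pm.span (relation_image Q n)"
  by (rule linear_image_span_closed[OF Psi.linear_axioms pm.subspace_span _ assms(2)])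
    (rule Psi_ext_relations[OF assms(1)])

lemma Psi_ideal_empty: "v \<in> ideal {} \<Longrightarrow> Psi n v = 0"
  using Psi_ideal[of "{}" v n] by (simp add: relation_image_def)

lemma ev_labelled_other:
  assumes "v \<in> labelled S" "T \<noteq> S"
  shows "ev T v = 0"
proof -
  have "ev_tree T t = 0" if "t \<in> Poly_Mapping.keys v" for t
    using assms that by (auto simp: labelled_iff ev_tree_def good_def)
  then show ?thesis by (simp add: ev_def extend_def)
qed

text \<open>The lift of an index to trees is a section of the coordinate map.\<close>

lemma Psi_index_tree:
  assumes "i \<in> indices n"
  shows "Psi n (index_tree n i) = mon i"
proof (rule poly_mapping_eqI)
  fix j :: "nat set \<times> 'a \<times> 'a \<times> 'a"
  obtain S b y z where i: "i = (S, b, y, z)" by (metis prod_cases4)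
  obtain T b' y' z' where j: "j = (T, b', y', z')" by (metis prod_cases4)
  let ?S = "{..<n} - S"
  have S: "S \<subseteq> {..<n}" "0 \<in> S" and b: "b \<in> gens" and y: "y \<in> basis (card S)"
    and z: "z \<in> basis (n - card S)"
    using assms by (auto simp: i indices_def)
  have x: "b \<in> X 2" using b gens by auto
  have fin: "finite S" "finite ?S" using S finite_subset by auto
  have yz: "y \<in> ops P (card S)" "z \<in> ops P (card ?S)"
    using y z basis(1) card_compl[OF S(1)] by auto
  note l = lift[OF fin(1) yz(1)] lift[OF fin(2) yz(2)]
  show "Poly_Mapping.lookup (Psi n (index_tree n i)) j = Poly_Mapping.lookup (mon i) j"
  proof (cases "j \<in> indices n")
    case False
    then have "j \<noteq> i" using assms by auto
    then show ?thesis using False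
      by (simp add: i index_tree_def node_comb_def Psi_lin_ext lookup_lin_ext lookup_Psi_mon lookup_mon)
  next
    case True
    then have T: "0 \<in> T" by (simp add: j indices_def)
    then have "T \<noteq> ?S" using S by auto
    then have 0: "ev T (lift ?S z) = 0" by (rule ev_labelled_other[OF l(3)])
    have eq: "Poly_Mapping.lookup (Psi n (index_tree n i)) j =
        representation gens b b' * representation (basis (card T)) (ev T (lift S y)) y' *
        representation (basis (n - card T)) (ev ({..<n} - T) (lift ?S z)) z'"
      using True unfolding i j index_tree_def
      by (simp add: lookup_Psi_node_comb[OF x] 0 representation_zero)
    show ?thesis
    proof (cases "T = S")
      case True
      then show ?thesis
        unfolding eq using l b y z
        by (auto simp: representation_basis[OF gens(2)] representation_basis[OF basis(2)] i j lookup_mon)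
    next
      case False
      then show ?thesis
        unfolding eq using ev_labelled_other[OF l(1) False]
        by (simp add: representation_zero i j lookup_mon)
    qed
  qed
qed

text \<open>
  A linear combination of indices that maps to 0 in \<open>P(n)\<close> lifts to an element of the ideal of
  relations, and the coordinate map takes the lift back to the combination.  So the kernel is
  contained in the image of the relations, which bounds its dimension.
\<close>

lemma card_indices_le:
  assumes n: "2 \<le> n"
    and R: "\<And>n. n \<noteq> 3 \<Longrightarrow> R n = {0}" "R 3 \<subseteq> ops F 3" and gen: "generates_kernel F \<pi> R"
    and E: "finite E" "relation_image (lifts (R 3)) n \<subseteq> pm.span E"
  shows "card (indices n) \<le> dim (ops P n) + card E"
proof -
  let ?L = "lin_ext (index_tree n)"
  define h where "h v = ev {..<n} (?L v)" for v
  have lin: "Vector_Spaces.linear pm_scale (scl P) h"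
    unfolding h_def[abs_def] Vector_Spaces.linear_iff
    by (simp add: lin_ext.add lin_ext.scale ev.add ev.scale pm.vector_space_axioms vector_space_axioms)
  interpret h: Vector_Spaces.linear pm_scale "scl P" h by (rule lin)
  have combs: "?L v \<in> combs n" if "v \<in> pm.span (mon ` indices n)" for v
    using that index_tree_props(1)
    by (intro lin_ext_closed subspace_combs) (auto simp: span_mon_iff indices_def)
  have Psi_L: "Psi n (?L v) = v" if "v \<in> pm.span (mon ` indices n)" for v
  proof -
    have "Psi n (?L v) = lin_ext mon v"
      unfolding Psi_lin_ext using that
      by (intro lin_ext_cong Psi_index_tree) (auto simp: span_mon_iff)
    then show ?thesis by simp
  qed
  have kernel: "v \<in> pm.span E" if v: "v \<in> pm.span (mon ` indices n)" and "h v = 0" for v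
  proof -
    have "\<pi> n (qp (?L v)) = 0"
      using that(2) ev_lessThan[OF combs[OF v]] by (simp add: h_def)
    then have "?L v \<in> ideal (lifts (R 3))"
      using kernel_subset_ideal[OF R gen combs[OF v]] by blast
    then have "v \<in> pm.span (relation_image (lifts (R 3)) n)"
      using Psi_ideal[of "lifts (R 3)" "?L v" n] lifts_null[OF gen] Psi_L[OF v] by simp
    then show ?thesis using E(2) pm.span_minimal[OF E(2) pm.subspace_span] by blast
  qed
  have "\<exists>w. w \<in> pm.span (mon ` indices n) \<and> h w = y" if "y \<in> basis n" for y
  proof -
    have "y \<in> span (h ` mon ` indices n)"
      using that ops_in_span[OF n] basis(1)[of n] by (auto simp: h_def image_image)
    then show ?thesis unfolding h.span_image by auto
  qed
  then obtain w where w: "\<And>y. y \<in> basis n \<Longrightarrow> w y \<in> pm.span (mon ` indices n)"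
    "\<And>y. y \<in> basis n \<Longrightarrow> h (w y) = y" by metis
  let ?G = "w ` basis n \<union> E"
  have "mon i \<in> pm.span ?G" if i: "i \<in> indices n" for i
  proof -
    let ?y = "h (mon i)"
    have y: "?y \<in> span (basis n)"
      using ev_closed[of "{..<n}" "index_tree n i"] by (simp add: h_def basis(3))
    define v where "v = (\<Sum>y\<in>basis n. pm_scale (representation (basis n) ?y y) (w y))"
    have hv: "h v = ?y"
      using sum_representation_eq[OF basis(2) y basis(4) order_refl] w(2)
      by (simp add: v_def h.sum h.scale)
    have "v \<in> pm.span (mon ` indices n)"
      unfolding v_def using w(1) by (intro pm.span_sum pm.span_scale)
    then have "mon i - v \<in> pm.span E"
      using i hv by (intro kernel pm.span_diff[OF pm.span_base]) (auto simp: h.diff)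
    then have "mon i - v \<in> pm.span ?G" using pm.span_mono[of E ?G] by auto
    moreover have "v \<in> pm.span ?G"
      unfolding v_def by (intro pm.span_sum pm.span_scale pm.span_base) auto
    ultimately show ?thesis using pm.span_add[of "mon i - v" ?G v] by simp
  qed
  then have "mon ` indices n \<subseteq> pm.span ?G" by (rule image_subsetI)
  then have "card (mon ` indices n :: (_ \<Rightarrow>\<^sub>0 'k) set) \<le> card ?G"
    using pm.independent_span_bound[OF _ independent_mon, of ?G "indices n"] E(1) basis(4) by simp
  also have "\<dots> \<le> card (w ` basis n) + card E" by (rule card_Un_le)
  also have "card (w ` basis n) \<le> dim (ops P n)"
    unfolding basis(5)[symmetric] by (rule card_image_le[OF basis(4)])
  finally show ?thesis by (simp add: card_mon_image)
qed

end

lemma ex_sorting_permutation_3: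
  fixes m :: "nat \<Rightarrow> nat"
  assumes "m 0 \<noteq> m 1" "m 0 \<noteq> m 2" "m 1 \<noteq> m 2"
  obtains \<sigma> where "\<sigma> permutes {..<3::nat}" "m (\<sigma> 0) < m (\<sigma> 1)" "m (\<sigma> 1) < m (\<sigma> 2)"
proof -
  let ?t = "Transposition.transpose :: nat \<Rightarrow> nat \<Rightarrow> nat \<Rightarrow> nat"
  have t: "?t a b permutes {..<3}" if "a < 3" "b < 3" for a b
    using that by (intro permutes_swap_id) auto
  have perm: "id permutes {..<3::nat}" "?t 0 1 permutes {..<3}" "?t 0 2 permutes {..<3}"
    "?t 1 2 permutes {..<3}" "?t 0 1 \<circ> ?t 1 2 permutes {..<3}" "?t 1 2 \<circ> ?t 0 1 permutes {..<3}"
    by (intro permutes_id permutes_compose t; simp)+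
  consider "m 0 < m 1" "m 1 < m 2" | "m 1 < m 0" "m 0 < m 2" | "m 2 < m 1" "m 1 < m 0"
    | "m 0 < m 2" "m 2 < m 1" | "m 1 < m 2" "m 2 < m 0" | "m 2 < m 0" "m 0 < m 1"
    using assms by linarith
  then show ?thesis
  proof cases
    case 1
    then show ?thesis by (intro that[OF perm(1)]) (simp_all add: transpose_def)
  next
    case 2
    then show ?thesis by (intro that[OF perm(2)]) (simp_all add: transpose_def)
  next
    case 3
    then show ?thesis by (intro that[OF perm(3)]) (simp_all add: transpose_def)
  next
    case 4
    then show ?thesis by (intro that[OF perm(4)]) (simp_all add: transpose_def)
  next
    case 5
    then show ?thesis by (intro that[OF perm(5)]) (simp_all add: transpose_def)
  next
    case 6
    then show ?thesis by (intro that[OF perm(6)]) (simp_all add: transpose_def)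
  qed
qed

lemma lin_ext_const_zero [simp]: "lin_ext (\<lambda>_. 0) v = 0"
  by (simp add: lin_ext_def)

text \<open>Partitions of the set of inputs into three blocks, ordered by their least elements.\<close>

definition partitions_3 :: "nat \<Rightarrow> (nat set \<times> nat set \<times> nat set) set" where
  "partitions_3 n = {(K, L, M). K \<union> L \<union> M = {..<n} \<and> K \<inter> L = {} \<and> K \<inter> M = {} \<and> L \<inter> M = {} \<and>
     K \<noteq> {} \<and> L \<noteq> {} \<and> M \<noteq> {} \<and> Min K < Min L \<and> Min L < Min M}"

lemma finite_partitions_3: "finite (partitions_3 n)"
  by (rule finite_subset[of _ "Pow {..<n} \<times> Pow {..<n} \<times> Pow {..<n}"])
    (auto simp: partitions_3_def)

context finite_binary_presentation begin

section \<open>The image of the relations\<close>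

lemma Psi_not_good:
  assumes "\<not> good {..<n} t"
  shows "Psi n (mon t) = 0"
proof (rule poly_mapping_eqI)
  fix i :: "nat set \<times> 'a \<times> 'a \<times> 'a"
  obtain S b y z where i: "i = (S, b, y, z)" by (metis prod_cases4)
  have "coord n i t = 0" if "i \<in> indices n"
  proof (cases t)
    case (Node x ts)
    show ?thesis
    proof (cases "length ts = 2")
      case True
      then obtain s u where ts: "ts = [s, u]" by (auto simp: length_Suc_conv numeral_2_eq_2)
      have "S \<subseteq> {..<n}" using that by (simp add: i indices_def)
      then have un: "{..<n} = S \<union> ({..<n} - S)" "{..<n} = ({..<n} - S) \<union> S" by auto
      have *: "x \<in> X 2 \<Longrightarrow> \<not> (good S s \<and> good ({..<n} - S) u)"
        "x \<in> X 2 \<Longrightarrow> \<not> (good S u \<and> good ({..<n} - S) s)"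
        using assms un unfolding Node ts good_Node2 by blast+
      show ?thesis
      proof (cases "x \<in> X 2")
        case True
        then have "ev_tree S s = 0 \<or> ev_tree ({..<n} - S) u = 0"
          "ev_tree S u = 0 \<or> ev_tree ({..<n} - S) s = 0"
          using * by (auto simp: ev_tree_def)
        then show ?thesis by (auto simp: Node ts i coord_Node representation_zero)
      qed (simp add: Node ts i coord_Node)
    qed (simp add: Node coord_other)
  qed simp
  then show "Poly_Mapping.lookup (Psi n (mon t)) i = Poly_Mapping.lookup 0 i"
    by (simp add: lookup_Psi_mon)
qed

text \<open>
  The tree \<open>s\<close> has three leaves, so the leaf \<open>i\<close> lies strictly below its root.
\<close>

lemma Psi_one_hole_null:
  assumes s: "s \<in> tree_monomials X 3" and i: "i < 3" and u: "u \<in> null_combs"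
  shows "Psi n (lin_ext (\<lambda>t. mon (tree_subst (h(i := t)) s)) u) = 0"
proof (cases s)
  case (Leaf a)
  then have "{a} = {..<3}" using s by (simp add: tree_monomials_def)
  then have "card {..<3::nat} = 1" by (metis card_1_singleton_iff One_nat_def)
  then show ?thesis by simp
next
  case (Node x ss)
  have good: "decorated X s" "distinct (leaves s)" "i \<in> set (leaves s)"
    using s i by (auto simp: tree_monomials_def)
  obtain us s' vs where ss: "ss = us @ s' # vs" "i \<in> set (leaves s')" and
    eq: "\<And>h v. lin_ext (\<lambda>t. mon (tree_subst (h(i := t)) (Node x ss))) v =
      vertex_comb x (map (tree_subst h) us)
        (lin_ext (\<lambda>t. mon (tree_subst (h(i := t)) s')) v :: _ \<Rightarrow>\<^sub>0 'k) (map (tree_subst h) vs)"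
    by (rule one_hole_Node[OF good(2,3)[unfolded Node]]) (rule that)
  have "decorated X s'" "distinct (leaves s')" and x: "x \<in> X (length us + 1 + length vs)"
    using good(1,2) by (auto simp: Node ss(1))
  then have "lin_ext (\<lambda>t. mon (tree_subst (h(i := t)) s')) u \<in> null_combs"
    by (intro context_closed[where X = X] null_combs_vertex u ss(2))
  then show ?thesis
    unfolding Node eq using x by (intro Psi_vertex_null) auto
qed

lemma Psi_subst_null:
  assumes r: "r \<in> combs 3" and i: "i < 3" and u: "u \<in> null_combs"
  shows "lin_ext (\<lambda>a. Psi n (subst_comb (h(i := a)) r)) u = 0"
proof -
  have "lin_ext (\<lambda>a. Psi n (subst_comb (h(i := a)) r)) u =
      lin_ext (\<lambda>s. Psi n (lin_ext (\<lambda>a. mon (tree_subst (h(i := a)) s)) u)) r"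
    unfolding subst_comb_def Psi_lin_ext[symmetric] by (subst lin_ext_swap) (rule refl)
  also have "\<dots> = lin_ext (\<lambda>_. 0) r"
    using r i u by (intro lin_ext_cong Psi_one_hole_null) (auto simp: combs_iff)
  finally show ?thesis by simp
qed

text \<open>
  If the linear extension of \<open>f\<close> kills the combinations of value 0, then \<open>f a\<close> is a linear
  combination of its values at the chosen representatives of a basis.
\<close>

lemma subspan_lift:
  fixes f :: "'a tree \<Rightarrow> (_ \<Rightarrow>\<^sub>0 'k)"
  assumes null: "\<And>v. v \<in> null_combs \<Longrightarrow> lin_ext f v = 0" and a: "good K a"
  shows "f a \<in> pm.span ((\<lambda>e. lin_ext f (lift K e)) ` basis (card K))"
proof -
  let ?B = "basis (card K)" and ?c = "representation (basis (card K)) (ev_tree K a)"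
  define u where "u = (\<Sum>e\<in>?B. pm_scale (?c e) (lift K e))"
  have K: "finite K" by (rule good_finite[OF a])
  have l: "lift K e \<in> labelled K" "ev K (lift K e) = e" if "e \<in> ?B" for e
    using lift[OF K, of e] that basis(1) by auto
  have lab: "mon a - u \<in> labelled K"
    unfolding u_def using a l
    by (intro pm.subspace_diff pm.subspace_sum pm.subspace_scale subspace_labelled)
      (auto simp: labelled_iff)
  have "ev K u = (\<Sum>e\<in>?B. scl P (?c e) e)"
    by (simp add: u_def ev.sum ev.scale l)
  also have "\<dots> = ev_tree K a"
    using sum_representation_eq[OF basis(2) _ basis(4) order_refl] ev_tree_closed[of K a] basis(3)
    by simp
  finally have "ev K (mon a - u) = 0" by (simp add: ev.diff)
  then have "ev S (mon a - u) = 0" for S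
    using ev_labelled_other[OF lab, of S] by (cases "S = K") simp_all
  then have "mon a - u \<in> null_combs" by (simp add: null_combs_def)
  then have "f a = lin_ext f u" using null[of "mon a - u"] by (simp add: lin_ext.diff)
  also have "\<dots> = (\<Sum>e\<in>?B. pm_scale (?c e) (lin_ext f (lift K e)))"
    by (simp add: u_def lin_ext.sum lin_ext.scale)
  also have "\<dots> \<in> pm.span ((\<lambda>e. lin_ext f (lift K e)) ` ?B)"
    by (intro pm.span_sum pm.span_scale pm.span_base) auto
  finally show ?thesis .
qed

lemma subst_comb_cong:
  assumes "q \<in> combs 3" "\<And>i. i < 3 \<Longrightarrow> f i = g i"
  shows "subst_comb f q = subst_comb g q"
  unfolding subst_comb_def using assms
  by (intro lin_ext_cong arg_cong[where f = mon] tree_subst_cong)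
    (auto simp: combs_iff tree_monomials_def)

text \<open>The substitution of three trees for the leaves 0, 1, 2.\<close>

definition three :: "'b \<Rightarrow> 'b \<Rightarrow> 'b \<Rightarrow> nat \<Rightarrow> 'b" where
  "three a b c i = (if i = 0 then a else if i = 1 then b else c)"

lemma three_simps [simp]: "three a b c 0 = a" "three a b c (Suc 0) = b" "three a b c 2 = c"
  by (simp_all add: three_def)

text \<open>
  The image of a relation \<open>q\<close> of arity 3, applied to elements of \<open>P(|K|)\<close>, \<open>P(|L|)\<close> and \<open>P(|M|)\<close>.
\<close>

definition relation_value ::
  "nat \<Rightarrow> ('a tree \<Rightarrow>\<^sub>0 'k) \<Rightarrow> nat set \<times> nat set \<times> nat set \<Rightarrow> 'a \<times> 'a \<times> 'a \<Rightarrow>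
    (nat set \<times> 'a \<times> 'a \<times> 'a \<Rightarrow>\<^sub>0 'k)" where
  "relation_value n q = (\<lambda>(K, L, M) (x, y, z). lin_ext (\<lambda>c. lin_ext (\<lambda>b. lin_ext (\<lambda>a.
     Psi n (subst_comb (three a b c) q)) (lift K x)) (lift L y)) (lift M z))"

lemma Psi_subst_in_span:
  assumes q: "q \<in> combs 3" and a: "good K a" and b: "good L b" and c: "good M c"
  shows "Psi n (subst_comb (three a b c) q) \<in> pm.span (relation_value n q (K, L, M) `
    (basis (card K) \<times> basis (card L) \<times> basis (card M)))" (is "_ \<in> pm.span ?V")
proof -
  let ?h = "\<lambda>a b c. Psi n (subst_comb (three a b c) q)"
  let ?f = "\<lambda>x b c. lin_ext (\<lambda>a. ?h a b c) (lift K x)"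
  let ?g = "\<lambda>x y c. lin_ext (\<lambda>b. ?f x b c) (lift L y)"
  have null_a: "lin_ext (\<lambda>a. ?h a b c) v = 0" if "v \<in> null_combs" for v b c
  proof -
    have "(three b b c)(0 := a) = three a b c" for a by (auto simp: three_def fun_eq_iff)
    then show ?thesis using Psi_subst_null[OF q _ that, of 0 n "three b b c"] by simp
  qed
  have null_b: "lin_ext (\<lambda>b. ?h a b c) v = 0" if "v \<in> null_combs" for v a c
  proof -
    have "(three a a c)(1 := b) = three a b c" for b by (auto simp: three_def fun_eq_iff)
    then show ?thesis using Psi_subst_null[OF q _ that, of 1 n "three a a c"] by simp
  qed
  have null_c: "lin_ext (\<lambda>c. ?h a b c) v = 0" if "v \<in> null_combs" for v a b
  proof -
    have "subst_comb ((three a b b)(2 := c)) q = subst_comb (three a b c) q" for c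
      by (rule subst_comb_cong[OF q]) (auto simp: three_def)
    then show ?thesis using Psi_subst_null[OF q _ that, of 2 n "three a b b"] by simp
  qed
  have null_f: "lin_ext (\<lambda>b. ?f x b c) v = 0" if "v \<in> null_combs" for v x c
    by (subst lin_ext_swap) (simp add: null_b[OF that])
  have "lin_ext (\<lambda>c. ?f x b c) v = 0" if "v \<in> null_combs" for v x b
    by (subst lin_ext_swap) (simp add: null_c[OF that])
  then have null_g: "lin_ext (\<lambda>c. ?g x y c) v = 0" if "v \<in> null_combs" for v x y
    using that by (subst lin_ext_swap) simp
  have 3: "?g x y c \<in> pm.span ?V" if xy: "x \<in> basis (card K)" "y \<in> basis (card L)" for x y
  proof -
    have "(\<lambda>z. lin_ext (?g x y) (lift M z)) ` basis (card M) \<subseteq> ?V"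
    proof (rule image_subsetI)
      fix z assume "z \<in> basis (card M)"
      then show "lin_ext (?g x y) (lift M z) \<in> ?V"
        using xy by (intro image_eqI[of _ _ "(x, y, z)"]) (simp_all add: relation_value_def)
    qed
    then show ?thesis
      using subspan_lift[of "?g x y", OF null_g c] pm.span_mono by blast
  qed
  have 2: "?f x b c \<in> pm.span ?V" if x: "x \<in> basis (card K)" for x
  proof -
    have "(\<lambda>y. ?g x y c) ` basis (card L) \<subseteq> pm.span ?V" using 3 x by auto
    then show ?thesis
      using subspan_lift[of "\<lambda>b. ?f x b c", OF null_f b] pm.span_minimal[OF _ pm.subspace_span]
      by blast
  qed
  have "(\<lambda>x. ?f x b c) ` basis (card K) \<subseteq> pm.span ?V" using 2 by auto
  then show ?thesis
    using subspan_lift[of "\<lambda>a. ?h a b c", OF null_a a] pm.span_minimal[OF _ pm.subspace_span]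
    by blast
qed

text \<open>
  The images of a relation \<open>q\<close>, applied to basis elements of \<open>P\<close> for each ordered partition.  They span
  the contribution of \<open>q\<close> to the image of \<open>(R \<circ> P)(n)\<close>.
\<close>

definition relation_values ::
  "nat \<Rightarrow> ('a tree \<Rightarrow>\<^sub>0 'k) \<Rightarrow> (nat set \<times> 'a \<times> 'a \<times> 'a \<Rightarrow>\<^sub>0 'k) set" where
  "relation_values n q = (\<Union>(K, L, M)\<in>partitions_3 n. relation_value n q (K, L, M) `
    (basis (card K) \<times> basis (card L) \<times> basis (card M)))"

lemma finite_relation_values: "finite (relation_values n q)"
  unfolding relation_values_def using finite_partitions_3 basis(4) by auto

lemma card_relation_values: "card (relation_values n q) \<le> (\<Sum>(K, L, M)\<in>partitions_3 n.
    dim (ops P (card K)) * (dim (ops P (card L)) * dim (ops P (card M))))"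
proof -
  have "card (relation_values n q) \<le> (\<Sum>p\<in>partitions_3 n. card (case p of (K, L, M) \<Rightarrow>
      relation_value n q (K, L, M) ` (basis (card K) \<times> basis (card L) \<times> basis (card M))))"
    unfolding relation_values_def by (rule card_UN_le[OF finite_partitions_3])
  also have "\<dots> \<le> (\<Sum>p\<in>partitions_3 n. case p of (K, L, M) \<Rightarrow>
      dim (ops P (card K)) * (dim (ops P (card L)) * dim (ops P (card M))))"
  proof (rule sum_mono)
    fix p :: "nat set \<times> nat set \<times> nat set"
    obtain K L M where p: "p = (K, L, M)" by (metis prod_cases3)
    have "card (relation_value n q (K, L, M) `
        (basis (card K) \<times> basis (card L) \<times> basis (card M)))
        \<le> card (basis (card K) \<times> basis (card L) \<times> basis (card M))"
      by (rule card_image_le) (simp add: basis)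
    then show "card (case p of (K, L, M) \<Rightarrow> relation_value n q (K, L, M) `
        (basis (card K) \<times> basis (card L) \<times> basis (card M)))
      \<le> (case p of (K, L, M) \<Rightarrow>
        dim (ops P (card K)) * (dim (ops P (card L)) * dim (ops P (card M))))"
      by (simp add: p card_cartesian_product basis(5))
  qed
  finally show ?thesis .
qed

lemma lifts_act:
  assumes "S_submodule F R" "q \<in> lifts (R 3)" "\<sigma> permutes {..<3}"
  shows "subst_comb (\<lambda>a. Leaf (\<sigma> a)) q \<in> lifts (R 3)"
proof -
  have "act F 3 \<sigma> (qp q) \<in> R 3" using assms by (auto simp: S_submodule_def lifts_def)
  then show ?thesis
    using assms(2,3) by (auto simp: lifts_def act_F subst_comb_qp combs_act)
qed

text \<open>
  By equivariance the three trees grafted to a relation can be ordered by their least leaves.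
\<close>

lemma Psi_subst_sorted:
  assumes R: "S_submodule F R" and q: "q \<in> lifts (R 3)" and nz: "Psi n (subst_comb f q) \<noteq> 0"
  obtains q' a b c K L M where "q' \<in> lifts (R 3)" "(K, L, M) \<in> partitions_3 n"
    "good K a" "good L b" "good M c" "subst_comb f q = subst_comb (three a b c) q'"
proof -
  have q3: "q \<in> combs 3" using q by (simp add: lifts_def)
  have "\<exists>s\<in>Poly_Mapping.keys q. good {..<n} (tree_subst f s)"
  proof (rule ccontr)
    assume "\<not> ?thesis"
    then have "Psi n (mon (tree_subst f s)) = 0" if "s \<in> Poly_Mapping.keys q" for s
      using that Psi_not_good by blast
    then have "Psi n (subst_comb f q) = 0"
      unfolding subst_comb_def Psi_lin_ext by (simp add: lin_ext_def)
    then show False using nz by simp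
  qed
  then obtain s where s: "s \<in> Poly_Mapping.keys q" "good {..<n} (tree_subst f s)" by blast
  have s3: "good {..<3} s" using s q3 by (auto simp: combs_iff tree_monomials_iff)
  define S where "S i = set (leaves (f i))" for i
  have S: "good (S i) (f i)" if "i < 3" for i
    unfolding S_def using good_tree_substD(1)[OF s(2) s3] that by simp
  have disj: "S i \<inter> S j = {}" if "i < 3" "j < 3" "i \<noteq> j" for i j
    unfolding S_def using good_tree_substD(2)[OF s(2) s3] that by simp
  have un: "(\<Union>i<3. S i) = {..<n}"
    unfolding S_def using good_tree_substD(3)[OF s(2) s3] by simp
  have split: "subst_comb g r = subst_comb (three (g 0) (g 1) (g 2)) r" if "r \<in> combs 3" for g r
  proof (rule subst_comb_cong[OF that])
    fix i :: nat assume "i < 3"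
    then consider "i = 0" | "i = 1" | "i = 2" by linarith
    then show "g i = three (g 0) (g 1) (g 2) i" by cases simp_all
  qed
  have ne: "S i \<noteq> {}" if "i < 3" for i
  proof
    assume "S i = {}"
    then have "basis (card (S i)) = {}" by (simp add: basis_0)
    moreover have "Psi n (subst_comb f q) \<in> pm.span (relation_value n q (S 0, S 1, S 2) `
        (basis (card (S 0)) \<times> basis (card (S 1)) \<times> basis (card (S 2))))"
      unfolding split[OF q3, of f] by (intro Psi_subst_in_span q3 S) simp_all
    moreover have "i = 0 \<or> i = 1 \<or> i = 2" using that by linarith
    ultimately show False using nz by auto
  qed
  have fin: "finite (S i)" if "i < 3" for i by (rule good_finite[OF S[OF that]])
  have "Min (S i) \<noteq> Min (S j)" if "i < 3" "j < 3" "i \<noteq> j" for i j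
    using Min_in[OF fin ne, of i] Min_in[OF fin ne, of j] disj[OF that] that by auto
  then obtain \<sigma> where \<sigma>: "\<sigma> permutes {..<3::nat}"
    "Min (S (\<sigma> 0)) < Min (S (\<sigma> 1))" "Min (S (\<sigma> 1)) < Min (S (\<sigma> 2))"
    using ex_sorting_permutation_3[of "\<lambda>i. Min (S i)"] by force
  have lt: "\<sigma> i < 3" if "i < 3" for i using permutes_in_image[OF \<sigma>(1), of i] that by simp
  have inj: "\<sigma> i \<noteq> \<sigma> j" if "i \<noteq> j" for i j using permutes_inj[OF \<sigma>(1)] that by (auto dest: injD)
  define q' where "q' = subst_comb (\<lambda>a. Leaf (inv \<sigma> a)) q"
  have q': "q' \<in> lifts (R 3)"
    unfolding q'_def by (rule lifts_act[OF R q permutes_inv[OF \<sigma>(1)]])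
  have "subst_comb (f \<circ> \<sigma>) q' = subst_comb f q"
    using permutes_inverses(1)[OF \<sigma>(1)] by (simp add: q'_def subst_comb_subst_comb)
  then have "subst_comb f q = subst_comb (three (f (\<sigma> 0)) (f (\<sigma> 1)) (f (\<sigma> 2))) q'"
    using split[of q' "f \<circ> \<sigma>"] q' by (simp add: lifts_def)
  moreover have "(S (\<sigma> 0), S (\<sigma> 1), S (\<sigma> 2)) \<in> partitions_3 n"
  proof -
    have "(\<Union>i\<in>\<sigma> ` {..<3}. S i) = {..<n}" unfolding permutes_image[OF \<sigma>(1)] by (rule un)
    then have "S (\<sigma> 0) \<union> S (\<sigma> 1) \<union> S (\<sigma> 2) = {..<n}"
      by (simp add: numeral_3_eq_3 lessThan_Suc numeral_2_eq_2 Un_ac)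
    then show ?thesis
      unfolding partitions_3_def using \<sigma>(2,3) by (auto intro!: disj[THEN equalityD1, THEN subsetD]
          simp: disj lt inj ne)
  qed
  ultimately show ?thesis
    using that[OF q' _ S S S] lt by simp
qed

text \<open>
  The image of the relations has at most the dimension of \<open>(R \<circ> P)(n)\<close>: by equivariance and linearity a
  basis of \<open>R(3)\<close> and ordered partitions suffice.
\<close>

lemma relation_image_span:
  assumes R: "S_submodule F R"
  obtains E where "finite E" "relation_image (lifts (R 3)) n \<subseteq> pm.span E"
    "card E \<le> pm.dim (R 3) * (\<Sum>(K, L, M)\<in>partitions_3 n.
      dim (ops P (card K)) * (dim (ops P (card L)) * dim (ops P (card M))))"
proof -
  let ?B = "basis_of pm_scale (R 3)"
  have sub: "pm.subspace (R 3)" "R 3 \<subseteq> ops F 3"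
    using R by (auto simp: S_submodule_def)
  have B: "?B \<subseteq> R 3" "pm.independent ?B" "R 3 \<subseteq> pm.span ?B" "card ?B = pm.dim (R 3)"
    by (rule pm.basis_of)+
  have finB: "finite ?B" by (rule finite_dim_F_subspace[OF sub(2)])
  have "\<exists>v\<in>combs 3. qp v = r" if "r \<in> ?B" for r using B(1) sub(2) that by (auto simp: ops_F)
  then obtain l where l: "\<And>r. r \<in> ?B \<Longrightarrow> l r \<in> combs 3" "\<And>r. r \<in> ?B \<Longrightarrow> qp (l r) = r" by metis
  define E where "E = (\<Union>r\<in>?B. relation_values n (l r))"
  have values_E: "pm.span (relation_values n (l r)) \<subseteq> pm.span E" if "r \<in> ?B" for r
    using that by (intro pm.span_mono) (auto simp: E_def)
  have "Psi n (subst_comb f q) \<in> pm.span E" if q: "q \<in> lifts (R 3)" for f q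
  proof (cases "Psi n (subst_comb f q) = 0")
    case False
    then obtain q' a b c K L M where q': "q' \<in> lifts (R 3)" and K: "(K, L, M) \<in> partitions_3 n"
      and abc: "good K a" "good L b" "good M c"
      and eq: "subst_comb f q = subst_comb (three a b c) q'"
      using Psi_subst_sorted[OF R q] by metis
    let ?c = "pm.representation ?B (qp q')"
    have "qp q' \<in> pm.span ?B" using q' B(3) by (auto simp: lifts_def)
    then have "qp q' = qp (\<Sum>r\<in>?B. pm_scale (?c r) (l r))"
      using pm.sum_representation_eq[OF B(2) _ finB order_refl] by (simp add: qp.sum qp.scale l)
    then have "subst_comb (three a b c) (q' - (\<Sum>r\<in>?B. pm_scale (?c r) (l r))) \<in> ideal {}"
      unfolding qp_eq_iff by (rule subst_comb_span_ext_relations)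
    then have "Psi n (subst_comb f q) =
        (\<Sum>r\<in>?B. pm_scale (?c r) (Psi n (subst_comb (three a b c) (l r))))"
      using Psi_ideal_empty[of _ n]
      by (fastforce simp: eq subst_comb.diff subst_comb.sum subst_comb.scale Psi.diff Psi.sum Psi.scale)
    also have "\<dots> \<in> pm.span E"
    proof (intro pm.span_sum pm.span_scale)
      fix r assume r: "r \<in> ?B"
      have "relation_value n (l r) (K, L, M) `
          (basis (card K) \<times> basis (card L) \<times> basis (card M)) \<subseteq> relation_values n (l r)"
        using K by (auto simp: relation_values_def)
      then show "Psi n (subst_comb (three a b c) (l r)) \<in> pm.span E"
        using Psi_subst_in_span[OF l(1)[OF r] abc] values_E[OF r] pm.span_mono by blast
    qed
    finally show ?thesis .
  qed (simp add: pm.span_zero)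
  then have "relation_image (lifts (R 3)) n \<subseteq> pm.span E" by (auto simp: relation_image_def)
  moreover have "finite E" unfolding E_def using finB finite_relation_values by auto
  moreover have "card E \<le> pm.dim (R 3) * (\<Sum>(K, L, M)\<in>partitions_3 n.
      dim (ops P (card K)) * (dim (ops P (card L)) * dim (ops P (card M))))"
  proof -
    have "card E \<le> (\<Sum>r\<in>?B. card (relation_values n (l r)))"
      unfolding E_def by (rule card_UN_le[OF finB])
    also have "\<dots> \<le> (\<Sum>r\<in>?B. \<Sum>(K, L, M)\<in>partitions_3 n.
        dim (ops P (card K)) * (dim (ops P (card L)) * dim (ops P (card M))))"
      by (intro sum_mono card_relation_values)
    finally show ?thesis using B(4) by simp
  qed
  ultimately show ?thesis by (intro that)
qed

end

section \<open>Counting\<close>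

text \<open>The exponential generating series of a sequence.\<close>

definition egf :: "(nat \<Rightarrow> real) \<Rightarrow> real fps" where
  "egf p = Abs_fps (\<lambda>n. p n / fact n)"

lemma egf_nth [simp]: "egf p $ n = p n / fact n"
  by (simp add: egf_def)

lemma egf_fact_nth: "egf (\<lambda>n. fact n * F $ n) = F"
  by (rule fps_ext) simp

text \<open>The product of exponential generating series counts pairs of complementary subsets.\<close>

lemma sum_subsets_egf:
  assumes "finite A"
  shows "(\<Sum>S\<in>Pow A. p (card S) * q (card A - card S)) = fact (card A) * (egf p * egf q) $ card A"
proof -
  let ?m = "card A"
  have card_le: "card S \<le> ?m" if "S \<in> Pow A" for S
    using that assms by (auto intro: card_mono)
  have "(\<Sum>S\<in>Pow A. p (card S) * q (?m - card S)) =
      (\<Sum>k\<in>{..?m}. \<Sum>S\<in>{S \<in> Pow A. card S = k}. p (card S) * q (?m - card S))"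
    by (rule sum.group[symmetric]) (use assms card_le in auto)
  also have "\<dots> = (\<Sum>k\<in>{..?m}. real (?m choose k) * (p k * q (?m - k)))"
    using n_subsets[OF assms] by (intro sum.cong) simp_all
  also have "\<dots> = (\<Sum>k\<in>{..?m}. fact ?m * (p k / fact k * (q (?m - k) / fact (?m - k))))"
    by (intro sum.cong refl) (simp add: binomial_fact)
  also have "\<dots> = fact ?m * (egf p * egf q) $ ?m"
    by (simp add: fps_mult_nth sum_distrib_left atLeast0AtMost)
  finally show ?thesis .
qed

lemma sum_subsets_containing_0:
  fixes p :: "nat \<Rightarrow> real"
  assumes "1 \<le> n"
  shows "2 * (\<Sum>S | S \<subseteq> {..<n} \<and> 0 \<in> S. p (card S) * p (n - card S)) = fact n * (egf p ^ 2) $ n"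
proof -
  let ?f = "\<lambda>S. p (card S) * p (n - card S)"
  have card: "card ({..<n} - S) = n - card S" "card S \<le> n" if "S \<subseteq> {..<n}" for S
    using that card_mono[of "{..<n}" S] by (simp_all add: card_Diff_subset finite_subset)
  have "(\<Sum>S\<in>{S. S \<subseteq> {..<n} \<and> 0 \<in> S}. ?f S) = (\<Sum>S\<in>{S. S \<subseteq> {..<n} \<and> 0 \<notin> S}. ?f S)"
    by (rule sum.reindex_bij_witness[where i = "\<lambda>S. {..<n} - S" and j = "\<lambda>S. {..<n} - S"])
      (use assms card in \<open>auto simp: mult.commute\<close>)
  moreover have "(\<Sum>S\<in>Pow {..<n}. ?f S) =
      (\<Sum>S\<in>{S. S \<subseteq> {..<n} \<and> 0 \<in> S}. ?f S) + (\<Sum>S\<in>{S. S \<subseteq> {..<n} \<and> 0 \<notin> S}. ?f S)"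
    by (subst sum.union_disjoint[symmetric]) (auto intro!: sum.cong)
  ultimately show ?thesis
    using sum_subsets_egf[of "{..<n}" p p] by (simp add: power2_eq_square)
qed

text \<open>
  The six orders of the blocks of a partition give six distinct triples of blocks, and the product of
  three exponential generating series counts all triples of disjoint sets with union \<open>{..<n}\<close>, with empty
  sets allowed.
\<close>

lemma sum_partitions_3_le:
  fixes p :: "nat \<Rightarrow> real"
  assumes nonneg: "\<And>n. 0 \<le> p n"
  shows "6 * (\<Sum>(K, L, M)\<in>partitions_3 n. p (card K) * (p (card L) * p (card M)))
    \<le> fact n * (egf p ^ 3) $ n"
proof -
  define U where "U = {(K, L, M). K \<union> L \<union> M = {..<n} \<and> K \<inter> L = {} \<and> K \<inter> M = {} \<and> L \<inter> M = {} \<and>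
     K \<noteq> {} \<and> L \<noteq> {} \<and> M \<noteq> {}}"
  define g where "g = (\<lambda>(K :: nat set, L :: nat set, M :: nat set).
    p (card K) * (p (card L) * p (card M)))"
  let ?T = "partitions_3 n"
  have finU: "finite U"
    by (rule finite_subset[of _ "Pow {..<n} \<times> Pow {..<n} \<times> Pow {..<n}"]) (auto simp: U_def)
  define \<phi> :: "nat \<Rightarrow> nat set \<times> nat set \<times> nat set \<Rightarrow> nat set \<times> nat set \<times> nat set" where
    "\<phi> i = (\<lambda>(K, L, M). [(K, L, M), (L, K, M), (M, L, K), (K, M, L), (L, M, K), (M, K, L)] ! i)" for i
  have lt6: "i \<in> {..<6} \<longleftrightarrow> i = 0 \<or> i = 1 \<or> i = 2 \<or> i = 3 \<or> i = 4 \<or> i = 5" for i :: nat by auto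
  have inj: "inj_on (\<phi> i) ?T" if "i < 6" for i
    using that lt6[of i] by (auto simp: inj_on_def \<phi>_def)
  have img: "\<phi> i ` ?T \<subseteq> U" if "i < 6" for i
    using that lt6[of i] by (auto simp: \<phi>_def partitions_3_def U_def)
  \<comment> \<open>The pairwise comparisons of the least elements recover the order.\<close>
  define \<tau> :: "nat set \<times> nat set \<times> nat set \<Rightarrow> bool \<times> bool \<times> bool" where
    "\<tau> = (\<lambda>(K, L, M). (Min K < Min L, Min K < Min M, Min L < Min M))"
  let ?codes = "[(True, True, True), (False, True, True), (False, False, False),
    (True, True, False), (True, False, False), (False, False, True)]"
  have \<tau>: "\<tau> (\<phi> i x) = ?codes ! i" if "i < 6" "x \<in> ?T" for i x
    using that lt6[of i] by (auto simp: \<tau>_def \<phi>_def partitions_3_def)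
  have disj: "\<phi> i ` ?T \<inter> \<phi> j ` ?T = {}" if "i < 6" "j < 6" "i \<noteq> j" for i j
  proof -
    have ne: "?codes ! i \<noteq> ?codes ! j"
      using that by (subst nth_eq_iff_index_eq) simp_all
    show ?thesis
    proof (rule equals0I)
      fix y assume "y \<in> \<phi> i ` ?T \<inter> \<phi> j ` ?T"
      then obtain x x' where "y = \<phi> i x" "x \<in> ?T" "y = \<phi> j x'" "x' \<in> ?T" by (elim IntE imageE)
      then have "?codes ! i = ?codes ! j"
        using \<tau>[OF that(1), of x] \<tau>[OF that(2), of x'] by (simp only:)
      then show False using ne by contradiction
    qed
  qed
  have g: "g (\<phi> i x) = g x" if "i < 6" for i x
    using that lt6[of i] by (cases x) (auto simp: g_def \<phi>_def)
  have "6 * sum g ?T = (\<Sum>i<6. \<Sum>x\<in>?T. g (\<phi> i x))"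
    using g by simp
  also have "\<dots> = (\<Sum>i<6. sum g (\<phi> i ` ?T))"
    using sum.reindex[OF inj, of _ g] by (intro sum.cong[OF refl]) (simp add: o_def)
  also have "\<dots> = sum g (\<Union>i<6. \<phi> i ` ?T)"
    using finite_partitions_3 disj by (intro sum.UNION_disjoint[symmetric]) auto
  also have "\<dots> \<le> sum g U"
    using finU img nonneg by (intro sum_mono2) (auto simp: g_def)
  also have "\<dots> = (\<Sum>(K, L)\<in>(\<lambda>(K, L, M). (K, L)) ` U.
      p (card K) * (p (card L) * p (n - card K - card L)))"
  proof (subst sum.reindex)
    have M: "M = {..<n} - (K \<union> L)" if "(K, L, M) \<in> U" for K L M
      using that by (auto simp: U_def)
    show "inj_on (\<lambda>(K, L, M). (K, L)) U"
      by (rule inj_onI) (auto dest: M)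
    show "sum g U = sum ((\<lambda>(K, L). p (card K) * (p (card L) * p (n - card K - card L))) \<circ>
        (\<lambda>(K, L, M). (K, L))) U"
    proof (rule sum.cong[OF refl])
      fix x assume x: "x \<in> U"
      obtain K L M where KLM: "x = (K, L, M)" by (metis prod_cases3)
      then have "K \<union> (L \<union> M) = {..<n}" "K \<inter> (L \<union> M) = {}" "L \<inter> M = {}"
        using x by (auto simp: U_def)
      moreover from this have "finite K" "finite L" "finite M"
        by (metis finite_Un finite_lessThan)+
      ultimately have "n = card K + (card L + card M)"
        by (metis card_Un_disjoint card_lessThan finite_Un)
      then show "g x = ((\<lambda>(K, L). p (card K) * (p (card L) * p (n - card K - card L))) \<circ>
        (\<lambda>(K, L, M). (K, L))) x"
        by (simp add: KLM g_def)
    qed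
  qed
  also have "\<dots> \<le> (\<Sum>(K, L)\<in>(SIGMA K:Pow {..<n}. Pow ({..<n} - K)).
      p (card K) * (p (card L) * p (n - card K - card L)))"
    using nonneg by (intro sum_mono2) (auto simp: U_def)
  also have "\<dots> = (\<Sum>K\<in>Pow {..<n}. p (card K) *
      (\<Sum>L\<in>Pow ({..<n} - K). p (card L) * p (n - card K - card L)))"
    by (subst sum.Sigma[symmetric]) (auto simp: sum_distrib_left)
  also have "\<dots> = (\<Sum>K\<in>Pow {..<n}. p (card K) *
      (fact (n - card K) * (egf p * egf p) $ (n - card K)))"
  proof (intro sum.cong refl arg_cong2[where f = "(*)"])
    fix K assume "K \<in> Pow {..<n}"
    then have "card ({..<n} - K) = n - card K" by (simp add: card_Diff_subset finite_subset)
    then show "(\<Sum>L\<in>Pow ({..<n} - K). p (card L) * p (n - card K - card L)) =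
        fact (n - card K) * (egf p * egf p) $ (n - card K)"
      using sum_subsets_egf[of "{..<n} - K" p p] by simp
  qed
  also have "\<dots> = fact n * (egf p * (egf p * egf p)) $ n"
    using sum_subsets_egf[of "{..<n}" p "\<lambda>m. fact m * (egf p * egf p) $ m"]
    by (simp add: egf_fact_nth)
  finally show ?thesis by (simp add: g_def power3_eq_cube mult.assoc)
qed

section \<open>The inequality for the generating series\<close>

context finite_binary_presentation begin

abbreviation p :: "nat \<Rightarrow> real" where
  "p n \<equiv> real (dim (ops P n))"

lemma gen_series_eq_egf: "gen_series P = egf p"
  by (rule fps_ext) (simp add: gen_series_def dim_ops_0)

lemma card_indices_egf:
  assumes "1 \<le> n"
  shows "real (card (indices n)) = real (dim (X 2)) / 2 * (fact n * (egf p ^ 2) $ n)"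
  unfolding card_indices sum_subsets_containing_0[OF assms, symmetric]
  by (simp add: sum_distrib_left)

lemma egf_dim_small:
  shows "egf p $ 0 = 0" "egf p $ 1 = 1"
    and "n \<le> 1 \<Longrightarrow> (egf p ^ 2) $ n = 0" "n \<le> 1 \<Longrightarrow> (egf p ^ 3) $ n = 0"
proof -
  show 0: "egf p $ 0 = 0" by (simp add: dim_ops_0)
  show "egf p $ 1 = 1" using dim_ops_1 by simp
  show "n \<le> 1 \<Longrightarrow> (egf p ^ 2) $ n = 0" "n \<le> 1 \<Longrightarrow> (egf p ^ 3) $ n = 0"
    using startsby_zero_power_prefix[OF 0, of 2] startsby_zero_power_prefix[OF 0, of 3] by auto
qed

lemma gen_series_le:
  "(gen_series P - fps_const (real (dim (X 2)) / 2) * gen_series P ^ 2) $ n \<le> fps_X $ n"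
proof (cases "n \<le> 1")
  case True
  then have "n = 0 \<or> n = 1" by auto
  then show ?thesis
    using egf_dim_small(1,2) egf_dim_small(3)[OF True] by (auto simp: gen_series_eq_egf)
next
  case False
  then have "p n \<le> real (dim (X 2)) / 2 * (fact n * (egf p ^ 2) $ n)"
    using dim_ops_le[of n] card_indices_egf[of n] by simp
  then have "p n / fact n \<le> real (dim (X 2)) / 2 * (egf p ^ 2) $ n"
    by (simp add: field_simps)
  then show ?thesis using False by (simp add: gen_series_eq_egf)
qed

text \<open>
  The analogue for operads of the Golod-Shafarevich inequality: the operations of arity \<open>n\<close> are the
  compositions with a generator at the root, modulo the relations at the root.
\<close>

lemma gen_series_ge:
  assumes R: "S_submodule F R" "\<And>n. n \<noteq> 3 \<Longrightarrow> R n = {0}" and gen: "generates_kernel F \<pi> R"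
  shows "fps_X $ n \<le> (gen_series P - fps_const (real (dim (X 2)) / 2) * gen_series P ^ 2
    + fps_const (real (pm.dim (R 3)) / 6) * gen_series P ^ 3) $ n"
proof (cases "n \<le> 1")
  case True
  then have "n = 0 \<or> n = 1" by auto
  then show ?thesis
    using egf_dim_small(1,2) egf_dim_small(3,4)[OF True] by (auto simp: gen_series_eq_egf)
next
  case False
  have "R 3 \<subseteq> ops F 3" using R(1) by (simp add: S_submodule_def)
  obtain E where E: "finite E" "relation_image (lifts (R 3)) n \<subseteq> pm.span E"
    "card E \<le> pm.dim (R 3) * (\<Sum>(K, L, M)\<in>partitions_3 n.
      dim (ops P (card K)) * (dim (ops P (card L)) * dim (ops P (card M))))"
    using relation_image_span[OF R(1)] .
  let ?c = "real (dim (X 2))" and ?d = "real (pm.dim (R 3))"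
  have "real (card E) \<le> real (pm.dim (R 3) * (\<Sum>(K, L, M)\<in>partitions_3 n.
      dim (ops P (card K)) * (dim (ops P (card L)) * dim (ops P (card M)))))"
    using E(3) by (simp only: of_nat_le_iff)
  also have "\<dots> = ?d * (\<Sum>(K, L, M)\<in>partitions_3 n. p (card K) * (p (card L) * p (card M)))"
    by (simp add: case_prod_beta)
  also have "\<dots> \<le> ?d * (fact n * (egf p ^ 3) $ n / 6)"
    using sum_partitions_3_le[of p n] by (intro mult_left_mono) simp_all
  finally have "real (card E) \<le> ?d / 6 * (fact n * (egf p ^ 3) $ n)" by simp
  moreover have "card (indices n) \<le> dim (ops P n) + card E"
    using False \<open>R 3 \<subseteq> ops F 3\<close> by (intro card_indices_le[where R = R] R gen E) auto
  ultimately have "?c / 2 * (fact n * (egf p ^ 2) $ n) \<le> p n + ?d / 6 * (fact n * (egf p ^ 3) $ n)"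
    using card_indices_egf[of n] False by linarith
  then have "?c / 2 * (egf p ^ 2) $ n \<le> p n / fact n + ?d / 6 * (egf p ^ 3) $ n"
    by (simp add: field_simps)
  then show ?thesis using False by (simp add: gen_series_eq_egf)
qed

end

theorem corollary4p3:
  fixes P :: "('k::field_char_0, 'a::ab_group_add) operad"
    and X :: "nat \<Rightarrow> 'a set"
    and \<pi> :: "nat \<Rightarrow> ('a tree \<Rightarrow>\<^sub>0 'k) \<Rightarrow> 'a"
    and R :: "nat \<Rightarrow> ('a tree \<Rightarrow>\<^sub>0 'k) set"
    and c d :: nat
  assumes "connected_operad P"
    and "minimal_generators P X"
    and "\<forall>n. n \<noteq> 2 \<longrightarrow> X n = {0}"
    and "\<exists>B. finite B \<and> X 2 \<subseteq> module.span (scl P) B"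
    and "natural_surjection P X \<pi>"
    and "minimal_relations P X \<pi> R"
    and "\<forall>n. n \<noteq> 3 \<longrightarrow> R n = {0}"
    and "c = vector_space.dim (scl P) (X 2)"
    and "d = vector_space.dim (scl (free_operad P X)) (R 3)"
    and "real d \<le> 3 * (real c)\<^sup>2 / 8"
  shows "(\<forall>n. fps_nth (gen_series P) n \<ge>
            fps_nth (fps_inv (fps_X - fps_const (real c / 2) * fps_X ^ 2
                                + fps_const (real d / 6) * fps_X ^ 3)) n) \<and>
         (\<forall>n\<ge>1. fact (2 * n) / fact n * root\<^sub>1 (real c) (real d) powi (- int n)
                    \<le> real (vector_space.dim (scl P) (ops P (n + 1))) \<and>
                real (vector_space.dim (scl P) (ops P (n + 1)))
                    \<le> fact (2 * n) / fact n * (real c / 2) ^ n)"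
proof -
  interpret connected_operad P by fact
  interpret finite_binary_presentation P X \<pi>
    using assms(2-5) by unfold_locales (auto simp: minimal_generators_def)
  have R: "S_submodule F R" "\<And>n. n \<noteq> 3 \<Longrightarrow> R n = {0}" and gen: "generates_kernel F \<pi> R"
    using assms(6,7) by (auto simp: minimal_relations_def)
  let ?G = "gen_series P"
  have G: "?G $ n = real (dim (ops P n)) / fact n" for n by (simp add: gen_series_eq_egf)
  have G0: "?G $ 0 = 0" and G_nonneg: "0 \<le> ?G $ n" for n by (simp_all add: G dim_ops_0)
  have c: "real (dim (X 2)) = real c" and d: "real (pm.dim (R 3)) = real d"
    using assms(8,9) by simp_all
  define u v where "u = (real c / 2 + sqrt ((real c)\<^sup>2 / 4 - 2 * real d / 3)) / 2"
    and "v = (real c / 2 - sqrt ((real c)\<^sup>2 / 4 - 2 * real d / 3)) / 2"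
  note uv = inverse_root[OF assms(10), folded u_def v_def]
  let ?f = "fps_X - fps_const (real c / 2) * fps_X ^ 2 + fps_const (real d / 6) * fps_X ^ 3"
  define g where "g = fps_inv ?f"
  have g: "g - fps_const (u + v) * g ^ 2 + fps_const (u * v) * g ^ 3 = fps_X" "g $ 0 = 0"
    unfolding uv(3,4) g_def by (rule fps_inv_cubic)+
  have ge: "fps_X $ n \<le> (?G - fps_const (u + v) * ?G ^ 2 + fps_const (u * v) * ?G ^ 3) $ n" for n
    using gen_series_ge[OF R gen, of n] unfolding uv(3,4) c d .
  have gG: "0 \<le> g $ n \<and> g $ n \<le> ?G $ n" for n
    by (rule fps_cubic_comparison[OF uv(1,2) G0 g(2) G_nonneg ge g(1)])
  \<comment> \<open>The quadratic equation with coefficient \<open>w\<close> is the cubic one with \<open>d = 0\<close>.\<close>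
  have "\<exists>h. h - fps_const w * h ^ 2 = fps_X \<and> h $ 0 = 0" for w :: real
    using fps_inv_cubic[of w 0] by auto
  then obtain h where h: "\<And>w::real. h w - fps_const w * h w ^ 2 = fps_X" "\<And>w. h w $ 0 = 0"
    by metis
  have h_coeff: "h w $ (n + 1) * fact (n + 1) = fact (2 * n) / fact n * w ^ n" for n w
    using fps_quadratic_coeff[OF h(2,1), of w n] by simp
  have hg: "h u $ n \<le> g $ n" for n
  proof -
    have "fps_X $ k \<le> (g - fps_const (u + 0) * g ^ 2 + fps_const (u * 0) * g ^ 3) $ k" for k
    proof -
      let ?i = "inverse (1 - fps_const v * g)"
      have "g * (1 - fps_const u * g) * (1 - fps_const v * g) = fps_X"
        using g(1) unfolding fps_cubic_factor .
      moreover have "(1 - fps_const v * g) * ?i = 1"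
        by (rule inverse_mult_eq_1') (simp add: g(2))
      then have "g * (1 - fps_const u * g) = g * (1 - fps_const u * g) * (1 - fps_const v * g) * ?i"
        by (simp only: mult.assoc mult_1_right)
      ultimately have "g * (1 - fps_const u * g) = fps_X * ?i" by (simp only:)
      then have eq: "g - fps_const (u + 0) * g ^ 2 + fps_const (u * 0) * g ^ 3 = fps_X * ?i"
        unfolding fps_cubic_factor by simp
      have "0 \<le> ?i $ j" for j
        using fps_inverse_one_minus_mono[OF uv(2) g(2) g(2), of j] gG by simp
      moreover have "?i $ 0 = 1" by (simp add: g(2))
      ultimately show ?thesis
        unfolding eq fps_X_nth fps_X_mult_nth by (cases "k = 1") (simp_all add: g(2))
    qed
    then show ?thesis
      using fps_cubic_comparison[of u 0 g "h u" n] uv(1) g(2) h gG by auto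
  qed
  have Gh: "?G $ n \<le> h (real c / 2) $ n" for n
    by (rule fps_quadratic_upper[OF _ G0 h(2) G_nonneg _ h(1)])
      (use gen_series_le in \<open>simp_all add: c\<close>)
  have dim_eq: "real (dim (ops P (n + 1))) = ?G $ (n + 1) * fact (n + 1)" for n
    by (simp add: G)
  show ?thesis
  proof (intro conjI allI impI)
    show "fps_inv ?f $ n \<le> ?G $ n" for n using gG[of n] by (simp add: g_def)
    fix n :: nat
    have "root\<^sub>1 (real c) (real d) powi (- int n) = u ^ n"
      using uv(5) by (simp add: power_int_minus power_inverse flip: uv(5))
    then show "fact (2 * n) / fact n * root\<^sub>1 (real c) (real d) powi (- int n)
        \<le> real (dim (ops P (n + 1)))"
      unfolding dim_eq h_coeff[symmetric] using order_trans[OF hg conjunct2[OF gG]]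
      by (simp only: h_coeff[symmetric]) (intro mult_right_mono, auto)
    show "real (dim (ops P (n + 1))) \<le> fact (2 * n) / fact n * (real c / 2) ^ n"
      unfolding dim_eq h_coeff[symmetric] by (intro mult_right_mono Gh) simp
  qed
qed

end
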